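(* Let $s\ge0$, $1\le p<\infty$ and $0<q\le\infty$. Then: (1) if $s>0$, there is no reverse Carleson measure for $HB_s^{p,q}$; (2) if $p\ge2$ and $q\ge p$, a finite positive Borel measure $\mu$ on $\overline{\mathbb{D}}$ is a reverse Carleson measure for $HB_0^{p,q}$ if and only if there is $c>0$ with $\mu(I)\ge c|I|$ for every arc $I\subset\partial\mathbb{D}$; (3) if $p\ge2$ and $q<p$, there is no reverse Carleson measure for $HB_0^{p,q}$; (4) if $p<2$ and $q\ge2$, $\mu$ is a reverse Carleson measure for $HB_0^{p,q}$ if and only if there is $c>0$ with $\mu(I)\ge c|I|$ for every arc $I\subset\partial\mathbb{D}$; (5) if $p<2$ and $q<2$, there is no reverse Carleson measure for $HB_0^{p,q}$.
   Context: For $0<p,q<\infty$, $s\ge0$ and an integer $m>s$, the holomorphic Besov space $HB_s^{p,q}$ consists of holomorphic $f$ on $\mathbb{D}$ with quasinorm $\|f\|_{HB_s^{p,q}}=\sum_{j=0}^{m-1}|f^{(j)}(0)|+\big(\int_0^1(\|f^{(m)}(re^{2\pi i\cdot})\|_{L^p(\mathbb{T})}(1-r)^{m-s-1/q})^q\,dr\big)^{1/q}<\infty$ (different admissible $m$ give equivalent quasinorms); for $q=\infty$ the integral is replaced by $\sup_{0<r<1}\|f^{(m)}(re^{2\pi i\cdot})\|_{L^p(\mathbb{T})}(1-r)^{m-s}$. A finite positive Borel measure $\mu$ on $\overline{\mathbb{D}}$ is a reverse Carleson measure for $HB_s^{p,q}$ if there is $C>0$ with $\|f\|_{HB_s^{p,q}}\le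 C\|f\|_{L^p(\overline{\mathbb{D}},\mu)}$ for all $f\in HB_s^{p,q}\cap C(\overline{\mathbb{D}})$. $|I|$ denotes normalized arc-length. *)

theory Defs
  imports "HOL-Analysis.Analysis"
begin

definition circle_arc :: "real \<Rightarrow> real \<Rightarrow> complex set" where
  "circle_arc a l = (\<lambda>t. cis (2 * pi * t)) ` {a..a + l}"

definition disc_measure :: "complex measure \<Rightarrow> bool" where
  "disc_measure \<mu> \<longleftrightarrow> sets \<mu> = sets borel \<and> finite_measure \<mu> \<and>
     emeasure \<mu> (UNIV - cball 0 1) = 0"

text \<open>The admissible integer m > s used to define the quasinorm
  (different admissible m give equivalent quasinorms).\<close>
definition besov_m :: "real \<Rightarrow> nat" where
  "besov_m s = nat \<lfloor>s\<rfloor> + 1"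

definition circ_Lp :: "real \<Rightarrow> (complex \<Rightarrow> complex) \<Rightarrow> real \<Rightarrow> real" where
  "circ_Lp p g r =
     (\<integral>t\<in>{0..1}. norm (g (complex_of_real r * cis (2 * pi * t))) powr p \<partial>lborel) powr (1 / p)"

definition besov_part :: "real \<Rightarrow> real \<Rightarrow> ereal \<Rightarrow> (complex \<Rightarrow> complex) \<Rightarrow> ennreal" where
  "besov_part s p q f =
     (let m = besov_m s in
      if q = \<infinity> then
        (SUP r\<in>{0<..<1}. ennreal (circ_Lp p ((deriv ^^ m) f) r * (1 - r) powr (real m - s)))
      else
        (\<integral>\<^sup>+ r\<in>{0<..<1}.
           ennreal ((circ_Lp p ((deriv ^^ m) f) r * (1 - r) powr (real m - s - 1 / real_of_ereal q))
                    powr real_of_ereal q) \<partial>lborel))"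

definition HB :: "real \<Rightarrow> real \<Rightarrow> ereal \<Rightarrow> (complex \<Rightarrow> complex) set" where
  "HB s p q = {f. f holomorphic_on ball 0 1 \<and> besov_part s p q f < \<infinity>}"

definition HB_norm :: "real \<Rightarrow> real \<Rightarrow> ereal \<Rightarrow> (complex \<Rightarrow> complex) \<Rightarrow> real" where
  "HB_norm s p q f =
     (\<Sum>j<besov_m s. norm ((deriv ^^ j) f 0)) +
     (if q = \<infinity> then enn2real (besov_part s p q f)
      else enn2real (besov_part s p q f) powr (1 / real_of_ereal q))"

definition Lp_mu :: "complex measure \<Rightarrow> real \<Rightarrow> (complex \<Rightarrow> complex) \<Rightarrow> real" where
  "Lp_mu \<mu> p f = enn2real (\<integral>\<^sup>+ z\<in>cball 0 1. ennreal (norm (f z) powr p) \<partial>\<mu>) powr (1 / p)"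

definition reverse_carleson :: "real \<Rightarrow> real \<Rightarrow> ereal \<Rightarrow> complex measure \<Rightarrow> bool" where
  "reverse_carleson s p q \<mu> \<longleftrightarrow>
     (\<exists>C>0. \<forall>f. f \<in> HB s p q \<and> continuous_on (cball 0 1) f \<longrightarrow>
                 HB_norm s p q f \<le> C * Lp_mu \<mu> p f)"

definition arc_lower_bound :: "complex measure \<Rightarrow> bool" where
  "arc_lower_bound \<mu> \<longleftrightarrow>
     (\<exists>c>0. \<forall>a l. 0 \<le> l \<and> l \<le> 1 \<longrightarrow> c * l \<le> measure \<mu> (circle_arc a l))"

end

theory Submission
  imports Defs "HOL-Complex_Analysis.Complex_Analysis" "HOL-Real_Asymp.Real_Asymp"
begin

text \<open>Testing a holomorphic F against the Poisson kernel times a + b/\<lambda> - cnj b \<lambda>, where \<lambda> is the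
  disc automorphism vanishing at x and \<bar>a\<bar>^2 + 4 \<bar>b\<bar>^2 = 1, gives
  sqrt(\<bar>F(x)\<bar>^2 + ((1 - x^2)/2)^2 \<bar>F'(x)\<bar>^2) \<le> P[\<bar>F\<bar>](x).
  Averaging over rotations (Jensen, then Minkowski with exponent q/p) turns this, for q \<ge> max(p, 2), into
  M_p(r, f)^q + ((R - r)/2)^q M_p(r, f')^q \<le> M_p(R, f)^q. With R = (1 + r)/2 the sum over scales
  telescopes, so the Besov norm is dominated by the Hardy norm, and the arc condition dominates the
  latter by the norm of L^p(\<mu>).

  Conversely, replacing g by z^n g with n large kills the mass of \<mu> inside the disc but not the Besov
  norm of order 0, and moduli of polynomials are dense in the nonnegative continuous functions on the
  circle; this yields the arc condition. For s > 0 the monomials z^n alone are a counterexample. If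
  q < max(p, 2), frequency-separated blocks have Besov norms adding in the l^q sense, whereas their
  L^p(\<mu>) norms stay of size N^(1/2) for monomials with well chosen signs, and bounded for N bumps
  with essentially disjoint supports.\<close>

subsection \<open>Circle means and the Poisson kernel\<close>

text \<open>Why max(p, 2) is the threshold: the pointwise gain is an l^2 sum, because on the circle
  the test function is a real constant plus a purely imaginary function, so its modulus is bounded
  by Pythagoras. The term in \<lambda> is there only for this: F times the Poisson kernel times
  \<lambda> has mean zero, so adding it costs nothing. Weakening l^2 to l^q needs q \<ge> 2, and
  Minkowski with exponent q/p needs q \<ge> p. Otherwise p \<ge> 1 is arbitrary, and p = 1 needs no
  separate treatment. In the negative results \<open>\<mu>\<close> is an arbitrary finite measure,
  so a counterexample may rely only on bounds valid at every point of the closed disc, or on an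
  average over signs that is controlled pointwise.\<close>

definition circ_mean :: "(complex \<Rightarrow> 'a::euclidean_space) \<Rightarrow> 'a" where
  "circ_mean \<phi> = integral {0..1} (\<lambda>t. \<phi> (cis (2 * pi * t)))"

lemma continuous_on_circ:
  assumes "continuous_on (sphere 0 1) \<phi>"
  shows "continuous_on S (\<lambda>t. \<phi> (cis (2 * pi * t)))"
  by (rule continuous_on_compose2[OF assms]) (auto intro!: continuous_intros)

lemma integrable_circ:
  fixes \<phi> :: "complex \<Rightarrow> 'a::banach"
  assumes "continuous_on (sphere 0 1) \<phi>"
  shows "(\<lambda>t. \<phi> (cis (2 * pi * t))) integrable_on {a..b}"
  by (rule integrable_continuous_interval) (rule continuous_on_circ[OF assms])

lemma circ_mean_cong:
  assumes "\<And>w. norm w = 1 \<Longrightarrow> \<phi> w = \<psi> w"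
  shows "circ_mean \<phi> = circ_mean \<psi>"
  unfolding circ_mean_def by (rule integral_cong) (simp add: assms)

lemma circ_mean_mono:
  fixes \<phi> \<psi> :: "complex \<Rightarrow> real"
  assumes "continuous_on (sphere 0 1) \<phi>" "continuous_on (sphere 0 1) \<psi>"
    and "\<And>w. norm w = 1 \<Longrightarrow> \<phi> w \<le> \<psi> w"
  shows "circ_mean \<phi> \<le> circ_mean \<psi>"
  unfolding circ_mean_def by (intro integral_le integrable_circ assms) simp

lemma circ_mean_const [simp]: "circ_mean (\<lambda>w. c) = c"
  by (simp add: circ_mean_def)

lemma circ_mean_nonneg:
  fixes \<phi> :: "complex \<Rightarrow> real"
  assumes "\<And>w. norm w = 1 \<Longrightarrow> 0 \<le> \<phi> w"
  shows "0 \<le> circ_mean \<phi>"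
  unfolding circ_mean_def
  by (cases "(\<lambda>t. \<phi> (cis (2 * pi * t))) integrable_on {0..1}")
    (auto intro!: integral_nonneg assms simp: not_integrable_integral)

lemma circ_mean_add:
  assumes "continuous_on (sphere 0 1) \<phi>" "continuous_on (sphere 0 1) \<psi>"
  shows "circ_mean (\<lambda>w. \<phi> w + \<psi> w) = circ_mean \<phi> + circ_mean \<psi>"
  unfolding circ_mean_def by (intro integral_add integrable_circ assms)

lemma circ_mean_cmult:
  fixes \<phi> :: "complex \<Rightarrow> 'a::{euclidean_space,real_normed_field}"
  shows "circ_mean (\<lambda>w. c * \<phi> w) = c * circ_mean \<phi>"
  unfolding circ_mean_def by simp

lemma norm_circ_mean_le:
  assumes "continuous_on (sphere 0 1) \<phi>"
  shows "norm (circ_mean \<phi>) \<le> circ_mean (\<lambda>w. norm (\<phi> w))"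
  unfolding circ_mean_def
  by (intro integral_norm_bound_integral integrable_circ assms continuous_intros) auto

text \<open>The integrand has period 1. An integer shift moves the left end into [0, 1]; the part
  beyond 1 is then shifted back by 1 to fill the gap at the left.\<close>

lemma circ_mean_interval:
  assumes "continuous_on (sphere 0 1) \<phi>"
  shows "integral {a..a+1} (\<lambda>t. \<phi> (cis (2 * pi * t))) = circ_mean \<phi>"
proof -
  let ?h = "\<lambda>t. \<phi> (cis (2 * pi * t))"
  have int: "?h integrable_on {x..y}" for x y by (rule integrable_circ[OF assms])
  have per: "cis (2 * pi * (t + of_int k)) = cis (2 * pi * t)" for t k
  proof -
    have "2 * pi * (t + of_int k) = 2 * pi * t + 2 * pi * of_int k" by (simp add: algebra_simps)
    then show ?thesis by (simp flip: cis_mult)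
  qed
  have shift: "integral {x + of_int k..y + of_int k} ?h = integral {x..y} ?h" for x y and k :: int
    using integral_shift_real_ivl[of "x + of_int k" "of_int k" "y + of_int k" ?h]
    by (simp add: per)
  define k where "k = \<lfloor>a\<rfloor>"
  define s where "s = a - of_int k"
  have s: "0 \<le> s" "s \<le> 1" unfolding s_def k_def by linarith+
  have "integral {a..a+1} ?h = integral {s..s+1} ?h"
    using shift[of s k "s+1"] by (simp add: s_def algebra_simps)
  also have "\<dots> = integral {s..1} ?h + integral {1..s+1} ?h"
    using s by (intro Henstock_Kurzweil_Integration.integral_combine[symmetric] int) auto
  also have "integral {1..s+1} ?h = integral {0..s} ?h"
    using shift[of 0 1 s] by simp
  also have "integral {s..1} ?h + integral {0..s} ?h = integral {0..1} ?h"
    using s by (subst add.commute) (intro Henstock_Kurzweil_Integration.integral_combine int; auto)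
  finally show ?thesis by (simp add: circ_mean_def)
qed

lemma circ_mean_rotate:
  assumes "continuous_on (sphere 0 1) \<phi>" "norm u = 1"
  shows "circ_mean (\<lambda>w. \<phi> (u * w)) = circ_mean \<phi>"
proof -
  obtain \<theta> where \<theta>: "u = cis \<theta>"
    using assms(2) by (metis complex_norm_eq_1_exp_eq cis_conv_exp)
  define s where "s = \<theta> / (2 * pi)"
  have "2 * pi * (t + s) = \<theta> + 2 * pi * t" for t by (simp add: s_def algebra_simps)
  then have u: "u * cis (2 * pi * t) = cis (2 * pi * (t + s))" for t
    by (simp add: \<theta> cis_mult)
  have "circ_mean (\<lambda>w. \<phi> (u * w)) = integral {s-s..(s+1)-s} (\<lambda>t. \<phi> (cis (2 * pi * (t + s))))"
    by (simp add: circ_mean_def u)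
  also have "\<dots> = integral {s..s+1} (\<lambda>t. \<phi> (cis (2 * pi * t)))"
    by (rule integral_shift_real_ivl)
  finally show ?thesis using circ_mean_interval[OF assms(1)] by simp
qed

lemma circ_mean_swap:
  fixes G :: "complex \<Rightarrow> complex \<Rightarrow> real"
  assumes "continuous_on (sphere 0 1 \<times> sphere 0 1) (\<lambda>(u,w). G u w)"
  shows "circ_mean (\<lambda>u. circ_mean (G u)) = circ_mean (\<lambda>w. circ_mean (\<lambda>u. G u w))"
proof -
  have "continuous_on (cbox (0, 0) (1, 1)) (\<lambda>x. (\<lambda>(u,w). G u w) (cis (2 * pi * fst x), cis (2 * pi * snd x)))"
    by (rule continuous_on_compose2[OF assms]) (auto intro!: continuous_intros)
  then show ?thesis
    using integral_swap_continuous[of 0 0 1 1 "\<lambda>s t. G (cis (2 * pi * s)) (cis (2 * pi * t))"]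
    by (simp add: circ_mean_def case_prod_unfold)
qed

lemma continuous_on_circ_mean:
  assumes "continuous_on (R \<times> sphere 0 1) (\<lambda>(r,w). G r w)"
  shows "continuous_on R (\<lambda>r. circ_mean (G r))"
proof -
  have "continuous_on (R \<times> cbox 0 1) (\<lambda>x. (\<lambda>(r,w). G r w) (fst x, cis (2 * pi * snd x)))"
    by (rule continuous_on_compose2[OF assms]) (auto intro!: continuous_intros)
  then show ?thesis
    using integral_continuous_on_param[of R 0 "1::real" "\<lambda>r t. G r (cis (2 * pi * t))"]
    by (simp add: circ_mean_def case_prod_unfold)
qed

section \<open>Cauchy formulas as means over the circle\<close>

lemma contour_integral_eq_circ_mean:
  assumes "(g has_contour_integral (2 * of_real pi * \<i> * I)) (circlepath 0 1)"
  shows "circ_mean (\<lambda>w. g w * w) = I"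
proof -
  \<comment> \<open>On the unit circle dw = 2 pi i w dt, whence the extra factor w in the
    mean.\<close>
  have 1: "((\<lambda>x. g (cis (2*pi*x)) * (2 * pi * \<i> * cis (2 * pi * x))) has_integral (2 * of_real pi * \<i> * I)) {0..1}"
    using assms unfolding has_contour_integral vector_derivative_circlepath
    by (simp add: circlepath cis_conv_exp mult_ac)
  have "((\<lambda>x. inverse (2 * of_real pi * \<i>) * (g (cis (2*pi*x)) * (2 * pi * \<i> * cis (2 * pi * x)))) has_integral
     inverse (2 * of_real pi * \<i>) * (2 * of_real pi * \<i> * I)) {0..1}"
    by (rule has_integral_mult_right[OF 1])
  then have "((\<lambda>x. g (cis (2*pi*x)) * cis (2 * pi * x)) has_integral I) {0..1}"
    by (simp add: field_simps)
  then show ?thesis unfolding circ_mean_def by (rule integral_unique)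
qed

context
  fixes F :: "complex \<Rightarrow> complex"
  assumes cont: "continuous_on (cball 0 1) F" and hol: "F holomorphic_on ball 0 1"
begin

lemma circ_mean_Cauchy:
  assumes "norm z < 1"
  shows "circ_mean (\<lambda>w. F w / (w - z) * w) = F z"
  using contour_integral_eq_circ_mean[OF Cauchy_integral_circlepath[OF cont hol]] assms by simp

lemma circ_mean_Cauchy_deriv:
  assumes "norm z < 1"
  shows "circ_mean (\<lambda>w. F w / (w - z)\<^sup>2 * w) = deriv F z"
proof -
  have z: "z \<in> ball 0 1" using assms by simp
  note C = Cauchy_derivative_integral_circlepath[OF cont hol z]
  have "contour_integral (circlepath 0 1) (\<lambda>u. F u / (u - z)\<^sup>2) = 2 * of_real pi * \<i> * deriv F z"
    using DERIV_imp_deriv[OF C(2)] by simp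
  then have "((\<lambda>u. F u / (u - z)\<^sup>2) has_contour_integral (2 * of_real pi * \<i> * deriv F z)) (circlepath 0 1)"
    using has_contour_integral_integral[OF C(1)] by simp
  then show ?thesis by (rule contour_integral_eq_circ_mean)
qed

lemma circ_mean_centre: "circ_mean F = F 0"
proof -
  have "circ_mean F = circ_mean (\<lambda>w. F w / (w - 0) * w)"
    by (rule circ_mean_cong) auto
  then show ?thesis using circ_mean_Cauchy[of 0] by simp
qed

end

text \<open>The Poisson kernel of a point x on the real diameter: on the circle |1 - x w| = |w - x|
  because x is real. Real points suffice, since rotating F brings every point of the disc to the
  diameter.\<close>

definition poisson :: "real \<Rightarrow> complex \<Rightarrow> real" where
  "poisson x w = (1 - x\<^sup>2) / (norm (1 - x * w))\<^sup>2"

lemma poisson_denominator: "norm w = 1 \<Longrightarrow> \<bar>x\<bar> < 1 \<Longrightarrow> 1 - complex_of_real x * w \<noteq> 0"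
proof
  assume "norm w = 1" "\<bar>x\<bar> < 1" "1 - complex_of_real x * w = 0"
  then have "norm (complex_of_real x * w) = 1" by (metis eq_iff_diff_eq_0 norm_one)
  then show False using \<open>norm w = 1\<close> \<open>\<bar>x\<bar> < 1\<close> by (simp add: norm_mult)
qed

lemma continuous_on_poisson: "\<bar>x\<bar> < 1 \<Longrightarrow> continuous_on (sphere 0 1) (poisson x)"
  unfolding poisson_def
  by (intro continuous_intros ballI) (use poisson_denominator in auto)

lemma poisson_nonneg: "\<bar>x\<bar> < 1 \<Longrightarrow> 0 \<le> poisson x w"
  by (simp add: poisson_def abs_square_le_1)

lemma poisson_eq:
  assumes "norm w = 1" "\<bar>x\<bar> < 1"
  shows "complex_of_real (poisson x w) = (1 - x\<^sup>2) * w / ((w - x) * (1 - x * w))"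
proof -
  have w: "w * cnj w = 1" "w \<noteq> 0"
    using assms(1) by (auto simp: complex_norm_square[symmetric])
  have "w - x = w * cnj (1 - x * w)"
    using w by (simp add: algebra_simps)
  then show ?thesis
    using poisson_denominator[OF assms] w
    by (simp add: poisson_def complex_norm_square mult_ac del: complex_cnj_diff complex_cnj_mult of_real_power flip: of_real_power)
qed

lemma mobius_circle:
  assumes "norm w = 1" "\<bar>x\<bar> < 1"
  shows "norm ((w - x) / (1 - complex_of_real x * w)) = 1"
proof -
  have w: "w * cnj w = 1" using assms(1) by (auto simp: complex_norm_square[symmetric])
  have "w - x = w * cnj (1 - x * w)"
    using w by (simp add: algebra_simps)
  then have "norm (w - x) = norm (1 - complex_of_real x * w)"
    using assms(1) by (metis norm_mult complex_mod_cnj mult_1)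
  then show ?thesis using poisson_denominator[OF assms] by (simp add: norm_divide)
qed

text \<open>On the circle the kernel equals the rational function (1 - x^2) w / ((w - x)(1 - x w)).
  Dividing by \<open>lam\<close> makes the pole at x double, hence the derivative; multiplying by
  \<open>lam\<close> removes the pole, and the mean is the value at 0, which the factor w makes
  vanish.\<close>

lemma circ_mean_poisson:
  fixes F :: "complex \<Rightarrow> complex"
  assumes cont: "continuous_on (cball 0 1) F" and hol: "F holomorphic_on ball 0 1"
    and x: "\<bar>x\<bar> < 1"
  defines "lam \<equiv> \<lambda>w. (w - x) / (1 - complex_of_real x * w)"
  shows "circ_mean (\<lambda>w. F w * poisson x w) = F x"
    and "circ_mean (\<lambda>w. F w * poisson x w / lam w) = complex_of_real (1 - x\<^sup>2) * deriv F x"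
    and "circ_mean (\<lambda>w. F w * poisson x w * lam w) = 0"
proof -
  have nz: "1 - complex_of_real x * w \<noteq> 0" if "norm w \<le> 1" for w
  proof
    assume "1 - complex_of_real x * w = 0"
    then have "norm (complex_of_real x * w) = 1" by (metis eq_iff_diff_eq_0 norm_one)
    moreover have "norm (complex_of_real x * w) \<le> \<bar>x\<bar> * 1"
      using that by (simp add: norm_mult mult_left_le)
    ultimately show False using x by simp
  qed
  have nz2: "w - complex_of_real x \<noteq> 0" if "norm w = 1" for w
    using that x by auto
  have xx: "1 - complex_of_real x * complex_of_real x \<noteq> 0" using nz[of x] x by simp
  have "circ_mean (\<lambda>w. F w * poisson x w) = circ_mean (\<lambda>w. complex_of_real (1 - x\<^sup>2) * F w / (1 - x * w) / (w - x) * w)"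
    by (rule circ_mean_cong) (simp add: poisson_eq x mult_ac)
  also have "\<dots> = complex_of_real (1 - x\<^sup>2) * F x / (1 - complex_of_real x * x)"
    by (rule circ_mean_Cauchy)
      (use nz x in \<open>auto intro!: continuous_intros holomorphic_intros cont hol\<close>)
  also have "\<dots> = F x" using xx by (simp add: power2_eq_square)
  finally show "circ_mean (\<lambda>w. F w * poisson x w) = F x" .
  have "circ_mean (\<lambda>w. F w * poisson x w / lam w) = circ_mean (\<lambda>w. complex_of_real (1 - x\<^sup>2) * (F w / (w - x)\<^sup>2 * w))"
  proof (rule circ_mean_cong)
    fix w :: complex assume "norm w = 1"
    then show "F w * poisson x w / lam w = complex_of_real (1 - x\<^sup>2) * (F w / (w - x)\<^sup>2 * w)"
      using nz[of w] nz2[of w] by (simp add: poisson_eq x lam_def power2_eq_square)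
  qed
  also have "\<dots> = complex_of_real (1 - x\<^sup>2) * deriv F x"
    unfolding circ_mean_cmult using circ_mean_Cauchy_deriv[OF cont hol, of "complex_of_real x"] x by simp
  finally show "circ_mean (\<lambda>w. F w * poisson x w / lam w) = complex_of_real (1 - x\<^sup>2) * deriv F x" .
  have "circ_mean (\<lambda>w. F w * poisson x w * lam w) = circ_mean (\<lambda>w. complex_of_real (1 - x\<^sup>2) * F w * w / (1 - x * w)\<^sup>2)"
  proof (rule circ_mean_cong)
    fix w :: complex assume "norm w = 1"
    then show "F w * poisson x w * lam w = complex_of_real (1 - x\<^sup>2) * F w * w / (1 - x * w)\<^sup>2"
      using nz[of w] nz2[of w] by (simp add: poisson_eq x lam_def power2_eq_square)
  qed
  also have "\<dots> = complex_of_real (1 - x\<^sup>2) * F 0 * 0 / (1 - complex_of_real x * 0)\<^sup>2"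
    by (rule circ_mean_centre)
      (use nz x in \<open>auto intro!: continuous_intros holomorphic_intros cont hol\<close>)
  finally show "circ_mean (\<lambda>w. F w * poisson x w * lam w) = 0" by simp
qed

lemma circ_mean_poisson_1: "\<bar>x\<bar> < 1 \<Longrightarrow> circ_mean (poisson x) = 1"
proof -
  assume x: "\<bar>x\<bar> < 1"
  have "circ_mean (\<lambda>w. complex_of_real (poisson x w)) = 1"
    using circ_mean_poisson(1)[of "\<lambda>_. 1" x] x by simp
  moreover have "circ_mean (\<lambda>w. complex_of_real (poisson x w)) = of_real (circ_mean (poisson x))"
    using integral_linear[OF integrable_circ[OF continuous_on_poisson[OF x]] bounded_linear_of_real, of 0 1]
    by (simp add: circ_mean_def o_def)
  ultimately show ?thesis by (metis of_real_eq_1_iff)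
qed

lemma continuous_on_powr_nonneg:
  fixes f :: "'a::topological_space \<Rightarrow> real"
  assumes "continuous_on S f" "\<And>x. x \<in> S \<Longrightarrow> 0 \<le> f x" "0 < p"
  shows "continuous_on S (\<lambda>x. f x powr p)"
  using assms by (intro continuous_on_powr' continuous_on_const) auto

text \<open>Duality: any h with |h| \<le> 1 on the circle bounds the modulus of the mean of F P h by
  the right-hand side, where P is the kernel. The \<open>h\<close> below is chosen so that this
  mean, after multiplication by a phase \<open>om\<close>, is the left-hand side itself.\<close>

lemma poisson_point_evaluation_bound:
  fixes F :: "complex \<Rightarrow> complex"
  assumes cont: "continuous_on (cball 0 1) F" and hol: "F holomorphic_on ball 0 1"
    and x: "\<bar>x\<bar> < 1"
  shows "sqrt ((norm (F x))\<^sup>2 + ((1 - x\<^sup>2) / 2 * norm (deriv F x))\<^sup>2)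
           \<le> circ_mean (\<lambda>w. norm (F w) * poisson x w)"
proof -
  define A where "A = norm (F x)"
  define B where "B = (1 - x\<^sup>2) / 2 * norm (deriv F x)"
  define S where "S = sqrt (A\<^sup>2 + B\<^sup>2)"
  have x2: "x\<^sup>2 < 1" using x by (simp add: abs_square_less_1)
  have contF: "continuous_on (sphere 0 1) F"
    using cont by (rule continuous_on_subset) auto
  have nn: "0 \<le> circ_mean (\<lambda>w. norm (F w) * poisson x w)"
    by (rule circ_mean_nonneg) (simp add: poisson_nonneg x)
  show ?thesis
  proof (cases "S = 0")
    case True
    then show ?thesis using nn unfolding S_def A_def B_def by linarith
  next
    case False
    then have S: "S > 0" by (simp add: S_def less_le)
    have SS: "S\<^sup>2 = A\<^sup>2 + B\<^sup>2" by (simp add: S_def)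
    obtain om where om: "norm om = 1" "om * F x = of_real A"
    proof (cases "F x = 0")
      case True then show ?thesis using that[of 1] by (simp add: A_def)
    next
      case False
      then have "norm (cnj (F x) / of_real A) = 1" by (simp add: A_def norm_divide)
      moreover have "cnj (F x) / of_real A * F x = of_real A"
        using False by (simp add: A_def mult.commute[of "cnj _"] power2_eq_square flip: complex_norm_square)
      ultimately show ?thesis by (rule that)
    qed
    define a where "a = complex_of_real (A / S)"
    \<comment> \<open>The conjugate aligns the phase of the derivative term with that of
      \<open>om * F x\<close>. The constant makes |b| = B/(2S) and the derivative term B^2/S, so
      that together with A^2/S it adds up to S.\<close>
    define b where "b = cnj (om * deriv F x) * of_real ((1 - x\<^sup>2) / (4 * S))"
    define lam where "lam = (\<lambda>w. (w - complex_of_real x) / (1 - complex_of_real x * w))"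
    define h where "h w = a + b / lam w - cnj b * lam w" for w
    have normb: "norm b = B / (2 * S)"
      using S x2 om(1) unfolding b_def B_def complex_mod_cnj norm_mult norm_of_real by simp
    have lam1: "norm (lam w) = 1" if "norm w = 1" for w :: complex
      unfolding lam_def by (rule mobius_circle[OF that x])
    have h_le: "norm (h w) \<le> 1" if w: "norm w = 1" for w :: complex
    proof -
      define u where "u = cnj b * lam w"
      have "lam w * cnj (lam w) = 1"
        using lam1[OF w] by (simp flip: complex_norm_square)
      then have "1 / lam w = cnj (lam w)"
        by (metis divide_eq_eq mult.commute zero_neq_one mult_zero_left)
      then have "b / lam w = cnj u"
        by (simp add: u_def divide_inverse)
      then have "h w = of_real (A / S) + (cnj u - u)" by (simp add: h_def a_def u_def)
      then have "(norm (h w))\<^sup>2 = (A / S)\<^sup>2 + (2 * Im u)\<^sup>2"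
        by (simp add: cmod_power2)
      also have "\<dots> \<le> (A / S)\<^sup>2 + (2 * norm u)\<^sup>2"
      proof -
        have "(Im u)\<^sup>2 \<le> (norm u)\<^sup>2" using abs_Im_le_cmod[of u] by (metis abs_norm_cancel power2_abs power_mono abs_ge_zero)
        then show ?thesis by (simp add: power_mult_distrib)
      qed
      also have "norm u = B / (2 * S)" using lam1[OF w] normb by (simp add: u_def norm_mult)
      also have "(A / S)\<^sup>2 + (2 * (B / (2 * S)))\<^sup>2 = 1"
      proof -
        have "(A / S)\<^sup>2 + (2 * (B / (2 * S)))\<^sup>2 = (A\<^sup>2 + B\<^sup>2) / S\<^sup>2"
          using S by (simp add: power_divide add_divide_distrib)
        also have "\<dots> = 1" unfolding SS[symmetric] using S by simp
        finally show ?thesis .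
      qed
      finally show ?thesis by (simp add: abs_square_le_1 power_le_one_iff)
    qed
    have contP: "continuous_on (sphere 0 1) (\<lambda>w. complex_of_real (poisson x w))"
      by (intro continuous_intros continuous_on_poisson x)
    have lam_nz: "lam w \<noteq> 0" if "norm w = 1" for w :: complex using lam1[OF that] by auto
    have contl: "continuous_on (sphere 0 1) lam"
      unfolding lam_def using poisson_denominator[OF _ x] by (auto intro!: continuous_intros)
    have conth: "continuous_on (sphere 0 1) h"
      unfolding h_def by (intro continuous_intros contl) (auto simp: lam_nz)
    have "circ_mean (\<lambda>w. om * (F w * poisson x w) * h w) =
        circ_mean (\<lambda>w. (om * a) * (F w * poisson x w) + ((om * b) * (F w * poisson x w / lam w)
             + (- om * cnj b) * (F w * poisson x w * lam w)))"
      by (rule circ_mean_cong) (simp add: h_def algebra_simps)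
    also have "\<dots> = (om * a) * circ_mean (\<lambda>w. F w * poisson x w) + ((om * b) * circ_mean (\<lambda>w. F w * poisson x w / lam w)
             + (- om * cnj b) * circ_mean (\<lambda>w. F w * poisson x w * lam w))"
    proof -
      have c: "continuous_on (sphere 0 1) (\<lambda>w. F w * poisson x w)"
        by (intro continuous_intros contF contP)
      have cl: "continuous_on (sphere 0 1) (\<lambda>w. F w * poisson x w / lam w)"
        by (intro continuous_on_divide c contl) (simp add: lam_nz)
      have cr: "continuous_on (sphere 0 1) (\<lambda>w. F w * poisson x w * lam w)"
        by (intro continuous_on_mult c contl)
      show ?thesis
        unfolding circ_mean_cmult[symmetric]
        by (simp only: circ_mean_add continuous_on_add continuous_on_mult continuous_on_const c cl cr)
    qed
    also have "\<dots> = om * a * F x + om * b * (of_real (1 - x\<^sup>2) * deriv F x)"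
      unfolding lam_def circ_mean_poisson[OF cont hol x] by simp
    also have "om * a * F x = of_real (A\<^sup>2 / S)"
    proof -
      have "om * a * F x = a * (om * F x)" by (simp only: mult_ac)
      then show ?thesis by (simp add: om a_def power2_eq_square)
    qed
    also have "om * b * (of_real (1 - x\<^sup>2) * deriv F x) = of_real (B\<^sup>2 / S)"
    proof -
      have "om * b * (of_real (1 - x\<^sup>2) * deriv F x) =
          ((om * deriv F x) * cnj (om * deriv F x)) * of_real ((1 - x\<^sup>2) / (4 * S)) * of_real (1 - x\<^sup>2)"
        by (simp add: b_def)
      also have "(om * deriv F x) * cnj (om * deriv F x) = of_real ((norm (deriv F x))\<^sup>2)"
        unfolding complex_norm_square[symmetric] by (simp add: norm_mult om(1))
      also have "complex_of_real ((norm (deriv F x))\<^sup>2) * of_real ((1 - x\<^sup>2) / (4 * S)) * of_real (1 - x\<^sup>2)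
          = of_real (B\<^sup>2 / S)"
        unfolding of_real_mult[symmetric] B_def using S
        by (intro arg_cong[where f=of_real]) (simp add: power2_eq_square field_simps)
      finally show ?thesis .
    qed
    also have "of_real (A\<^sup>2 / S) + of_real (B\<^sup>2 / S) = complex_of_real S"
      unfolding of_real_add[symmetric] add_divide_distrib[symmetric] SS[symmetric]
      using S by (simp add: power2_eq_square)
    finally have "S = norm (circ_mean (\<lambda>w. om * (F w * poisson x w) * h w))"
      using S by simp
    also have "\<dots> \<le> circ_mean (\<lambda>w. norm (om * (F w * poisson x w) * h w))"
      by (intro norm_circ_mean_le continuous_intros contF contP conth)
    also have "\<dots> \<le> circ_mean (\<lambda>w. norm (F w) * poisson x w)"
    proof (rule circ_mean_mono)
      show "norm (om * (F w * poisson x w) * h w) \<le> norm (F w) * poisson x w" if "norm w = 1" for w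
        using h_le[OF that] om(1) poisson_nonneg[OF x, of w]
        by (simp add: norm_mult mult_left_le)
    qed (intro continuous_intros contF contP conth continuous_on_poisson x)+
    finally show ?thesis by (simp add: S_def A_def B_def)
  qed
qed

section \<open>Convexity inequalities for powers and circle means\<close>

lemma powr_ge_tangent:
  fixes x y p :: real
  assumes "0 \<le> x" "0 < y" "1 \<le> p"
  shows "y powr p + p * y powr (p - 1) * (x - y) \<le> x powr p"
proof (cases "x = 0")
  case True
  have "y powr p = y powr (p - 1) * y" using assms by (simp add: powr_mult_base mult.commute)
  then show ?thesis using assms True by (simp add: algebra_simps mult_left_mono)
next
  case False
  then have x: "x > 0" using assms by simp
  \<comment> \<open>Weighted AM-GM of (x/y)^p and 1 with weights 1/p and 1 - 1/p is the tangent
    inequality at 1; scaling by y gives it at y.\<close>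
  have "((x/y) powr p) powr (1/p) * 1 powr (1 - 1/p) \<le> (1/p) * (x/y) powr p + (1 - 1/p) * 1"
    by (rule Youngs_inequality_0) (use assms x in auto)
  then have "x / y \<le> (1/p) * (x/y) powr p + (1 - 1/p)"
    using assms x by (simp add: powr_powr)
  then have "p * (x/y) \<le> (x/y) powr p + (p - 1)"
    using assms mult_left_mono[of "x/y" _ p] by (fastforce simp: algebra_simps)
  then have "y powr p * (p * (x/y)) \<le> y powr p * ((x/y) powr p + (p - 1))"
    by (intro mult_left_mono) auto
  moreover have "y powr p * (x/y) powr p = x powr p"
    using assms x by (simp add: powr_mult[symmetric])
  moreover have "y powr p * (p * (x/y)) = p * y powr (p - 1) * x"
    using assms by (simp add: powr_diff field_simps)
  moreover have "y powr p = y powr (p - 1) * y" using assms by (simp add: powr_diff)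
  ultimately show ?thesis by (simp add: algebra_simps)
qed

lemma circ_mean_jensen:
  fixes u P :: "complex \<Rightarrow> real"
  assumes "continuous_on (sphere 0 1) u" "continuous_on (sphere 0 1) P"
    and u: "\<And>w. norm w = 1 \<Longrightarrow> 0 \<le> u w" and P: "\<And>w. norm w = 1 \<Longrightarrow> 0 \<le> P w"
    and P1: "circ_mean P = 1" and p: "1 \<le> p"
  shows "circ_mean (\<lambda>w. u w * P w) powr p \<le> circ_mean (\<lambda>w. u w powr p * P w)"
proof -
  define y where "y = circ_mean (\<lambda>w. u w * P w)"
  have "0 \<le> y" unfolding y_def by (intro circ_mean_nonneg mult_nonneg_nonneg u P)
  have contp: "continuous_on (sphere 0 1) (\<lambda>w. u w powr p)"
    using p by (intro continuous_on_powr_nonneg assms(1)) (auto simp: u)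
  show ?thesis
  proof (cases "y = 0")
    case True
    then show ?thesis using P
      by (simp add: y_def[symmetric]) (intro circ_mean_nonneg mult_nonneg_nonneg, auto)
  next
    case False
    then have y: "y > 0" using \<open>0 \<le> y\<close> by simp
    \<comment> \<open>The tangent to t^p at the mean y, integrated against P: as P has mean 1 and u
      P has mean y, the linear part contributes nothing and y^p remains.\<close>
    have "circ_mean (\<lambda>w. (y powr p - p * y powr p) * P w + (p * y powr (p - 1)) * (u w * P w)) \<le> circ_mean (\<lambda>w. u w powr p * P w)"
    proof (rule circ_mean_mono)
      fix w :: complex assume w: "norm w = 1"
      have "(y powr p + p * y powr (p - 1) * (u w - y)) * P w \<le> u w powr p * P w"
        by (intro mult_right_mono powr_ge_tangent u P w y p)
      moreover have "y powr p = y powr (p - 1) * y" using y by (simp add: powr_diff)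
      ultimately show "(y powr p - p * y powr p) * P w + (p * y powr (p - 1)) * (u w * P w) \<le> u w powr p * P w"
        by (simp add: algebra_simps)
    qed (intro continuous_intros assms contp)+
    also have "circ_mean (\<lambda>w. (y powr p - p * y powr p) * P w + (p * y powr (p - 1)) * (u w * P w))
        = (y powr p - p * y powr p) * 1 + (p * y powr (p - 1)) * y"
      unfolding y_def P1[symmetric] circ_mean_cmult[symmetric]
      by (rule circ_mean_add; intro continuous_intros assms)
    also have "\<dots> = y powr p" using y by (simp add: powr_diff algebra_simps)
    finally show ?thesis by (simp add: y_def)
  qed
qed

text \<open>Hoelder for vectors with two entries and exponents k and k/(k - 1): Young's inequality
  entry by entry, after both vectors are normalised. It is the pairing behind
  \<open>circ_mean_minkowski\<close>.\<close>

lemma two_point_hoelder: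
  fixes u v U V k :: real
  assumes "0 \<le> u" "0 \<le> v" "0 \<le> U" "0 \<le> V" "1 < k"
  shows "U powr (k - 1) * u + V powr (k - 1) * v
           \<le> ((U powr k + V powr k) powr (1 / k)) powr (k - 1) * (u powr k + v powr k) powr (1 / k)"
proof -
  define N where "N = (U powr k + V powr k) powr (1 / k)"
  define n where "n = (u powr k + v powr k) powr (1 / k)"
  have Nk: "N powr k = U powr k + V powr k" and nk: "n powr k = u powr k + v powr k"
    using assms by (simp_all add: N_def n_def powr_powr)
  show ?thesis
  proof (cases "(U = 0 \<and> V = 0) \<or> (u = 0 \<and> v = 0)")
    case True then show ?thesis by (auto simp: assms)
  next
    case False
    then have "U powr k + V powr k > 0" "u powr k + v powr k > 0"
      using assms by (auto simp: add_pos_nonneg add_nonneg_pos)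
    then have pos: "N > 0" "n > 0" by (auto simp: N_def n_def)
    have young: "(a / n) * (A / N) powr (k - 1) \<le> (a / n) powr k / k + (A / N) powr k * (1 - 1 / k)"
      if "0 \<le> a" "0 \<le> A" for a A
    proof -
      have 1: "1 / k + 1 / (k / (k - 1)) = 1" using assms by (simp add: field_simps)
      have "(a / n) * (A / N) powr (k - 1) \<le> (a / n) powr k / k + ((A / N) powr (k - 1)) powr (k / (k - 1)) / (k / (k - 1))"
        by (rule Youngs_inequality) (use that pos assms 1 in \<open>auto simp: field_simps\<close>)
      also have "((A / N) powr (k - 1)) powr (k / (k - 1)) = (A / N) powr k"
        using assms by (simp add: powr_powr)
      moreover have "(A / N) powr k / (k / (k - 1)) = (A / N) powr k * (1 - 1 / k)"
        using assms by (simp add: field_simps)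
      ultimately show ?thesis by simp
    qed
    have "(u / n) * (U / N) powr (k - 1) + (v / n) * (V / N) powr (k - 1)
        \<le> ((u / n) powr k + (v / n) powr k) / k + ((U / N) powr k + (V / N) powr k) * (1 - 1 / k)"
      using young[of u U] young[of v V] assms by (simp add: algebra_simps add_divide_distrib)
    also have "(u / n) powr k + (v / n) powr k = 1"
      using pos assms nk[symmetric] by (simp add: powr_divide flip: add_divide_distrib)
    also have "(U / N) powr k + (V / N) powr k = 1"
      using pos assms Nk[symmetric] by (simp add: powr_divide flip: add_divide_distrib)
    finally have "(u * U powr (k - 1) + v * V powr (k - 1)) / (n * N powr (k - 1)) \<le> 1"
      using pos assms by (simp add: powr_divide add_divide_distrib)
    then have "u * U powr (k - 1) + v * V powr (k - 1) \<le> n * N powr (k - 1)"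
      using pos by (simp add: pos_divide_le_eq)
    then show ?thesis by (simp add: N_def n_def mult.commute)
  qed
qed

text \<open>Duality: pairing the averages (U, V) with (U^(k-1), V^(k-1)) gives N^k exactly, while
  Hoelder at each w bounds the same pairing by N^(k-1) times the mean of the pointwise l^k norms.
  Dividing by N^(k-1) leaves the claim.\<close>

lemma circ_mean_minkowski:
  fixes u v :: "complex \<Rightarrow> real"
  assumes cont: "continuous_on (sphere 0 1) u" "continuous_on (sphere 0 1) v"
    and u: "\<And>w. norm w = 1 \<Longrightarrow> 0 \<le> u w" and v: "\<And>w. norm w = 1 \<Longrightarrow> 0 \<le> v w" and k: "1 \<le> k"
  shows "circ_mean u powr k + circ_mean v powr k
           \<le> circ_mean (\<lambda>w. (u w powr k + v w powr k) powr (1 / k)) powr k"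
proof (cases "k = 1")
  case True
  have "circ_mean (\<lambda>w. (u w powr k + v w powr k) powr (1 / k)) = circ_mean (\<lambda>w. u w + v w)"
    by (rule circ_mean_cong) (simp add: True u v)
  also have "\<dots> = circ_mean u + circ_mean v" by (rule circ_mean_add[OF cont])
  finally show ?thesis using True circ_mean_nonneg[OF u] circ_mean_nonneg[OF v] by simp
next
  case False
  then have k: "1 < k" using k by simp
  define U V where "U = circ_mean u" and "V = circ_mean v"
  have UV: "0 \<le> U" "0 \<le> V" unfolding U_def V_def by (auto intro!: circ_mean_nonneg u v)
  define N where "N = (U powr k + V powr k) powr (1 / k)"
  have Nk: "N powr k = U powr k + V powr k" using k by (simp add: N_def powr_powr)
  have "0 \<le> N" by (simp add: N_def)
  have cp: "continuous_on (sphere 0 1) (\<lambda>w. (u w powr k + v w powr k) powr (1 / k))"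
    using k u v by (intro continuous_on_powr_nonneg continuous_intros cont) auto
  have "U powr (k - 1) * U + V powr (k - 1) * V = circ_mean (\<lambda>w. U powr (k - 1) * u w + V powr (k - 1) * v w)"
    unfolding U_def V_def circ_mean_cmult[symmetric]
    by (rule circ_mean_add[symmetric]; intro continuous_intros cont)
  also have "\<dots> \<le> circ_mean (\<lambda>w. N powr (k - 1) * (u w powr k + v w powr k) powr (1 / k))"
    unfolding N_def
    by (intro circ_mean_mono continuous_intros cont cp[unfolded N_def] two_point_hoelder u v UV k)
  also have "\<dots> = N powr (k - 1) * circ_mean (\<lambda>w. (u w powr k + v w powr k) powr (1 / k))"
    by (rule circ_mean_cmult)
  finally have *: "N powr k \<le> N powr (k - 1) * circ_mean (\<lambda>w. (u w powr k + v w powr k) powr (1 / k))"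
    using UV k by (simp add: Nk powr_mult_base mult.commute)
  have "N \<le> circ_mean (\<lambda>w. (u w powr k + v w powr k) powr (1 / k))"
  proof (cases "N = 0")
    case True then show ?thesis by (simp add: circ_mean_nonneg)
  next
    case False
    then have "N > 0" using \<open>0 \<le> N\<close> by simp
    then show ?thesis using * by (simp add: powr_diff field_simps)
  qed
  then have "N powr k \<le> circ_mean (\<lambda>w. (u w powr k + v w powr k) powr (1 / k)) powr k"
    using \<open>0 \<le> N\<close> k by (intro powr_mono2) auto
  then show ?thesis by (simp add: Nk U_def V_def)
qed

text \<open>After division by the l^2 norm both entries lie in [0, 1], where raising the exponent
  from 2 to q decreases powers. This is what q \<ge> 2 is for in the growth estimate.\<close>

lemma sum_powr_le_l2:
  fixes a b q :: real
  assumes "0 \<le> a" "0 \<le> b" "2 \<le> q"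
  shows "(a powr q + b powr q) powr (1 / q) \<le> sqrt (a\<^sup>2 + b\<^sup>2)"
proof (cases "a\<^sup>2 + b\<^sup>2 = 0")
  case True then show ?thesis by (simp add: sum_power2_eq_zero_iff)
next
  case False
  define S where "S = sqrt (a\<^sup>2 + b\<^sup>2)"
  have S: "S > 0" unfolding S_def using False sum_power2_ge_zero[of a b] by (simp only: real_sqrt_gt_0_iff less_le) simp
  have le: "(c / S) powr q \<le> (c / S) powr 2" if "0 \<le> c" "c \<le> S" for c
    using that S assms by (intro powr_mono') auto
  have "a \<le> S" "b \<le> S" unfolding S_def using real_sqrt_sum_squares_ge1 real_sqrt_sum_squares_ge2 by auto
  then have "(a / S) powr q + (b / S) powr q \<le> (a / S) powr 2 + (b / S) powr 2"
    using le assms by (intro add_mono) auto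
  also have "\<dots> = (a\<^sup>2 + b\<^sup>2) / S\<^sup>2" using S assms by (simp add: power_divide add_divide_distrib)
  also have "\<dots> = 1"
  proof -
    have "S\<^sup>2 = a\<^sup>2 + b\<^sup>2" by (simp add: S_def)
    then show ?thesis using False by simp
  qed
  finally have "(a powr q + b powr q) / S powr q \<le> 1"
    using S assms by (simp add: powr_divide add_divide_distrib)
  then have "a powr q + b powr q \<le> S powr q" using S by (simp add: pos_divide_le_eq)
  then have "(a powr q + b powr q) powr (1 / q) \<le> (S powr q) powr (1 / q)"
    using assms by (intro powr_mono2) auto
  then show ?thesis using S assms unfolding S_def[symmetric] by (simp add: powr_powr)
qed

lemma circ_mean_growth:
  fixes F :: "complex \<Rightarrow> complex"
  assumes cont: "continuous_on (cball 0 1) F" and hol: "F holomorphic_on ball 0 1"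
    and x: "\<bar>x\<bar> < 1" and p: "1 \<le> p" and q: "2 \<le> q" "p \<le> q"
  shows "circ_mean (\<lambda>u. norm (F (complex_of_real x * u)) powr p) powr (q / p)
       + circ_mean (\<lambda>u. ((1 - x\<^sup>2) / 2 * norm (deriv F (complex_of_real x * u))) powr p) powr (q / p)
       \<le> circ_mean (\<lambda>u. norm (F u) powr p) powr (q / p)"
proof -
  define c where "c = (1 - x\<^sup>2) / 2"
  have c: "0 < c" using x by (simp add: c_def abs_square_less_1)
  have xu: "norm (complex_of_real x * u) < 1" if "norm u = 1" for u
    using that x by (simp add: norm_mult)
  have c1: "continuous_on (sphere 0 1) (\<lambda>u. norm (F (complex_of_real x * u)) powr p)"
  proof -
    have "continuous_on (sphere 0 1) (\<lambda>u. F (complex_of_real x * u))"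
      by (rule continuous_on_compose2[OF cont]) (auto intro!: continuous_intros less_imp_le[OF xu])
    then show ?thesis using p by (intro continuous_on_powr_nonneg continuous_intros) auto
  qed
  have c2: "continuous_on (sphere 0 1) (\<lambda>u. (c * norm (deriv F (complex_of_real x * u))) powr p)"
  proof -
    have "continuous_on (ball 0 1) (deriv F)"
      by (intro holomorphic_on_imp_continuous_on holomorphic_deriv hol) auto
    then have "continuous_on (sphere 0 1) (\<lambda>u. deriv F (complex_of_real x * u))"
      by (rule continuous_on_compose2) (use xu in \<open>auto intro!: continuous_intros\<close>)
    then show ?thesis using p c by (intro continuous_on_powr_nonneg continuous_intros) auto
  qed
  have uw: "norm (u * w) = 1" if "norm u = 1" "norm w = 1" for u w :: complex
    using that by (simp add: norm_mult)
  have contS: "continuous_on (sphere 0 1) F" using cont by (rule continuous_on_subset) auto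
  have cFp: "continuous_on (sphere 0 1) (\<lambda>u. norm (F u) powr p)"
    using p by (intro continuous_on_powr_nonneg continuous_intros contS) auto
  have cK: "continuous_on (sphere 0 1 \<times> sphere 0 1) (\<lambda>(u,w). norm (F (u * w)) powr p * poisson x w)"
  proof -
    have a: "continuous_on (sphere 0 1 \<times> sphere 0 1) (\<lambda>z. (\<lambda>u. norm (F u) powr p) (fst z * snd z))"
      by (rule continuous_on_compose2[OF cFp]) (auto intro!: continuous_intros uw)
    have b: "continuous_on (sphere 0 1 \<times> sphere 0 1) (\<lambda>z. poisson x (snd z))"
      by (rule continuous_on_compose2[OF continuous_on_poisson[OF x]]) (auto intro!: continuous_intros)
    show ?thesis using continuous_on_mult[OF a b] by (simp add: case_prod_unfold)
  qed
  have cmean: "continuous_on (sphere 0 1) (\<lambda>u. circ_mean (\<lambda>w. norm (F (u * w)) powr p * poisson x w))"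
    by (rule continuous_on_circ_mean[OF cK])
  \<comment> \<open>\<open>G\<close> is F rotated so that the real point x stands for x u. The inner
    powers p and the outer powers q/p are arranged for Minkowski with k = q/p.\<close>
  have pt: "((norm (F (complex_of_real x * u)) powr p) powr (q / p) + ((c * norm (deriv F (complex_of_real x * u))) powr p) powr (q / p)) powr (1 / (q / p))
      \<le> circ_mean (\<lambda>w. norm (F (u * w)) powr p * poisson x w)" if u: "norm u = 1" for u
  proof -
    define G where "G z = F (u * z)" for z
    have contG: "continuous_on (cball 0 1) G" unfolding G_def
      by (rule continuous_on_compose2[OF cont]) (auto intro!: continuous_intros simp: norm_mult u)
    have holG: "G holomorphic_on ball 0 1" unfolding G_def
      by (rule holomorphic_on_compose_gen[OF _ hol, unfolded o_def]) (auto intro!: holomorphic_intros simp: norm_mult u)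
    have "(F has_field_derivative deriv F (u * x)) (at (u * x))"
      by (rule holomorphic_derivI[OF hol]) (use xu[OF u] in \<open>auto simp: mult.commute\<close>)
    then have "(G has_field_derivative deriv F (u * x) * u) (at x)"
      unfolding G_def by (rule DERIV_chain'[rotated]) (auto intro!: derivative_eq_intros)
    then have dG: "norm (deriv G x) = norm (deriv F (complex_of_real x * u))"
      by (simp add: DERIV_imp_deriv norm_mult u mult.commute)
    have contGS: "continuous_on (sphere 0 1) G" using contG by (rule continuous_on_subset) auto
    define a b where "a = norm (F (complex_of_real x * u))" and "b = c * norm (deriv F (complex_of_real x * u))"
    have ab: "0 \<le> a" "0 \<le> b" using c by (auto simp: a_def b_def)
    have "((a powr p) powr (q / p) + (b powr p) powr (q / p)) powr (1 / (q / p)) = ((a powr q + b powr q) powr (1 / q)) powr p"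
      using p q by (simp add: powr_powr)
    also have "\<dots> \<le> sqrt (a\<^sup>2 + b\<^sup>2) powr p"
      using sum_powr_le_l2[OF ab q(1)] p by (intro powr_mono2) auto
    also have "sqrt (a\<^sup>2 + b\<^sup>2) = sqrt ((norm (G x))\<^sup>2 + ((1 - x\<^sup>2) / 2 * norm (deriv G x))\<^sup>2)"
      by (simp add: a_def b_def c_def dG G_def mult.commute)
    also have "\<dots> powr p \<le> circ_mean (\<lambda>w. norm (G w) * poisson x w) powr p"
      using poisson_point_evaluation_bound[OF contG holG x] p by (intro powr_mono2) auto
    also have "\<dots> \<le> circ_mean (\<lambda>w. norm (G w) powr p * poisson x w)"
      by (intro circ_mean_jensen continuous_intros continuous_on_poisson x poisson_nonneg circ_mean_poisson_1 p contGS) auto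
    finally show ?thesis by (simp add: a_def b_def G_def)
  qed
  have cL: "continuous_on (sphere 0 1) (\<lambda>u. ((norm (F (complex_of_real x * u)) powr p) powr (q / p) + ((c * norm (deriv F (complex_of_real x * u))) powr p) powr (q / p)) powr (1 / (q / p)))"
    using p q by (intro continuous_on_powr_nonneg continuous_intros c1 c2) auto
  have "circ_mean (\<lambda>u. norm (F (complex_of_real x * u)) powr p) powr (q / p) + circ_mean (\<lambda>u. (c * norm (deriv F (complex_of_real x * u))) powr p) powr (q / p)
    \<le> circ_mean (\<lambda>u. ((norm (F (complex_of_real x * u)) powr p) powr (q / p) + ((c * norm (deriv F (complex_of_real x * u))) powr p) powr (q / p)) powr (1 / (q / p))) powr (q / p)"
    by (rule circ_mean_minkowski[OF c1 c2]) (use p q in auto)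
  also have "\<dots> \<le> circ_mean (\<lambda>u. circ_mean (\<lambda>w. norm (F (u * w)) powr p * poisson x w)) powr (q / p)"
    using p q by (intro powr_mono2 circ_mean_mono circ_mean_nonneg cL cmean pt) auto
  also have "circ_mean (\<lambda>u. circ_mean (\<lambda>w. norm (F (u * w)) powr p * poisson x w))
      = circ_mean (\<lambda>w. circ_mean (\<lambda>u. norm (F (u * w)) powr p * poisson x w))"
    by (rule circ_mean_swap[OF cK])
  \<comment> \<open>Rotation invariance: after the exchange of means the inner mean over u no longer
    depends on w, so the kernel integrates to 1.\<close>
  also have "\<dots> = circ_mean (\<lambda>w. circ_mean (\<lambda>u. norm (F u) powr p) * poisson x w)"
  proof (rule circ_mean_cong)
    fix w :: complex assume w: "norm w = 1"
    show "circ_mean (\<lambda>u. norm (F (u * w)) powr p * poisson x w) = circ_mean (\<lambda>u. norm (F u) powr p) * poisson x w"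
      using circ_mean_cmult[of "poisson x w" "\<lambda>u. norm (F (w * u)) powr p"] circ_mean_rotate[OF cFp w]
      by (simp add: mult.commute)
  qed
  also have "\<dots> = circ_mean (\<lambda>u. norm (F u) powr p)"
    by (simp add: circ_mean_cmult circ_mean_poisson_1[OF x])
  finally show ?thesis by (simp add: c_def)
qed

subsection \<open>Growth of integral means and the Littlewood--Paley bound\<close>

text \<open>Bridge between the two integrals in use: \<open>circ_Lp\<close> is a Lebesgue integral,
  \<open>circ_mean\<close> a gauge integral, and they agree on continuous integrands.\<close>

lemma circ_Lp_eq:
  assumes "continuous_on (sphere 0 1) (\<lambda>w. g (complex_of_real r * w))" "0 < p"
  shows "circ_Lp p g r = circ_mean (\<lambda>w. norm (g (complex_of_real r * w)) powr p) powr (1 / p)"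
proof -
  have "continuous_on (sphere 0 1) (\<lambda>w. norm (g (complex_of_real r * w)) powr p)"
    using assms by (intro continuous_on_powr_nonneg continuous_intros) auto
  then have "set_integrable lborel {0..1} (\<lambda>t. norm (g (complex_of_real r * cis (2 * pi * t))) powr p)"
    by (intro borel_integrable_atLeastAtMost' continuous_on_circ)
  then show ?thesis
    unfolding circ_Lp_def circ_mean_def by (subst set_borel_integral_eq_integral(2)) auto
qed

lemma circ_Lp_nonneg: "0 \<le> circ_Lp p g r"
  by (simp add: circ_Lp_def)

lemma circ_Lp_powr:
  assumes "continuous_on (sphere 0 1) (\<lambda>w. g (complex_of_real r * w))" "0 < p"
  shows "circ_Lp p g r powr q = circ_mean (\<lambda>w. norm (g (complex_of_real r * w)) powr p) powr (q / p)"
  unfolding circ_Lp_eq[OF assms] by (simp add: powr_powr)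

lemma continuous_on_circle_of_radius:
  assumes "continuous_on S g" "\<And>w. norm w = 1 \<Longrightarrow> complex_of_real r * w \<in> S"
  shows "continuous_on (sphere 0 1) (\<lambda>w. g (complex_of_real r * w))"
  by (rule continuous_on_compose2[OF assms(1)]) (auto intro!: continuous_intros assms(2))

lemma continuous_on_circ_Lp:
  assumes g: "continuous_on S g" and S: "\<And>r w. r \<in> R \<Longrightarrow> norm w = 1 \<Longrightarrow> complex_of_real r * w \<in> S" and p: "0 < p"
  shows "continuous_on R (circ_Lp p g)"
proof -
  have "continuous_on (R \<times> sphere 0 1) (\<lambda>z. g (complex_of_real (fst z) * snd z))"
    by (rule continuous_on_compose2[OF g]) (auto intro!: continuous_intros S)
  then have "continuous_on (R \<times> sphere 0 1) (\<lambda>(r, w). norm (g (complex_of_real r * w)) powr p)"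
    unfolding case_prod_unfold using p by (intro continuous_on_powr_nonneg continuous_intros) auto
  then have "continuous_on R (\<lambda>r. circ_mean (\<lambda>w. norm (g (complex_of_real r * w)) powr p) powr (1 / p))"
    using p by (intro continuous_on_powr_nonneg continuous_on_circ_mean circ_mean_nonneg) auto
  moreover have "circ_Lp p g r = circ_mean (\<lambda>w. norm (g (complex_of_real r * w)) powr p) powr (1 / p)" if "r \<in> R" for r
    by (intro circ_Lp_eq continuous_on_circle_of_radius[OF g] S that p)
  ultimately show ?thesis by (simp cong: continuous_on_cong)
qed

text \<open>Obtained from \<open>circ_mean_growth\<close> for the dilation z \<mapsto> f(R z) at the
  point x = r/R, at the price of the smaller weight (R - r)/2.\<close>

lemma circ_Lp_growth:
  fixes f :: "complex \<Rightarrow> complex"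
  assumes cont: "continuous_on (cball 0 1) f" and hol: "f holomorphic_on ball 0 1"
    and r: "0 \<le> r" "r < R" "R \<le> 1" and p: "1 \<le> p" and q: "2 \<le> q" "p \<le> q"
  shows "circ_Lp p f r powr q + ((R - r) / 2 * circ_Lp p (deriv f) r) powr q \<le> circ_Lp p f R powr q"
proof -
  define F where "F z = f (complex_of_real R * z)" for z
  define x where "x = r / R"
  have R: "0 < R" using r by simp
  have x: "0 \<le> x" "\<bar>x\<bar> < 1" using r by (auto simp: x_def)
  have xR: "complex_of_real R * (complex_of_real x * u) = complex_of_real r * u" for u
    using R by (simp add: x_def)
  have Rz: "norm (complex_of_real R * z) \<le> norm z" for z
    using r R by (simp add: norm_mult mult_left_le_one_le)
  have contF: "continuous_on (cball 0 1) F" unfolding F_def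
    by (rule continuous_on_compose2[OF cont]) (use Rz order_trans in \<open>fastforce intro!: continuous_intros\<close>)+
  have holF: "F holomorphic_on ball 0 1" unfolding F_def
    by (rule holomorphic_on_compose_gen[OF _ hol, unfolded o_def])
       (use Rz le_less_trans in \<open>fastforce intro!: holomorphic_intros\<close>)+
  have ru: "norm (complex_of_real r * u) < 1" if "norm u = 1" for u
    using that r by (simp add: norm_mult)
  have dF: "deriv F (complex_of_real x * u) = R * deriv f (complex_of_real r * u)" if u: "norm u = 1" for u
  proof -
    have "(f has_field_derivative deriv f (complex_of_real r * u)) (at (complex_of_real R * (complex_of_real x * u)))"
      unfolding xR by (rule holomorphic_derivI[OF hol]) (use ru[OF u] in auto)
    then have "(F has_field_derivative deriv f (complex_of_real r * u) * R) (at (complex_of_real x * u))"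
      unfolding F_def by (rule DERIV_chain'[rotated]) (auto intro!: derivative_eq_intros)
    then show ?thesis by (simp add: DERIV_imp_deriv mult.commute)
  qed
  define c where "c = (R - r) / 2"
  have c: "0 < c" using r by (simp add: c_def)
  \<comment> \<open>The chain rule contributes the factor R, and R^2 - r^2 \<ge> (R - r) R replaces
    the weight in x by one that is linear in R - r.\<close>
  have c_le: "c \<le> (1 - x\<^sup>2) / 2 * R"
  proof -
    have "R\<^sup>2 * (1 - x\<^sup>2) = (R - r) * (R + r)" using R by (simp add: x_def field_simps power2_eq_square)
    also have "\<dots> \<ge> (R - r) * R" using r by (intro mult_left_mono) auto
    finally have "(R - r) * R \<le> (R * (1 - x\<^sup>2)) * R" by (simp add: power2_eq_square mult_ac)
    then have "R - r \<le> R * (1 - x\<^sup>2)" using R by (simp only: mult_le_cancel_right_pos)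
    then show ?thesis by (simp add: c_def mult.commute)
  qed
  have contd: "continuous_on (ball 0 1) (deriv f)"
    by (intro holomorphic_on_imp_continuous_on holomorphic_deriv hol) auto
  have cd: "continuous_on (sphere 0 1) (\<lambda>w. deriv f (complex_of_real r * w))"
    by (rule continuous_on_circle_of_radius[OF contd]) (use ru in auto)
  have cr: "continuous_on (sphere 0 1) (\<lambda>w. f (complex_of_real r * w))"
    by (rule continuous_on_circle_of_radius[OF cont]) (use ru less_imp_le in fastforce)
  have cR: "continuous_on (sphere 0 1) (\<lambda>w. f (complex_of_real R * w))"
    by (rule continuous_on_circle_of_radius[OF cont]) (use r R in \<open>auto simp: norm_mult\<close>)
  have "(c * circ_Lp p (deriv f) r) powr q = circ_mean (\<lambda>w. (c * norm (deriv f (complex_of_real r * w))) powr p) powr (q / p)"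
    using c p by (simp add: powr_mult circ_Lp_nonneg circ_Lp_powr[OF cd] circ_mean_cmult circ_mean_nonneg powr_powr)
  also have "\<dots> \<le> circ_mean (\<lambda>u. ((1 - x\<^sup>2) / 2 * norm (deriv F (complex_of_real x * u))) powr p) powr (q / p)"
  proof (rule powr_mono2[OF _ _ circ_mean_mono])
    show "continuous_on (sphere 0 1) (\<lambda>w. (c * norm (deriv f (complex_of_real r * w))) powr p)"
      using c p by (intro continuous_on_powr_nonneg continuous_intros cd) auto
    have "continuous_on (sphere 0 1) (\<lambda>u. ((1 - x\<^sup>2) / 2 * norm (R * deriv f (complex_of_real r * u))) powr p)"
      using x p by (intro continuous_on_powr_nonneg continuous_intros cd) (auto simp: abs_square_le_1)
    then show "continuous_on (sphere 0 1) (\<lambda>u. ((1 - x\<^sup>2) / 2 * norm (deriv F (complex_of_real x * u))) powr p)"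
      by (rule continuous_on_eq) (simp add: dF)
    show "(c * norm (deriv f (complex_of_real r * w))) powr p \<le> ((1 - x\<^sup>2) / 2 * norm (deriv F (complex_of_real x * w))) powr p"
      if "norm w = 1" for w
    proof (rule powr_mono2)
      have "c * norm (deriv f (complex_of_real r * w)) \<le> (1 - x\<^sup>2) / 2 * R * norm (deriv f (complex_of_real r * w))"
        by (intro mult_right_mono c_le) auto
      then show "c * norm (deriv f (complex_of_real r * w)) \<le> (1 - x\<^sup>2) / 2 * norm (deriv F (complex_of_real x * w))"
        using R by (simp add: dF[OF that] norm_mult)
    qed (use c p in auto)
  qed (use p q in \<open>auto intro!: circ_mean_nonneg\<close>)
  finally have "circ_Lp p f r powr q + (c * circ_Lp p (deriv f) r) powr q
      \<le> circ_mean (\<lambda>u. norm (F (complex_of_real x * u)) powr p) powr (q / p)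
       + circ_mean (\<lambda>u. ((1 - x\<^sup>2) / 2 * norm (deriv F (complex_of_real x * u))) powr p) powr (q / p)"
    using p by (simp add: circ_Lp_powr[OF cr] F_def xR)
  also have "\<dots> \<le> circ_mean (\<lambda>u. norm (F u) powr p) powr (q / p)"
    by (rule circ_mean_growth[OF contF holF x(2) p q])
  also have "\<dots> = circ_Lp p f R powr q"
    using p by (simp add: circ_Lp_powr[OF cR] F_def)
  finally show ?thesis by (simp add: c_def)
qed

text \<open>The growth estimate with exponent max 2 p and its derivative term dropped.\<close>

lemma circ_Lp_mono:
  assumes "continuous_on (cball 0 1) f" "f holomorphic_on ball 0 1"
    and "0 \<le> r" "r \<le> R" "R \<le> 1" and p: "1 \<le> p"
  shows "circ_Lp p f r \<le> circ_Lp p f R"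
proof (cases "r = R")
  case False
  have "circ_Lp p f r powr (max 2 p) \<le> circ_Lp p f R powr (max 2 p)"
    using circ_Lp_growth[OF assms(1-3) _ assms(5) p, of "max 2 p"] assms(4) False
      powr_ge_zero[of "(R - r) / 2 * circ_Lp p (deriv f) r" "max 2 p"] by linarith
  then show ?thesis by (metis circ_Lp_nonneg linorder_not_le max.strict_coboundedI1 powr_less_mono2 zero_less_numeral)
qed simp

section \<open>Integration in the radius\<close>

lemma nn_integral_continuous_interval:
  fixes f :: "real \<Rightarrow> real"
  assumes cont: "continuous_on {a..b} f" and nonneg: "\<And>x. x \<in> {a..b} \<Longrightarrow> 0 \<le> f x"
  shows "(\<integral>\<^sup>+x\<in>{a..b}. ennreal (f x) \<partial>lborel) = ennreal (integral {a..b} f)"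
proof -
  have "(\<integral>\<^sup>+x\<in>{a..b}. ennreal (f x) \<partial>lborel) = (\<integral>\<^sup>+x. ennreal (indicator {a..b} x * f x) \<partial>lborel)"
    by (intro nn_integral_cong) (auto simp: indicator_def)
  also have "\<dots> = ennreal (integral {a..b} f)"
  proof (rule nn_integral_has_integral_lborel)
    show "(\<lambda>x. indicator {a..b} x * f x) \<in> borel_measurable borel"
      using borel_measurable_continuous_on_indicator[OF _ cont] by simp
    show "0 \<le> indicator {a..b} x * f x" for x using nonneg by (auto simp: indicator_def)
    have "(f has_integral integral {a..b} f) {a..b}"
      by (intro integrable_integral integrable_continuous_interval cont)
    then have "((\<lambda>x. if x \<in> {a..b} then f x else 0) has_integral integral {a..b} f) UNIV"
      by (simp only: has_integral_restrict_UNIV)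
    then show "((\<lambda>x. indicator {a..b} x * f x) has_integral integral {a..b} f) UNIV"
      by (rule has_integral_eq[rotated]) (auto simp: indicator_def)
  qed
  finally show ?thesis .
qed

text \<open>Exhaustion by intervals [0, \<rho>] with \<rho> < 1: in the applications the weight may
  blow up at 1, and primitives are at hand only away from that endpoint.\<close>

lemma nn_integral_unit_interval_le:
  fixes g :: "real \<Rightarrow> ennreal"
  assumes g: "(\<lambda>x. g x * indicator {0<..<1} x) \<in> borel_measurable borel"
    and le: "\<And>\<rho>. 0 < \<rho> \<Longrightarrow> \<rho> < 1 \<Longrightarrow> (\<integral>\<^sup>+x\<in>{0..\<rho>}. g x \<partial>lborel) \<le> B"
  shows "(\<integral>\<^sup>+x\<in>{0<..<1}. g x \<partial>lborel) \<le> B"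
proof -
  define \<rho> where "\<rho> n = 1 - 1 / (real n + 2)" for n
  define G where "G n x = g x * indicator {0<..<1} x * indicator {0..\<rho> n} x" for n x
  have \<rho>: "0 < \<rho> n" "\<rho> n < 1" for n by (auto simp: \<rho>_def)
  have \<rho>_mono: "\<rho> m \<le> \<rho> n" if "m \<le> n" for m n
    unfolding \<rho>_def using that by (simp add: frac_le)
  have "(\<integral>\<^sup>+x\<in>{0<..<1}. g x \<partial>lborel) = (\<integral>\<^sup>+x. (SUP n. G n x) \<partial>lborel)"
  proof (rule nn_integral_cong)
    fix x :: real
    show "g x * indicator {0<..<1} x = (SUP n. G n x)"
    proof (cases "0 < x \<and> x < 1")
      case True
      obtain n :: nat where n: "1 / (1 - x) < real n" using reals_Archimedean2 by blast
      have "1 < real n * (1 - x)" using n True by (simp add: field_simps)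
      then have "x \<le> \<rho> n" using True by (simp add: \<rho>_def field_simps)
      then have "G n x = g x * indicator {0<..<1} x" using True by (simp add: G_def)
      moreover have "G m x \<le> g x * indicator {0<..<1} x" for m
        by (simp add: G_def indicator_def)
      ultimately show ?thesis by (intro antisym SUP_least) (metis UNIV_I SUP_upper)+
    qed (auto simp: G_def)
  qed
  also have "\<dots> = (SUP n. \<integral>\<^sup>+x. G n x \<partial>lborel)"
  proof (rule nn_integral_monotone_convergence_SUP)
    show "incseq G"
      unfolding G_def incseq_def le_fun_def
      by (auto simp: indicator_def dest: \<rho>_mono intro: order_trans)
    show "G n \<in> borel_measurable lborel" for n
      unfolding G_def
      by (rule borel_measurable_times_ennreal[where f = "\<lambda>x. g x * indicator {0<..<1} x"]) (use g in auto)
  qed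
  also have "\<dots> \<le> B"
  proof (rule SUP_least)
    fix n
    have "(\<integral>\<^sup>+x. G n x \<partial>lborel) \<le> (\<integral>\<^sup>+x\<in>{0..\<rho> n}. g x \<partial>lborel)"
      by (intro nn_integral_mono) (auto simp: G_def indicator_def)
    then show "(\<integral>\<^sup>+x. G n x \<partial>lborel) \<le> B" using le[OF \<rho>[of n]] by (rule order_trans)
  qed
  finally show ?thesis .
qed

text \<open>The measure dr/(1-r) is invariant under r \<open>\<mapsto>\<close> (1+r)/2, so the two terms cancel up to
  an integral over [\<rho>, (1+\<rho>)/2], on which dr/(1-r) has bounded mass.\<close>

lemma telescoping_bound:
  fixes N :: "real \<Rightarrow> real"
  assumes cont: "continuous_on {0..1} N" and nonneg: "\<And>x. x \<in> {0..1} \<Longrightarrow> 0 \<le> N x"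
    and mono: "\<And>x y. 0 \<le> x \<Longrightarrow> x \<le> y \<Longrightarrow> y \<le> 1 \<Longrightarrow> N x \<le> N y"
  shows "(\<integral>\<^sup>+r\<in>{0<..<1}. ennreal ((N ((1 + r) / 2) - N r) / (1 - r)) \<partial>lborel) \<le> ennreal (N 1)"
proof (rule nn_integral_unit_interval_le)
  define D where "D r = (N ((1 + r) / 2) - N r) / (1 - r)" for r
  have contD: "continuous_on T D" if "T \<subseteq> {0..<1}" for T
    unfolding D_def
    by (intro continuous_intros continuous_on_compose2[OF cont, of T "\<lambda>r. (1 + r) / 2"] continuous_on_subset[OF cont])
       (use that in auto)
  have "(\<lambda>r. ennreal (indicator {0<..<1} r * D r)) \<in> borel_measurable borel"
  proof -
    have "continuous_on {0<..<1} D" by (rule contD) auto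
    from borel_measurable_continuous_on_indicator[OF _ this] show ?thesis by simp
  qed
  moreover have "(\<lambda>r. ennreal (indicator {0<..<1} r * D r)) = (\<lambda>r. ennreal ((N ((1 + r) / 2) - N r) / (1 - r)) * indicator {0<..<1} r)"
    by (auto simp: indicator_def D_def fun_eq_iff)
  ultimately show "(\<lambda>r. ennreal ((N ((1 + r) / 2) - N r) / (1 - r)) * indicator {0<..<1} r) \<in> borel_measurable borel"
    by simp
  fix \<rho> :: real assume \<rho>: "0 < \<rho>" "\<rho> < 1"
  define \<sigma> where "\<sigma> = (1 + \<rho>) / 2"
  have \<sigma>: "\<rho> < \<sigma>" "\<sigma> < 1" "1/2 < \<sigma>" using \<rho> by (auto simp: \<sigma>_def)
  define k where "k u = N u / (1 - u)" for u
  have contk: "continuous_on {0..\<sigma>} k" unfolding k_def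
    by (intro continuous_intros continuous_on_subset[OF cont]) (use \<sigma> in auto)
  have k_int: "k integrable_on {a..b}" if "0 \<le> a" "b \<le> \<sigma>" for a b
    using that by (intro integrable_continuous_interval continuous_on_subset[OF contk]) auto
  have k_nonneg: "0 \<le> k u" if "0 \<le> u" "u \<le> \<sigma>" for u
    using that \<sigma> nonneg[of u] by (simp add: k_def)
  define Phi where "Phi x = integral {0..x} k" for x
  have dPhi: "(Phi has_real_derivative k x) (at x within {0..\<sigma>})" if "x \<in> {0..\<sigma>}" for x
    unfolding Phi_def by (rule integral_has_real_derivative[OF contk that])
  \<comment> \<open>An explicit primitive of \<open>D\<close>: the factor 1/2 from the chain rule
    cancels against 1 - (1 + r)/2 = (1 - r)/2.\<close>
  define H where "H r = Phi ((1 + r) / 2) - Phi r" for r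
  have "(D has_integral (H \<rho> - H 0)) {0..\<rho>}"
  proof (rule fundamental_theorem_of_calculus)
    fix r assume r: "r \<in> {0..\<rho>}"
    have "(Phi has_real_derivative k r) (at r within {0..\<rho>})"
      by (rule has_field_derivative_subset[OF dPhi]) (use r \<sigma> in auto)
    moreover have "((\<lambda>r. Phi ((1 + r) / 2)) has_real_derivative (k ((1 + r) / 2) * (1 / 2))) (at r within {0..\<rho>})"
    proof -
      have "(Phi has_real_derivative k ((1 + r) / 2)) (at ((1 + r) / 2) within (\<lambda>r. (1 + r) / 2) ` {0..\<rho>})"
        by (rule has_field_derivative_subset[OF dPhi]) (use r \<rho> in \<open>auto simp: \<sigma>_def\<close>)
      moreover have "((\<lambda>r. (1 + r) / 2) has_real_derivative 1 / 2) (at r within {0..\<rho>})"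
        by (auto intro!: derivative_eq_intros)
      ultimately show ?thesis by (rule DERIV_image_chain[where f = Phi and g = "\<lambda>r. (1 + r) / 2", unfolded o_def])
    qed
    ultimately have "(H has_real_derivative (k ((1 + r) / 2) * (1 / 2) - k r)) (at r within {0..\<rho>})"
      unfolding H_def by (intro derivative_intros)
    moreover have "k ((1 + r) / 2) * (1 / 2) - k r = D r"
    proof -
      have "1 - (1 + r) / 2 = (1 - r) / 2" by (simp add: field_simps)
      then show ?thesis by (simp add: k_def D_def diff_divide_distrib)
    qed
    ultimately show "(H has_vector_derivative D r) (at r within {0..\<rho>})"
      by (simp add: has_real_derivative_iff_has_vector_derivative)
  qed (use \<rho> in auto)
  then have intD: "integral {0..\<rho>} D = H \<rho> - H 0" by (rule integral_unique)
  have "0 \<le> H 0"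
    unfolding H_def Phi_def using \<sigma> by (auto intro!: integral_nonneg k_int k_nonneg)
  moreover have "H \<rho> = integral {\<rho>..\<sigma>} k"
    using Henstock_Kurzweil_Integration.integral_combine[of 0 \<rho> \<sigma> k] \<rho> \<sigma> k_int
    by (simp add: H_def Phi_def flip: \<sigma>_def)
  moreover have "integral {\<rho>..\<sigma>} k \<le> integral {\<rho>..\<sigma>} (\<lambda>u. N 1 / (1 - \<sigma>))"
  proof (rule integral_le)
    fix u assume "u \<in> {\<rho>..\<sigma>}"
    then show "k u \<le> N 1 / (1 - \<sigma>)"
      unfolding k_def using \<rho> \<sigma> by (intro frac_le mono nonneg) auto
  qed (use \<rho> in \<open>auto intro!: k_int integrable_const_ivl\<close>)
  \<comment> \<open>The interval has length \<sigma> - \<rho> = 1 - \<sigma>, so the constant is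
    exactly 1.\<close>
  moreover have "integral {\<rho>..\<sigma>} (\<lambda>u. N 1 / (1 - \<sigma>)) = N 1"
    using \<rho> by (simp add: \<sigma>_def field_simps)
  ultimately have "integral {0..\<rho>} D \<le> N 1" using intD by linarith
  moreover have "(\<integral>\<^sup>+r\<in>{0..\<rho>}. ennreal (D r) \<partial>lborel) = ennreal (integral {0..\<rho>} D)"
  proof (rule nn_integral_continuous_interval)
    show "0 \<le> D r" if "r \<in> {0..\<rho>}" for r
      unfolding D_def using that \<rho> mono[of r "(1 + r) / 2"] by (intro divide_nonneg_pos) auto
  qed (rule contD, use \<rho> in auto)
  ultimately show "(\<integral>\<^sup>+r\<in>{0..\<rho>}. ennreal ((N ((1 + r) / 2) - N r) / (1 - r)) \<partial>lborel) \<le> ennreal (N 1)"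
    unfolding D_def by (simp add: ennreal_leI)
qed

lemma besov_m_0 [simp]: "besov_m 0 = 1"
  by (simp add: besov_m_def)

text \<open>The constant is 1 + 4: the value at 0 costs 1 by monotonicity of the means, and the
  Besov part costs 4 because with R = (1 + r)/2 the factor (R - r)/2 is (1 - r)/4.\<close>

lemma HB_norm_le_circ_Lp:
  fixes f :: "complex \<Rightarrow> complex"
  assumes cont: "continuous_on (cball 0 1) f" and hol: "f holomorphic_on ball 0 1"
    and p: "1 \<le> p" and q: "2 \<le> q" "ereal p \<le> q"
  shows "HB_norm 0 p q f \<le> 5 * circ_Lp p f 1"
proof -
  define L where "L = circ_Lp p f 1"
  have L: "0 \<le> L" by (simp add: L_def circ_Lp_nonneg)
  have "norm (f 0) \<le> L"
  proof -
    have "circ_Lp p f 0 = norm (f 0)"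
      by (subst circ_Lp_eq) (use p in \<open>simp_all add: powr_powr\<close>)
    then show ?thesis using circ_Lp_mono[OF cont hol, of 0 1 p] p by (simp add: L_def)
  qed
  moreover have "(if q = \<infinity> then enn2real (besov_part 0 p q f)
      else enn2real (besov_part 0 p q f) powr (1 / real_of_ereal q)) \<le> 4 * L"
  proof (cases "q = \<infinity>")
    case True
    have "besov_part 0 p q f \<le> ennreal (4 * L)"
      unfolding besov_part_def Let_def using True
    proof (simp, intro SUP_least)
      fix r :: real assume r: "r \<in> {0<..<1}"
      \<comment> \<open>No telescoping for the supremum: the growth estimate is used once, from r to
        R = 1, with the auxiliary exponent max 2 p in place of q.\<close>
      have "((1 - r) / 2 * circ_Lp p (deriv f) r) powr max 2 p \<le> L powr max 2 p"
      proof -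
        have "circ_Lp p f r powr max 2 p + ((1 - r) / 2 * circ_Lp p (deriv f) r) powr max 2 p \<le> L powr max 2 p"
          unfolding L_def by (rule circ_Lp_growth[OF cont hol]) (use r p in auto)
        then show ?thesis using powr_ge_zero[of "circ_Lp p f r" "max 2 p"] by linarith
      qed
      then have "(1 - r) / 2 * circ_Lp p (deriv f) r \<le> L"
        using L by (metis linorder_not_le max.strict_coboundedI1 powr_less_mono2 zero_less_numeral)
      then have "circ_Lp p (deriv f) r * (1 - r) \<le> 4 * L"
        using L by (simp add: algebra_simps)
      then show "ennreal (circ_Lp p (deriv f) r * (1 - r)) \<le> ennreal (4 * L)"
        by (rule ennreal_leI)
    qed
    then show ?thesis using True L by (simp add: enn2real_leI)
  next
    case False
    then obtain q' where q': "q = ereal q'" using q by (cases q) auto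
    then have qq: "2 \<le> q'" "p \<le> q'" using q by (auto simp: numeral_eq_ereal)
    define N where "N r = circ_Lp p f r powr q'" for r
    have contL: "continuous_on {0..1} (circ_Lp p f)"
      by (rule continuous_on_circ_Lp[OF cont]) (use p in \<open>auto simp: norm_mult\<close>)
    have "besov_part 0 p q f = (\<integral>\<^sup>+r\<in>{0<..<1}. ennreal ((circ_Lp p (deriv f) r * (1 - r) powr (1 - 1 / q')) powr q') \<partial>lborel)"
      by (simp add: besov_part_def q')
    also have "\<dots> \<le> (\<integral>\<^sup>+r. ennreal (4 powr q') * (ennreal ((N ((1 + r) / 2) - N r) / (1 - r)) * indicator {0<..<1} r) \<partial>lborel)"
    proof (rule nn_integral_mono)
      fix r :: real
      show "ennreal ((circ_Lp p (deriv f) r * (1 - r) powr (1 - 1 / q')) powr q') * indicator {0<..<1} r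
         \<le> ennreal (4 powr q') * (ennreal ((N ((1 + r) / 2) - N r) / (1 - r)) * indicator {0<..<1} r)"
      proof (cases "r \<in> {0<..<1}")
        case True
        \<comment> \<open>The weight becomes (1 - r)^(q' - 1), that is (1 - r)^q' times the
          invariant density 1/(1 - r); the former is matched by the q'-th power of (1 -
          r)/4.\<close>
        have *: "(1 - 1 / q') * q' = q' - 1" using qq by (simp add: field_simps)
        have "(circ_Lp p (deriv f) r * (1 - r) powr (1 - 1 / q')) powr q' = circ_Lp p (deriv f) r powr q' * (1 - r) powr (q' - 1)"
          using True by (simp add: powr_mult circ_Lp_nonneg powr_powr *)
        also have "\<dots> = 4 powr q' * ((1 - r) / 4 * circ_Lp p (deriv f) r) powr q' / (1 - r)"
          using True by (simp add: powr_mult circ_Lp_nonneg powr_diff powr_divide)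
        also have "\<dots> \<le> 4 powr q' * (N ((1 + r) / 2) - N r) / (1 - r)"
        proof -
          have "((1 + r) / 2 - r) / 2 = (1 - r) / 4" by (simp add: field_simps)
          then have "((1 - r) / 4 * circ_Lp p (deriv f) r) powr q' \<le> N ((1 + r) / 2) - N r"
            using circ_Lp_growth[OF cont hol, of r "(1 + r) / 2" p q'] True p qq by (simp add: N_def)
          then show ?thesis using True by (intro divide_right_mono mult_left_mono) auto
        qed
        finally have le: "(circ_Lp p (deriv f) r * (1 - r) powr (1 - 1 / q')) powr q' \<le> 4 powr q' * ((N ((1 + r) / 2) - N r) / (1 - r))"
          by simp
        have "ennreal (4 powr q' * ((N ((1 + r) / 2) - N r) / (1 - r)))
            = ennreal (4 powr q') * ennreal ((N ((1 + r) / 2) - N r) / (1 - r))"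
          by (rule ennreal_mult') simp
        then show ?thesis using True ennreal_leI[OF le] by simp
      qed simp
    qed
    also have "\<dots> = ennreal (4 powr q') * (\<integral>\<^sup>+r\<in>{0<..<1}. ennreal ((N ((1 + r) / 2) - N r) / (1 - r)) \<partial>lborel)"
    proof (rule nn_integral_cmult)
      have "continuous_on {0<..<1} (\<lambda>r. (N ((1 + r) / 2) - N r) / (1 - r))"
        unfolding N_def using qq
        by (intro continuous_intros continuous_on_powr_nonneg circ_Lp_nonneg
             continuous_on_compose2[OF contL, of _ "\<lambda>r. (1 + r) / 2"] continuous_on_subset[OF contL]) auto
      from borel_measurable_continuous_on_indicator[OF _ this]
      have "(\<lambda>r. ennreal (indicator {0<..<1} r * ((N ((1 + r) / 2) - N r) / (1 - r)))) \<in> borel_measurable lborel"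
        by simp
      also have "(\<lambda>r. ennreal (indicator {0<..<1} r * ((N ((1 + r) / 2) - N r) / (1 - r)))) = (\<lambda>r. ennreal ((N ((1 + r) / 2) - N r) / (1 - r)) * indicator {0<..<1} r)"
        by (auto simp: indicator_def fun_eq_iff)
      finally show "(\<lambda>r. ennreal ((N ((1 + r) / 2) - N r) / (1 - r)) * indicator {0<..<1} r) \<in> borel_measurable lborel" .
    qed
    also have "\<dots> \<le> ennreal (4 powr q') * ennreal (N 1)"
    proof (intro mult_left_mono telescoping_bound)
      show "continuous_on {0..1} N" unfolding N_def
        using qq by (intro continuous_on_powr_nonneg contL circ_Lp_nonneg) auto
      show "N x \<le> N y" if "0 \<le> x" "x \<le> y" "y \<le> 1" for x y
        unfolding N_def using qq that p by (intro powr_mono2 circ_Lp_mono[OF cont hol] circ_Lp_nonneg) auto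
    qed (auto simp: N_def)
    also have "\<dots> = ennreal ((4 * L) powr q')"
      using L by (simp add: N_def L_def powr_mult ennreal_mult')
    finally have "enn2real (besov_part 0 p q f) \<le> (4 * L) powr q'"
      by (intro enn2real_leI) auto
    then have "enn2real (besov_part 0 p q f) powr (1 / q') \<le> ((4 * L) powr q') powr (1 / q')"
      using qq by (intro powr_mono2) auto
    then show ?thesis using q' L qq by (simp add: powr_powr)
  qed
  ultimately show ?thesis by (simp add: HB_norm_def L_def)
qed

subsection \<open>Sufficiency of the arc condition\<close>

lemma inj_on_cis_unit: "inj_on (\<lambda>t. cis (2 * pi * t)) {0..<1}"
proof (rule inj_onI)
  fix s t :: real assume st: "s \<in> {0..<1}" "t \<in> {0..<1}" "cis (2 * pi * s) = cis (2 * pi * t)"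
  then obtain n :: int where "2 * pi * s = 2 * pi * t + 2 * pi * n"
    using sin_cos_eq_iff[of "2 * pi * s" "2 * pi * t"] by (auto simp: complex_eq_iff)
  then have "2 * pi * (s - t - n) = 0" by (simp add: algebra_simps)
  then have n: "s - t = n" by simp
  then have "n = 0" using st by auto
  then show "s = t" using n by simp
qed

lemma circle_arc_subset: "circle_arc a l \<subseteq> sphere 0 1"
  by (auto simp: circle_arc_def)

lemma compact_circle_arc: "compact (circle_arc a l)"
  unfolding circle_arc_def by (intro compact_continuous_image continuous_intros) auto

lemma disc_measure_sets: "disc_measure \<mu> \<Longrightarrow> sets \<mu> = sets borel"
  and disc_measure_finite: "disc_measure \<mu> \<Longrightarrow> finite_measure \<mu>"
  by (auto simp: disc_measure_def)

lemma integral_le_riemann_sum: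
  fixes h :: "real \<Rightarrow> real"
  assumes cont: "continuous_on {0..1} h" and n: "0 < n" and "m \<le> n"
    and le: "\<And>j t. j < n \<Longrightarrow> t \<in> {real j / real n..real (Suc j) / real n} \<Longrightarrow> h t \<le> v j"
  shows "integral {0..real m / real n} h \<le> (\<Sum>j<m. v j / real n)"
  using \<open>m \<le> n\<close>
proof (induction m)
  case (Suc m)
  have le1: "real (Suc m) / real n \<le> 1" using Suc.prems n by simp
  have int: "h integrable_on {a..b}" if "0 \<le> a" "b \<le> 1" for a b
    using that by (intro integrable_continuous_interval continuous_on_subset[OF cont]) auto
  have "integral {0..real (Suc m) / real n} h
      = integral {0..real m / real n} h + integral {real m / real n..real (Suc m) / real n} h"
    using n le1 by (intro Henstock_Kurzweil_Integration.integral_combine[symmetric] int) (auto simp: divide_right_mono)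
  also have "integral {real m / real n..real (Suc m) / real n} h \<le> integral {real m / real n..real (Suc m) / real n} (\<lambda>t. v m)"
    using le1 Suc.prems by (intro integral_le int le) (auto intro: integrable_const_ivl)
  also have "\<dots> = v m / real n" using n by (simp add: divide_right_mono flip: diff_divide_distrib)
  finally show ?case using Suc by simp
qed simp

text \<open>A Riemann sum over short disjoint arcs, on each of which \<phi> stays within e of a
  constant; the arc condition trades arc length for \<open>\<mu>\<close> up to the factor c. Letting
  e tend to 0 removes the errors.\<close>

lemma arc_lower_bound_circ_mean:
  assumes \<mu>: "disc_measure \<mu>" and c: "0 < c"
    and arcs: "\<And>a l. 0 \<le> l \<Longrightarrow> l \<le> 1 \<Longrightarrow> c * l \<le> measure \<mu> (circle_arc a l)"
    and cont: "continuous_on (sphere 0 1) \<phi>" and nonneg: "\<And>w. norm w = 1 \<Longrightarrow> 0 \<le> \<phi> w"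
  shows "ennreal (c * circ_mean \<phi>) \<le> (\<integral>\<^sup>+z\<in>sphere 0 1. ennreal (\<phi> z) \<partial>\<mu>)"
proof -
  interpret finite_measure \<mu> by (rule disc_measure_finite[OF \<mu>])
  note [measurable_cong, simp] = disc_measure_sets[OF \<mu>]
  define h where "h t = \<phi> (cis (2 * pi * t))" for t
  have conth: "continuous_on {0..1} h" unfolding h_def by (rule continuous_on_circ[OF cont])
  have h0: "0 \<le> h t" for t by (simp add: h_def nonneg)
  have main: "ennreal (c * (1 - e) * (circ_mean \<phi> - 2 * e)) \<le> (\<integral>\<^sup>+z\<in>sphere 0 1. ennreal (\<phi> z) \<partial>\<mu>)"
    if e: "0 < e" "e < 1" for e
  proof -
    have "uniformly_continuous_on {0..1} h" by (intro compact_uniformly_continuous conth) simp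
    then obtain d where d: "d > 0" "\<And>s t. s \<in> {0..1} \<Longrightarrow> t \<in> {0..1} \<Longrightarrow> dist s t < d \<Longrightarrow> dist (h s) (h t) < e"
      unfolding uniformly_continuous_on_def using e by metis
    obtain n :: nat where n: "inverse (real (Suc n)) < d" using reals_Archimedean[OF d(1)] by blast
    define N where "N = Suc n"
    have N: "0 < N" "1 / real N < d" using n by (auto simp: N_def inverse_eq_divide)
    define v where "v j = h (real j / real N)" for j
    have near: "\<bar>h t - v j\<bar> \<le> e" if "j < N" "t \<in> {real j / real N..real (Suc j) / real N}" for j t
    proof -
      have "real (Suc j) / real N \<le> 1" using that N by simp
      moreover have "t - real j / real N \<le> 1 / real N" using that by (simp add: add_divide_distrib)
      moreover have "0 \<le> real j / real N" by simp
      ultimately show ?thesis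
        using d(2)[of t "real j / real N"] that N(2) unfolding v_def atLeastAtMost_iff dist_real_def by linarith
    qed
    \<comment> \<open>Closed arcs of full length 1/N would share end points, which
      \<open>\<mu>\<close> may charge. Shrinking them makes them disjoint and loses the factor 1 -
      e.\<close>
    define l where "l = (1 - e) / real N"
    define A where "A j = circle_arc (real j / real N) l" for j
    have l: "0 < l" "l < 1 / real N" "l \<le> 1"
      using e N by (auto simp: l_def field_simps)
    have sub: "{real j / real N..real j / real N + l} \<subseteq> {real j / real N..<real (Suc j) / real N}" for j
      using l by (auto simp: add_divide_distrib)
    have Asub: "A j \<subseteq> (\<lambda>t. cis (2 * pi * t)) ` {real j / real N..<real (Suc j) / real N}" for j
      unfolding A_def circle_arc_def by (rule image_mono[OF sub])
    have Ameas [measurable]: "A j \<in> sets \<mu>" for j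
      unfolding A_def by (simp add: borel_compact compact_circle_arc)
    have Ah: "v j - e \<le> \<phi> z" if j: "j < N" and z: "z \<in> A j" for j z
    proof -
      obtain t where t: "t \<in> {real j / real N..real j / real N + l}" "z = cis (2 * pi * t)"
        using z by (auto simp: A_def circle_arc_def)
      then have "t \<in> {real j / real N..real (Suc j) / real N}" using sub[of j] by auto
      then show ?thesis using near[OF j, of t] by (simp add: h_def t(2))
    qed
    have disj: "z \<notin> A j" if "i < N" "j < N" "i \<noteq> j" "z \<in> A i" for i j z
    proof
      assume "z \<in> A j"
      then obtain t where t: "t \<in> {real j / real N..<real (Suc j) / real N}" "z = cis (2 * pi * t)"
        using Asub[of j] by blast
      obtain s where s: "s \<in> {real i / real N..<real (Suc i) / real N}" "z = cis (2 * pi * s)"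
        using \<open>z \<in> A i\<close> Asub[of i] by blast
      have unit: "x \<in> {0..<1}" if x: "x \<in> {real k / real N..<real (Suc k) / real N}" and k: "k < N" for x k
      proof -
        have "real (Suc k) / real N \<le> 1" using k N by simp
        moreover have "0 \<le> real k / real N" by simp
        ultimately show ?thesis using x unfolding atLeastLessThan_iff by linarith
      qed
      have "s = t"
        using inj_onD[OF inj_on_cis_unit] s t unit \<open>i < N\<close> \<open>j < N\<close> by metis
      then have "real i < real (Suc j)" "real j < real (Suc i)"
        using s t N by (auto simp: field_simps)
      then show False using \<open>i \<noteq> j\<close> by linarith
    qed
    \<comment> \<open>One e comes from bounding the mean by an upper sum, the other from using the
      lower values \<open>v j - e\<close>. The maximum with 0 keeps the coefficients nonnegative, as
      \<open>ennreal\<close> requires.\<close>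
    have "c * (1 - e) * (circ_mean \<phi> - 2 * e) \<le> (\<Sum>j<N. max 0 (v j - e) * (c * l))"
    proof -
      have "circ_mean \<phi> = integral {0..real N / real N} h"
        using N by (simp add: circ_mean_def h_def[abs_def])
      also have "\<dots> \<le> (\<Sum>j<N. (v j + e) / real N)"
        by (rule integral_le_riemann_sum[OF conth N(1)]) (use near in \<open>auto simp: abs_le_iff algebra_simps\<close>)
      also have "\<dots> = (\<Sum>j<N. (v j - e) / real N) + 2 * e"
        using N by (simp add: add_divide_distrib diff_divide_distrib sum.distrib sum_subtractf)
      finally have "c * (1 - e) * (circ_mean \<phi> - 2 * e) \<le> c * (1 - e) * (\<Sum>j<N. (v j - e) / real N)"
        using c e by (intro mult_left_mono) auto
      also have "\<dots> = (\<Sum>j<N. (v j - e) * (c * l))"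
        by (simp add: sum_distrib_left l_def mult_ac)
      also have "\<dots> \<le> (\<Sum>j<N. max 0 (v j - e) * (c * l))"
        using c l by (intro sum_mono mult_right_mono) auto
      finally show ?thesis .
    qed
    then have "ennreal (c * (1 - e) * (circ_mean \<phi> - 2 * e)) \<le> ennreal (\<Sum>j<N. max 0 (v j - e) * (c * l))"
      by (rule ennreal_leI)
    also have "\<dots> = (\<Sum>j<N. ennreal (max 0 (v j - e)) * ennreal (c * l))"
      using c l by (subst sum_ennreal[symmetric]) (auto simp: ennreal_mult')
    also have "\<dots> \<le> (\<Sum>j<N. ennreal (max 0 (v j - e)) * emeasure \<mu> (A j))"
      unfolding A_def emeasure_eq_measure using arcs[of l] l
      by (intro sum_mono mult_left_mono ennreal_leI) auto
    also have "\<dots> = (\<integral>\<^sup>+z. (\<Sum>j<N. ennreal (max 0 (v j - e)) * indicator (A j) z) \<partial>\<mu>)"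
      by (subst nn_integral_sum, measurable) (intro sum.cong refl nn_integral_cmult_indicator[symmetric] Ameas)
    also have "\<dots> \<le> (\<integral>\<^sup>+z\<in>sphere 0 1. ennreal (\<phi> z) \<partial>\<mu>)"
    proof (rule nn_integral_mono)
      fix z
      show "(\<Sum>j<N. ennreal (max 0 (v j - e)) * indicator (A j) z) \<le> ennreal (\<phi> z) * indicator (sphere 0 1) z"
      proof (cases "\<exists>i<N. z \<in> A i")
        case True
        then obtain i where i: "i < N" "z \<in> A i" by blast
        have "z \<in> sphere 0 1" using i(2) circle_arc_subset unfolding A_def by blast
        moreover have "(\<Sum>j<N. ennreal (max 0 (v j - e)) * indicator (A j) z) = ennreal (max 0 (v i - e))"
          using i disj[of i] by (subst sum.remove[of _ i]) (auto intro!: sum.neutral)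
        ultimately show ?thesis using Ah[OF i] nonneg[of z] by (auto intro!: ennreal_leI)
      next
        case False
        then have "(\<Sum>j<N. ennreal (max 0 (v j - e)) * indicator (A j) z) = 0"
          by (intro sum.neutral) auto
        then show ?thesis by simp
      qed
    qed
    finally show ?thesis .
  qed
  show ?thesis
  proof (rule tendsto_upperbound)
    have "((\<lambda>e. c * (1 - e) * (circ_mean \<phi> - 2 * e)) \<longlongrightarrow> c * (1 - 0) * (circ_mean \<phi> - 2 * 0)) (at_right 0)"
      by (intro tendsto_intros)
    then show "((\<lambda>e. ennreal (c * (1 - e) * (circ_mean \<phi> - 2 * e))) \<longlongrightarrow> ennreal (c * circ_mean \<phi>)) (at_right 0)"
      by (intro tendsto_ennrealI) simp
    show "\<forall>\<^sub>F e in at_right 0. ennreal (c * (1 - e) * (circ_mean \<phi> - 2 * e)) \<le> (\<integral>\<^sup>+z\<in>sphere 0 1. ennreal (\<phi> z) \<partial>\<mu>)"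
      by (rule eventually_at_rightI[of 0 1]) (auto intro: main)
  qed simp
qed

lemma continuous_on_indicator_powr_measurable:
  assumes \<mu>: "disc_measure \<mu>" and f: "continuous_on S f" and S: "S \<in> sets borel" and p: "0 < p"
  shows "(\<lambda>z. ennreal (norm (f z) powr p) * indicator S z) \<in> borel_measurable \<mu>"
proof -
  have "continuous_on S (\<lambda>z. norm (f z) powr p)"
    using p by (intro continuous_on_powr_nonneg continuous_intros f) auto
  from borel_measurable_continuous_on_indicator[OF S this]
  have "(\<lambda>z. ennreal (indicator S z * norm (f z) powr p)) \<in> borel_measurable borel" by simp
  also have "(\<lambda>z. ennreal (indicator S z * norm (f z) powr p)) = (\<lambda>z. ennreal (norm (f z) powr p) * indicator S z)"
    by (auto simp: indicator_def)
  finally show ?thesis using measurable_cong_sets[OF disc_measure_sets[OF \<mu>] refl] by blast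
qed

lemma nn_integral_powr_le:
  assumes \<mu>: "disc_measure \<mu>" and "\<And>z. z \<in> S \<Longrightarrow> norm (f z) \<le> B" and p: "0 < p"
  shows "(\<integral>\<^sup>+z\<in>S. ennreal (norm (f z) powr p) \<partial>\<mu>) \<le> ennreal (B powr p) * emeasure \<mu> UNIV"
proof -
  have "(\<integral>\<^sup>+z\<in>S. ennreal (norm (f z) powr p) \<partial>\<mu>) \<le> (\<integral>\<^sup>+z. ennreal (B powr p) \<partial>\<mu>)"
    using assms(2) p by (intro nn_integral_mono) (auto simp: indicator_def intro!: ennreal_leI powr_mono2)
  then show ?thesis
    using sets_eq_imp_space_eq[OF disc_measure_sets[OF \<mu>]] by simp
qed

lemma emeasure_disc_measure_finite: "disc_measure \<mu> \<Longrightarrow> emeasure \<mu> A < \<infinity>"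
  using finite_measure.emeasure_finite[OF disc_measure_finite] by (simp add: less_top)

lemma nn_integral_powr_finite:
  assumes \<mu>: "disc_measure \<mu>" and f: "continuous_on (cball 0 1) f" and p: "0 < p"
  shows "(\<integral>\<^sup>+z\<in>cball 0 1. ennreal (norm (f z) powr p) \<partial>\<mu>) < \<infinity>"
proof -
  have "bounded (f ` cball 0 1)" by (intro compact_imp_bounded compact_continuous_image f) simp
  then obtain B where B: "\<And>z. z \<in> cball 0 1 \<Longrightarrow> norm (f z) \<le> B" unfolding bounded_iff by blast
  from nn_integral_powr_le[where S = "cball 0 1" and f = f and B = B, OF \<mu> B p] show ?thesis
    using emeasure_disc_measure_finite[OF \<mu>] by (simp add: ennreal_mult_less_top order_le_less_trans)
qed

lemma Lp_mu_le:
  assumes \<mu>: "disc_measure \<mu>" and "\<And>z. z \<in> cball 0 1 \<Longrightarrow> norm (f z) \<le> B" and p: "0 < p" and B: "0 \<le> B"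
  shows "Lp_mu \<mu> p f \<le> B * measure \<mu> UNIV powr (1 / p)"
proof -
  have "enn2real (\<integral>\<^sup>+z\<in>cball 0 1. ennreal (norm (f z) powr p) \<partial>\<mu>) \<le> enn2real (ennreal (B powr p) * emeasure \<mu> UNIV)"
    using emeasure_disc_measure_finite[OF \<mu>] nn_integral_powr_le[where S = "cball 0 1" and f = f, OF \<mu> assms(2) p]
    by (intro enn2real_mono) (auto simp: ennreal_mult_less_top)
  also have "\<dots> = B powr p * measure \<mu> UNIV"
    by (simp add: enn2real_mult measure_def)
  finally have "Lp_mu \<mu> p f \<le> (B powr p * measure \<mu> UNIV) powr (1 / p)"
    unfolding Lp_mu_def using p by (intro powr_mono2) auto
  then show ?thesis using p B by (simp add: powr_mult powr_powr)
qed

lemma arc_lower_bound_imp_reverse_carleson: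
  assumes \<mu>: "disc_measure \<mu>" and arc: "arc_lower_bound \<mu>"
    and p: "1 \<le> p" and q: "2 \<le> q" "ereal p \<le> q"
  shows "reverse_carleson 0 p q \<mu>"
proof -
  obtain c where c: "c > 0" "\<And>a l. 0 \<le> l \<Longrightarrow> l \<le> 1 \<Longrightarrow> c * l \<le> measure \<mu> (circle_arc a l)"
    using arc unfolding arc_lower_bound_def by blast
  have "HB_norm 0 p q f \<le> (5 * c powr (- 1 / p)) * Lp_mu \<mu> p f"
    if f: "f \<in> HB 0 p q" "continuous_on (cball 0 1) f" for f
  proof -
    have hol: "f holomorphic_on ball 0 1" using f(1) by (simp add: HB_def)
    have contS: "continuous_on (sphere 0 1) f" using f(2) by (rule continuous_on_subset) auto
    have contp: "continuous_on (sphere 0 1) (\<lambda>w. norm (f w) powr p)"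
      using p by (intro continuous_on_powr_nonneg continuous_intros contS) auto
    have "ennreal (c * circ_mean (\<lambda>w. norm (f w) powr p)) \<le> (\<integral>\<^sup>+z\<in>sphere 0 1. ennreal (norm (f z) powr p) \<partial>\<mu>)"
      by (rule arc_lower_bound_circ_mean[OF \<mu> c contp]) auto
    also have "\<dots> \<le> (\<integral>\<^sup>+z\<in>cball 0 1. ennreal (norm (f z) powr p) \<partial>\<mu>)"
      by (intro nn_integral_mono) (auto simp: indicator_def)
    finally have "c * circ_mean (\<lambda>w. norm (f w) powr p) \<le> enn2real (\<integral>\<^sup>+z\<in>cball 0 1. ennreal (norm (f z) powr p) \<partial>\<mu>)"
      using nn_integral_powr_finite[OF \<mu> f(2), of p] p c circ_mean_nonneg[of "\<lambda>w. norm (f w) powr p"]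
      by (subst (asm) ennreal_enn2real[symmetric]) auto
    then have "(c * circ_mean (\<lambda>w. norm (f w) powr p)) powr (1 / p) \<le> Lp_mu \<mu> p f"
      unfolding Lp_mu_def using c p by (intro powr_mono2) (auto intro!: mult_nonneg_nonneg circ_mean_nonneg)
    moreover have "circ_Lp p f 1 = circ_mean (\<lambda>w. norm (f w) powr p) powr (1 / p)"
      using circ_Lp_eq[of f 1 p] contS p by simp
    ultimately have "c powr (1 / p) * circ_Lp p f 1 \<le> Lp_mu \<mu> p f"
      using c by (simp add: powr_mult circ_mean_nonneg)
    then have "circ_Lp p f 1 \<le> c powr (- 1 / p) * Lp_mu \<mu> p f"
      using c by (simp add: powr_minus_divide field_simps)
    then show ?thesis using HB_norm_le_circ_Lp[OF f(2) hol p q] by simp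
  qed
  moreover have "0 < 5 * c powr (- 1 / p)" using c by simp
  ultimately show ?thesis unfolding reverse_carleson_def by blast
qed

subsection \<open>Lower bounds for Besov norms\<close>

lemma circ_Lp_le_const:
  assumes "continuous_on (sphere 0 1) (\<lambda>w. g (complex_of_real r * w))" "0 < p"
    and "\<And>w. norm w = 1 \<Longrightarrow> norm (g (complex_of_real r * w)) \<le> B" and "0 \<le> B"
  shows "circ_Lp p g r \<le> B"
proof -
  have c: "continuous_on (sphere 0 1) (\<lambda>w. norm (g (complex_of_real r * w)) powr p)"
    using assms by (intro continuous_on_powr_nonneg continuous_intros) auto
  have "circ_mean (\<lambda>w. norm (g (complex_of_real r * w)) powr p) \<le> circ_mean (\<lambda>w. B powr p)"
    using assms by (intro circ_mean_mono c continuous_intros powr_mono2) auto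
  then have "circ_Lp p g r \<le> (B powr p) powr (1 / p)"
    unfolding circ_Lp_eq[OF assms(1,2)] using assms by (intro powr_mono2 circ_mean_nonneg) auto
  then show ?thesis using assms by (simp add: powr_powr)
qed

lemma circ_Lp_ge_const:
  assumes "continuous_on (sphere 0 1) (\<lambda>w. g (complex_of_real r * w))" "0 < p"
    and "\<And>w. norm w = 1 \<Longrightarrow> A \<le> norm (g (complex_of_real r * w))" and "0 \<le> A"
  shows "A \<le> circ_Lp p g r"
proof -
  have c: "continuous_on (sphere 0 1) (\<lambda>w. norm (g (complex_of_real r * w)) powr p)"
    using assms by (intro continuous_on_powr_nonneg continuous_intros) auto
  have "circ_mean (\<lambda>w::complex. A powr p) \<le> circ_mean (\<lambda>w. norm (g (complex_of_real r * w)) powr p)"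
    using assms by (intro circ_mean_mono c continuous_intros powr_mono2) auto
  then have "(A powr p) powr (1 / p) \<le> circ_Lp p g r"
    unfolding circ_Lp_eq[OF assms(1,2)] using assms by (intro powr_mono2) auto
  then show ?thesis using assms by (simp add: powr_powr)
qed

lemma besov_m_gt: "0 \<le> s \<Longrightarrow> s < real (besov_m s)"
  unfolding besov_m_def by linarith

lemma entire_bounded_on_disc:
  assumes "f holomorphic_on UNIV"
  obtains B :: real where "0 < B" "\<And>z. norm z \<le> 1 \<Longrightarrow> norm (f z) \<le> B"
proof -
  have "bounded (f ` cball 0 1)"
    by (intro compact_imp_bounded compact_continuous_image holomorphic_on_imp_continuous_on
        holomorphic_on_subset[OF assms]) auto
  then show ?thesis using that unfolding bounded_pos by auto
qed

lemma entire_continuous_circle: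
  "f holomorphic_on UNIV \<Longrightarrow> continuous_on (sphere 0 1) (\<lambda>w. f (complex_of_real r * w))"
  by (rule continuous_on_circle_of_radius[of UNIV]) (auto intro: holomorphic_on_imp_continuous_on)

lemma nn_integral_one_minus_powr_le:
  fixes \<gamma> :: real
  assumes "0 < \<gamma>"
  shows "(\<integral>\<^sup>+r\<in>{0<..<1}. ennreal ((1 - r) powr (\<gamma> - 1)) \<partial>lborel) \<le> ennreal (1 / \<gamma>)"
proof (rule nn_integral_unit_interval_le)
  have "continuous_on {0<..<1} (\<lambda>r::real. (1 - r) powr (\<gamma> - 1))"
    by (intro continuous_intros) auto
  from borel_measurable_continuous_on_indicator[OF _ this]
  have "(\<lambda>r. ennreal (indicator {0<..<1} r * (1 - r) powr (\<gamma> - 1))) \<in> borel_measurable borel" by simp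
  also have "(\<lambda>r. ennreal (indicator {0<..<1} r * (1 - r) powr (\<gamma> - 1))) = (\<lambda>r. ennreal ((1 - r) powr (\<gamma> - 1)) * indicator {0<..<1} r)"
    by (auto simp: indicator_def fun_eq_iff)
  finally show "(\<lambda>r. ennreal ((1 - r) powr (\<gamma> - 1)) * indicator {0<..<1} r) \<in> borel_measurable borel" .
  fix \<rho> :: real assume \<rho>: "0 < \<rho>" "\<rho> < 1"
  have "((\<lambda>r. (1 - r) powr (\<gamma> - 1)) has_integral (- ((1 - \<rho>) powr \<gamma> / \<gamma>) - (- ((1 - 0) powr \<gamma> / \<gamma>)))) {0..\<rho>}"
  proof (rule fundamental_theorem_of_calculus)
    fix r assume r: "r \<in> {0..\<rho>}"
    then have "((\<lambda>r. - ((1 - r) powr \<gamma> / \<gamma>)) has_real_derivative (1 - r) powr (\<gamma> - 1)) (at r within {0..\<rho>})"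
      using \<rho> assms by (auto intro!: derivative_eq_intros)
    then show "((\<lambda>r. - ((1 - r) powr \<gamma> / \<gamma>)) has_vector_derivative (1 - r) powr (\<gamma> - 1)) (at r within {0..\<rho>})"
      by (simp add: has_real_derivative_iff_has_vector_derivative)
  qed (use \<rho> in auto)
  then have "integral {0..\<rho>} (\<lambda>r. (1 - r) powr (\<gamma> - 1)) \<le> 1 / \<gamma>"
    using assms \<rho> by (simp add: integral_unique)
  moreover have "(\<integral>\<^sup>+r\<in>{0..\<rho>}. ennreal ((1 - r) powr (\<gamma> - 1)) \<partial>lborel) = ennreal (integral {0..\<rho>} (\<lambda>r. (1 - r) powr (\<gamma> - 1)))"
    using \<rho> by (intro nn_integral_continuous_interval continuous_intros) auto
  ultimately show "(\<integral>\<^sup>+r\<in>{0..\<rho>}. ennreal ((1 - r) powr (\<gamma> - 1)) \<partial>lborel) \<le> ennreal (1 / \<gamma>)"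
    by (simp add: ennreal_leI)
qed

lemma besov_integrand_eq:
  fixes L r q \<gamma> :: real
  assumes "r < 1" "0 < q" "0 \<le> L"
  shows "(L * (1 - r) powr (\<gamma> - 1 / q)) powr q = L powr q * (1 - r) powr (q * \<gamma> - 1)"
proof -
  have "(\<gamma> - 1 / q) * q = q * \<gamma> - 1" using assms by (simp add: algebra_simps)
  then show ?thesis using assms by (simp add: powr_mult powr_powr)
qed

text \<open>All derivatives are bounded on the closed disc, and the remaining weight (1 - r)^(q
  \<gamma> - 1) is integrable because m > s makes \<gamma> positive. Entire functions are thus
  admissible tests for all exponents considered.\<close>

lemma entire_in_HB:
  assumes f: "f holomorphic_on UNIV" and s: "0 \<le> s" and p: "0 < p" and q: "0 < q"
  shows "f \<in> HB s p q"
proof -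
  define g where "g = (deriv ^^ besov_m s) f"
  define \<gamma> where "\<gamma> = real (besov_m s) - s"
  have \<gamma>: "0 < \<gamma>" using besov_m_gt[OF s] by (simp add: \<gamma>_def)
  have g: "g holomorphic_on UNIV" unfolding g_def by (intro holomorphic_higher_deriv f) auto
  obtain B where B: "0 < B" "\<And>z. norm z \<le> 1 \<Longrightarrow> norm (g z) \<le> B" using entire_bounded_on_disc[OF g] by metis
  have L: "circ_Lp p g r \<le> B" if "r \<in> {0<..<1}" for r
    by (rule circ_Lp_le_const[OF entire_continuous_circle[OF g] p])
       (use that B in \<open>auto simp: norm_mult intro!: B(2)\<close>)
  have "besov_part s p q f < \<infinity>"
  proof (cases "q = \<infinity>")
    case True
    have "besov_part s p q f \<le> ennreal B"
      unfolding besov_part_def Let_def using True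
    proof (simp flip: g_def \<gamma>_def, intro SUP_least ennreal_leI)
      fix r :: real assume r: "r \<in> {0<..<1}"
      have "circ_Lp p g r * (1 - r) powr \<gamma> \<le> B * 1"
        using r L[OF r] B(1) \<gamma> by (intro mult_mono powr_le1) auto
      then show "circ_Lp p g r * (1 - r) powr \<gamma> \<le> B" by simp
    qed
    then show ?thesis by (simp add: order_le_less_trans)
  next
    case False
    then obtain q' where q': "q = ereal q'" "0 < q'" using q by (cases q) auto
    have "besov_part s p q f = (\<integral>\<^sup>+r\<in>{0<..<1}. ennreal ((circ_Lp p g r * (1 - r) powr (\<gamma> - 1 / q')) powr q') \<partial>lborel)"
      by (simp add: besov_part_def q' Let_def g_def \<gamma>_def)
    also have "\<dots> \<le> (\<integral>\<^sup>+r. ennreal (B powr q') * (ennreal ((1 - r) powr (q' * \<gamma> - 1)) * indicator {0<..<1} r) \<partial>lborel)"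
    proof (rule nn_integral_mono)
      fix r :: real
      show "ennreal ((circ_Lp p g r * (1 - r) powr (\<gamma> - 1 / q')) powr q') * indicator {0<..<1} r
          \<le> ennreal (B powr q') * (ennreal ((1 - r) powr (q' * \<gamma> - 1)) * indicator {0<..<1} r)"
      proof (cases "r \<in> {0<..<1}")
        case True
        have "(circ_Lp p g r * (1 - r) powr (\<gamma> - 1 / q')) powr q' = circ_Lp p g r powr q' * (1 - r) powr (q' * \<gamma> - 1)"
          using True q' by (intro besov_integrand_eq circ_Lp_nonneg) auto
        also have "\<dots> \<le> B powr q' * (1 - r) powr (q' * \<gamma> - 1)"
          using L[OF True] q' by (intro mult_right_mono powr_mono2 circ_Lp_nonneg) auto
        finally show ?thesis using True by (simp add: ennreal_leI flip: ennreal_mult')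
      qed simp
    qed
    also have "\<dots> = ennreal (B powr q') * (\<integral>\<^sup>+r\<in>{0<..<1}. ennreal ((1 - r) powr (q' * \<gamma> - 1)) \<partial>lborel)"
      by (rule nn_integral_cmult) measurable
    also have "\<dots> \<le> ennreal (B powr q') * ennreal (1 / (q' * \<gamma>))"
      using q' \<gamma> by (intro mult_left_mono nn_integral_one_minus_powr_le) auto
    also have "\<dots> < \<infinity>" by (simp add: ennreal_mult_less_top)
    finally show ?thesis .
  qed
  then show ?thesis using holomorphic_on_subset[OF f] by (simp add: HB_def)
qed

text \<open>One dyadic ring suffices: there (1 - r)^\<gamma> is at least (\<delta>/2)^\<gamma>, and
  the ring has mass at least 1/2 for dr/(1 - r), the density being at least 1/\<delta> on length
  \<delta>/2.\<close>

lemma besov_dyadic_lower: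
  assumes q: "0 < q" and \<delta>: "0 < \<delta>" "\<delta> < 1" and A: "0 \<le> A"
    and le: "\<And>r. 1 - \<delta> \<le> r \<Longrightarrow> r \<le> 1 - \<delta> / 2 \<Longrightarrow> A \<le> L r" and \<gamma>: "0 < \<gamma>"
  shows "ennreal ((A * (\<delta> / 2) powr \<gamma>) powr q / 2)
    \<le> (\<integral>\<^sup>+r\<in>{1 - \<delta>..1 - \<delta> / 2}. ennreal ((L r * (1 - r) powr (\<gamma> - 1 / q)) powr q) \<partial>lborel)"
proof -
  define K where "K = (A * (\<delta> / 2) powr \<gamma>) powr q / \<delta>"
  have "ennreal ((A * (\<delta> / 2) powr \<gamma>) powr q / 2) = ennreal K * emeasure lborel {1 - \<delta>..1 - \<delta> / 2}"
    using \<delta> A by (simp add: K_def flip: ennreal_mult'')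
  also have "\<dots> = (\<integral>\<^sup>+r\<in>{1 - \<delta>..1 - \<delta> / 2}. ennreal K \<partial>lborel)"
    by (rule nn_integral_cmult_indicator[symmetric]) simp
  also have "\<dots> \<le> (\<integral>\<^sup>+r\<in>{1 - \<delta>..1 - \<delta> / 2}. ennreal ((L r * (1 - r) powr (\<gamma> - 1 / q)) powr q) \<partial>lborel)"
  proof (rule nn_integral_mono)
    fix r :: real
    show "ennreal K * indicator {1 - \<delta>..1 - \<delta> / 2} r
       \<le> ennreal ((L r * (1 - r) powr (\<gamma> - 1 / q)) powr q) * indicator {1 - \<delta>..1 - \<delta> / 2} r"
    proof (cases "r \<in> {1 - \<delta>..1 - \<delta> / 2}")
      case True
      then have r: "\<delta> / 2 \<le> 1 - r" "1 - r \<le> \<delta>" "r < 1" using \<delta> by auto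
      have AL: "A \<le> L r" using le[of r] True by auto
      have "K = A powr q * ((\<delta> / 2) powr (q * \<gamma>) / \<delta>)"
        using A \<delta> by (simp add: K_def powr_mult powr_powr mult.commute)
      also have "\<dots> \<le> L r powr q * ((1 - r) powr (q * \<gamma>) / (1 - r))"
        using r \<delta> A AL q \<gamma> by (intro mult_mono frac_le powr_mono2) auto
      also have "\<dots> = (L r * (1 - r) powr (\<gamma> - 1 / q)) powr q"
        using r A AL q by (subst besov_integrand_eq) (auto simp: powr_diff)
      finally show ?thesis using True by (simp add: ennreal_leI)
    qed simp
  qed
  finally show ?thesis .
qed

text \<open>For q = \<open>\<infinity>\<close> the factor below is 2 powr 0 = 1, because real_of_ereal \<open>\<infinity>\<close> = 0.\<close>

lemma HB_norm_dyadic_lower: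
  assumes f: "f \<in> HB s p q" and s: "0 \<le> s" and q: "0 < q" and \<delta>: "0 < \<delta>" "\<delta> < 1" and A: "0 \<le> A"
    and le: "\<And>r. 1 - \<delta> \<le> r \<Longrightarrow> r \<le> 1 - \<delta> / 2 \<Longrightarrow> A \<le> circ_Lp p ((deriv ^^ besov_m s) f) r"
  shows "2 powr (- 1 / real_of_ereal q) * (A * (\<delta> / 2) powr (real (besov_m s) - s)) \<le> HB_norm s p q f"
proof -
  define \<gamma> where "\<gamma> = real (besov_m s) - s"
  have \<gamma>: "0 < \<gamma>" using besov_m_gt[OF s] by (simp add: \<gamma>_def)
  have fin: "besov_part s p q f < \<infinity>" using f by (simp add: HB_def)
  have sum0: "0 \<le> (\<Sum>j<besov_m s. norm ((deriv ^^ j) f 0))" by (intro sum_nonneg) simp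
  show ?thesis
  proof (cases "q = \<infinity>")
    case True
    define r where "r = 1 - \<delta> / 2"
    have "ennreal (A * (\<delta> / 2) powr \<gamma>) \<le> ennreal (circ_Lp p ((deriv ^^ besov_m s) f) r * (1 - r) powr \<gamma>)"
      using \<delta> by (intro ennreal_leI mult_mono le) (auto simp: r_def circ_Lp_nonneg)
    also have "\<dots> \<le> besov_part s p q f"
      using True \<delta> by (simp add: besov_part_def Let_def \<gamma>_def) (rule SUP_upper, simp add: r_def)
    finally have "A * (\<delta> / 2) powr \<gamma> \<le> enn2real (besov_part s p q f)"
      using fin A by (subst (asm) ennreal_enn2real[symmetric]) auto
    then show ?thesis using True sum0 by (simp add: HB_norm_def \<gamma>_def)
  next
    case False
    then obtain q' where q': "q = ereal q'" "0 < q'" using q by (cases q) auto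
    have "ennreal ((A * (\<delta> / 2) powr \<gamma>) powr q' / 2)
      \<le> (\<integral>\<^sup>+r\<in>{1 - \<delta>..1 - \<delta> / 2}. ennreal ((circ_Lp p ((deriv ^^ besov_m s) f) r * (1 - r) powr (\<gamma> - 1 / q')) powr q') \<partial>lborel)"
      by (rule besov_dyadic_lower[OF q'(2) \<delta> A le \<gamma>])
    also have "\<dots> \<le> besov_part s p q f"
      unfolding besov_part_def Let_def using q' \<delta>
      by (auto simp: \<gamma>_def indicator_def intro!: nn_integral_mono)
    finally have "(A * (\<delta> / 2) powr \<gamma>) powr q' / 2 \<le> enn2real (besov_part s p q f)"
      using fin A by (subst (asm) ennreal_enn2real[symmetric]) auto
    then have "((A * (\<delta> / 2) powr \<gamma>) powr q' / 2) powr (1 / q') \<le> enn2real (besov_part s p q f) powr (1 / q')"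
      using q' by (intro powr_mono2) auto
    moreover have "((A * (\<delta> / 2) powr \<gamma>) powr q' / 2) powr (1 / q') = 2 powr (- 1 / q') * (A * (\<delta> / 2) powr \<gamma>)"
    proof -
      define X where "X = A * (\<delta> / 2) powr \<gamma>"
      have "0 \<le> X" using A by (simp add: X_def)
      then have "(X powr q' / 2) powr (1 / q') = 2 powr (- 1 / q') * X"
        using q' by (simp add: powr_divide powr_powr powr_minus_divide)
      then show ?thesis by (simp add: X_def)
    qed
    ultimately show ?thesis using q' sum0 by (simp add: HB_norm_def \<gamma>_def)
  qed
qed

text \<open>Bernoulli's inequality. It makes the ring at distance about 1/n from the circle the
  natural scale of the frequency n.\<close>

lemma power_ge_half:
  fixes r :: real
  assumes "0 < n" "1 - 1 / (2 * real n) \<le> r" "r \<le> 1" "k \<le> n"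
  shows "1 / 2 \<le> r ^ k"
proof -
  have n: "1 / (2 * real n) \<le> 1" using assms by (simp add: field_simps)
  have "1 / 2 = 1 + real n * (- (1 / (2 * real n)))" using assms by simp
  also have "\<dots> \<le> (1 + - (1 / (2 * real n))) ^ n"
    using n by (intro Bernoulli_inequality) auto
  also have "\<dots> \<le> r ^ n" using assms n by (intro power_mono) auto
  also have "\<dots> \<le> r ^ k"
  proof (rule power_decreasing)
    have "0 \<le> 1 - 1 / (2 * real n)" using n by simp
    then show "0 \<le> r" using assms(2) by linarith
  qed (use assms in auto)
  finally show ?thesis .
qed

lemma power_le_pochhammer: "(a::nat) ^ m \<le> pochhammer a m"
proof (induction m)
  case (Suc m)
  then show ?case using mult_le_mono[OF Suc, of a "a + m"] by (simp add: pochhammer_Suc mult.commute)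
qed simp

text \<open>In the ring where 1 - r is about 1/n, the m-th derivative has size about n^m and the
  weight contributes n^(s - m), so n^s remains. The condition on n gives n + 1 - m \<ge>
  n/2.\<close>

lemma HB_norm_monomial_lower:
  assumes s: "0 \<le> s" and p: "0 < p" and q: "0 < q" and n: "2 * besov_m s \<le> n"
  defines "m \<equiv> besov_m s"
  shows "2 powr (- 1 / real_of_ereal q) * (1 / 2 ^ Suc m * 4 powr (s - real m)) * real n powr s \<le> HB_norm s p q (\<lambda>z. z ^ n)"
proof -
  define \<delta> where "\<delta> = 1 / (2 * real n)"
  have "0 < m" by (simp add: m_def besov_m_def)
  then have n0: "0 < n" using n by (simp add: m_def)
  have n2: "2 * m \<le> n" using n by (simp add: m_def)
  have \<delta>: "0 < \<delta>" "\<delta> < 1" using n0 by (auto simp: \<delta>_def field_simps)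
  define A where "A = (real n / 2) ^ m / 2"
  have hol: "(\<lambda>z. z ^ n) holomorphic_on UNIV" by (intro holomorphic_intros)
  have "2 powr (- 1 / real_of_ereal q) * (A * (\<delta> / 2) powr (real (besov_m s) - s)) \<le> HB_norm s p q (\<lambda>z. z ^ n)"
  proof (rule HB_norm_dyadic_lower[OF entire_in_HB[OF hol s p q] s q \<delta>])
    fix r assume r: "1 - \<delta> \<le> r" "r \<le> 1 - \<delta> / 2"
    have r1: "r \<le> 1" "0 \<le> r" using r \<delta> by auto
    show "A \<le> circ_Lp p ((deriv ^^ besov_m s) (\<lambda>z. z ^ n)) r"
    proof (rule circ_Lp_ge_const[OF entire_continuous_circle p])
      fix w :: complex assume w: "norm w = 1"
      have "(deriv ^^ m) (\<lambda>z. z ^ n) (complex_of_real r * w) = pochhammer (of_nat (Suc n - m)) m * (complex_of_real r * w) ^ (n - m)"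
        using higher_deriv_power[of m 0 n "complex_of_real r * w"] by simp
      then have "norm ((deriv ^^ m) (\<lambda>z. z ^ n) (complex_of_real r * w)) = real (pochhammer (Suc n - m) m) * r ^ (n - m)"
        using w r1 by (simp add: norm_mult norm_power pochhammer_of_nat)
      moreover have "1 / 2 \<le> r ^ (n - m)"
        by (rule power_ge_half[OF n0]) (use r r1 \<delta>_def in auto)
      moreover have "(real n / 2) ^ m \<le> real (pochhammer (Suc n - m) m)"
      proof -
        have "(real n / 2) ^ m \<le> real (Suc n - m) ^ m" using n2 by (intro power_mono) auto
        also have "\<dots> \<le> real (pochhammer (Suc n - m) m)"
          using power_le_pochhammer[of "Suc n - m" m] by (metis of_nat_le_iff of_nat_power)
        finally show ?thesis .
      qed
      ultimately have "(real n / 2) ^ m * (1 / 2) \<le> norm ((deriv ^^ m) (\<lambda>z. z ^ n) (complex_of_real r * w))"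
        using mult_mono[of "(real n / 2) ^ m" _ "1 / 2" "r ^ (n - m)"] by simp
      then show "A \<le> norm ((deriv ^^ besov_m s) (\<lambda>z. z ^ n) (complex_of_real r * w))"
        by (simp add: A_def m_def)
    qed (auto simp: A_def intro!: holomorphic_higher_deriv hol)
  qed (simp add: A_def)
  moreover have "A * (\<delta> / 2) powr (real m - s) = 1 / 2 ^ Suc m * 4 powr (s - real m) * real n powr s"
  proof -
    have "(\<delta> / 2) powr (real m - s) = (4 * real n) powr (s - real m)"
      using n0 by (simp add: \<delta>_def powr_divide powr_diff)
    also have "\<dots> = 4 powr (s - real m) * (real n powr s / real n ^ m)"
      using n0 by (simp add: powr_mult powr_diff[of "real n"] powr_realpow)
    finally show ?thesis using n0 by (simp add: A_def power_divide)
  qed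
  ultimately show ?thesis by (simp add: m_def mult.assoc)
qed

lemma not_reverse_carleson_positive_smoothness:
  assumes \<mu>: "disc_measure \<mu>" and s: "0 < s" and p: "0 < p" and q: "0 < q"
  shows "\<not> reverse_carleson s p q \<mu>"
proof
  assume "reverse_carleson s p q \<mu>"
  then obtain C where C: "C > 0" "\<And>f. f \<in> HB s p q \<Longrightarrow> continuous_on (cball 0 1) f \<Longrightarrow> HB_norm s p q f \<le> C * Lp_mu \<mu> p f"
    unfolding reverse_carleson_def by blast
  define K where "K = C * measure \<mu> UNIV powr (1 / p)"
  define k where "k = 2 powr (- 1 / real_of_ereal q) * (1 / 2 ^ Suc (besov_m s) * 4 powr (s - real (besov_m s)))"
  have k: "k > 0" by (simp add: k_def)
  have bound: "k * real n powr s \<le> K" if n: "2 * besov_m s \<le> n" for n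
  proof -
    have hol: "(\<lambda>z::complex. z ^ n) holomorphic_on UNIV" by (intro holomorphic_intros)
    have "k * real n powr s \<le> HB_norm s p q (\<lambda>z. z ^ n)"
      unfolding k_def using s by (intro HB_norm_monomial_lower p q n) auto
    also have "\<dots> \<le> C * Lp_mu \<mu> p (\<lambda>z. z ^ n)"
      using s by (intro C entire_in_HB hol p q continuous_intros) auto
    also have "Lp_mu \<mu> p (\<lambda>z. z ^ n) \<le> 1 * measure \<mu> UNIV powr (1 / p)"
      by (rule Lp_mu_le[OF \<mu> _ p]) (auto simp: norm_power power_le_one)
    finally show ?thesis using C(1) by (simp add: K_def)
  qed
  have "filterlim (\<lambda>n. k * real n powr s) at_top sequentially"
    using s k by real_asymp
  then have "\<forall>\<^sub>F n in sequentially. K + 1 \<le> k * real n powr s"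
    by (simp add: filterlim_at_top)
  then have "\<forall>\<^sub>F n in sequentially. False"
    using eventually_ge_at_top[of "2 * besov_m s"] by eventually_elim (use bound in fastforce)
  then show False by simp
qed

subsection \<open>Modulation by high powers\<close>

lemma deriv_add_modulation:
  assumes "F holomorphic_on UNIV" "g holomorphic_on UNIV"
  shows "deriv (\<lambda>z. F z + z ^ n * g z) z = deriv F z + (of_nat n * z ^ (n - 1) * g z + z ^ n * deriv g z)"
proof -
  have "(F has_field_derivative deriv F z) (at z)" "(g has_field_derivative deriv g z) (at z)"
    using assms by (auto intro!: holomorphic_derivI[of _ UNIV])
  then have "((\<lambda>z. F z + z ^ n * g z) has_field_derivative
      (deriv F z + (of_nat n * z ^ (n - 1) * g z + z ^ n * deriv g z))) (at z)"
    by (auto intro!: derivative_eq_intros simp: algebra_simps)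
  then show ?thesis by (rule DERIV_imp_deriv)
qed

text \<open>A triangle inequality for p-th powers with a loss of 2^p, which is harmless: it only
  enters the constant 16 in \<open>modulated_circ_Lp_lower\<close>.\<close>

lemma powr_add_le:
  fixes x y p :: real
  assumes "0 \<le> x" "0 \<le> y" "0 < p"
  shows "(x + y) powr p \<le> 2 powr p * (x powr p + y powr p)"
proof -
  have "(x + y) powr p \<le> (2 * max x y) powr p" using assms by (intro powr_mono2) auto
  also have "\<dots> = 2 powr p * max x y powr p" using assms by (simp add: powr_mult)
  also have "\<dots> \<le> 2 powr p * (x powr p + y powr p)"
    by (intro mult_left_mono) (auto simp: max_def)
  finally show ?thesis .
qed

text \<open>The term n z^(n-1) g dominates, since the rest of the derivative stays below a bound
  \<open>D\<close> independent of n. The constant 16 collects four factors 2: one for r^(n-1) \<ge>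
  1/2, one for the norm of g at radius r instead of 1, one from \<open>powr_add_le\<close>, and one
  for absorbing \<open>D\<close>.\<close>

lemma modulated_circ_Lp_lower:
  assumes F: "F holomorphic_on UNIV" and g: "g holomorphic_on UNIV" and p: "1 \<le> p"
    and G: "0 < circ_Lp p g 1"
  shows "\<forall>\<^sub>F n in sequentially. \<forall>r. 1 - 1 / (2 * real n) \<le> r \<longrightarrow> r \<le> 1 \<longrightarrow>
    real n * circ_Lp p g 1 / 16 \<le> circ_Lp p (deriv (\<lambda>z. F z + z ^ n * g z)) r"
proof -
  define G where "G = circ_Lp p g 1"
  have dF: "deriv F holomorphic_on UNIV" and dg: "deriv g holomorphic_on UNIV"
    using F g by (auto intro: holomorphic_deriv)
  obtain B1 where B1: "0 < B1" "\<And>z. norm z \<le> 1 \<Longrightarrow> norm (deriv F z) \<le> B1" using entire_bounded_on_disc[OF dF] by metis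
  obtain B2 where B2: "0 < B2" "\<And>z. norm z \<le> 1 \<Longrightarrow> norm (deriv g z) \<le> B2" using entire_bounded_on_disc[OF dg] by metis
  define D where "D = B1 + B2"
  have D: "0 < D" using B1 B2 by (simp add: D_def)
  have "continuous_on {0..1} (circ_Lp p g)"
    by (rule continuous_on_circ_Lp[of UNIV]) (use p g in \<open>auto intro: holomorphic_on_imp_continuous_on\<close>)
  then have "\<forall>e>0. \<exists>d>0. \<forall>x'\<in>{0..1}. dist x' 1 < d \<longrightarrow> dist (circ_Lp p g x') (circ_Lp p g 1) < e"
    unfolding continuous_on_iff by simp
  then obtain d where d: "d > 0" "\<And>r. r \<in> {0..1} \<Longrightarrow> dist r 1 < d \<Longrightarrow> dist (circ_Lp p g r) (circ_Lp p g 1) < G / 2"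
    using G by (auto simp: G_def dest!: spec[of _ "circ_Lp p g 1 / 2"])
  have "\<forall>\<^sub>F n in sequentially. 1 / (2 * real n) < d \<and> D \<le> real n * G / 16 \<and> 0 < n"
  proof (intro eventually_conj)
    show "\<forall>\<^sub>F n in sequentially. 1 / (2 * real n) < d" using d(1) by real_asymp
    have "0 < G" using G by (simp add: G_def)
    then have "filterlim (\<lambda>n. real n * G / 16) at_top sequentially" by real_asymp
    then show "\<forall>\<^sub>F n in sequentially. D \<le> real n * G / 16" by (simp add: filterlim_at_top)
  qed (rule eventually_gt_at_top)
  then show ?thesis
  proof eventually_elim
    case (elim n)
    show ?case
    proof (intro allI impI)
      fix r assume r: "1 - 1 / (2 * real n) \<le> r" "r \<le> 1"
      have "1 / (2 * real n) \<le> 1" using elim by (simp add: field_simps)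
      then have r0: "0 \<le> r" using r by linarith
      have Gr: "G / 2 \<le> circ_Lp p g r"
      proof -
        have "dist r 1 < d" using r elim by (auto simp: dist_real_def)
        then have "\<bar>circ_Lp p g r - G\<bar> < G / 2" using d(2)[of r] r r0 by (auto simp: dist_real_def G_def)
        then show ?thesis by linarith
      qed
      define H where "H = deriv (\<lambda>z. F z + z ^ n * g z)"
      have holH: "H holomorphic_on UNIV"
        unfolding H_def using F g by (intro holomorphic_deriv holomorphic_intros) auto
      define L where "L = circ_Lp p H r"
      have cH: "continuous_on (sphere 0 1) (\<lambda>w. norm (H (complex_of_real r * w)) powr p)"
        and cg: "continuous_on (sphere 0 1) (\<lambda>w. norm (g (complex_of_real r * w)) powr p)"
        using p by (auto intro!: continuous_on_powr_nonneg continuous_on_norm entire_continuous_circle holH g)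
      have pt: "(real n / 2) powr p * norm (g (complex_of_real r * w)) powr p
          \<le> 2 powr p * norm (H (complex_of_real r * w)) powr p + 2 powr p * D powr p" if w: "norm w = 1" for w
      proof -
        define z where "z = complex_of_real r * w"
        have z: "norm z = r" using w r0 by (simp add: z_def norm_mult)
        have "H z = deriv F z + (of_nat n * z ^ (n - 1) * g z + z ^ n * deriv g z)"
          unfolding H_def by (rule deriv_add_modulation[OF F g])
        then have "of_nat n * z ^ (n - 1) * g z = H z - (deriv F z + z ^ n * deriv g z)" by simp
        then have "norm (of_nat n * z ^ (n - 1) * g z) \<le> norm (H z) + norm (deriv F z + z ^ n * deriv g z)"
          by (metis norm_triangle_ineq4)
        also have "norm (deriv F z + z ^ n * deriv g z) \<le> norm (deriv F z) + norm (z ^ n * deriv g z)"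
          by (rule norm_triangle_ineq)
        also have "norm (deriv F z) \<le> B1" using z r by (intro B1) auto
        also have "norm (z ^ n * deriv g z) \<le> 1 * B2"
          unfolding norm_mult norm_power using z r r0 by (intro mult_mono B2 power_le_one) auto
        finally have 1: "real n * (r ^ (n - 1) * norm (g z)) \<le> norm (H z) + D"
          using z by (simp add: norm_mult norm_power D_def mult.assoc)
        have "real n * (1 / 2 * norm (g z)) \<le> real n * (r ^ (n - 1) * norm (g z))"
          using elim r by (intro mult_left_mono mult_right_mono power_ge_half[of n]) auto
        with 1 have "real n / 2 * norm (g z) \<le> norm (H z) + D" by simp
        then have "(real n / 2 * norm (g z)) powr p \<le> (norm (H z) + D) powr p"
          using p by (intro powr_mono2) auto
        also have "\<dots> \<le> 2 powr p * (norm (H z) powr p + D powr p)"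
          using D p by (intro powr_add_le) auto
        finally show ?thesis unfolding z_def powr_mult by (simp only: distrib_left)
      qed
      have mean_eq: "circ_mean (\<lambda>w. norm (f (complex_of_real r * w)) powr p) = circ_Lp p f r powr p"
        if "f holomorphic_on UNIV" for f
        using p circ_mean_nonneg[of "\<lambda>w. norm (f (complex_of_real r * w)) powr p"]
        by (simp add: circ_Lp_powr[OF entire_continuous_circle[OF that]])
      have "(real n / 2 * circ_Lp p g r) powr p = circ_mean (\<lambda>w. (real n / 2) powr p * norm (g (complex_of_real r * w)) powr p)"
        unfolding circ_mean_cmult mean_eq[OF g] by (rule powr_mult)
      also have "\<dots> \<le> circ_mean (\<lambda>w. 2 powr p * norm (H (complex_of_real r * w)) powr p + 2 powr p * D powr p)"
        by (intro circ_mean_mono continuous_on_add continuous_on_mult continuous_on_const cH cg pt)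
      also have "\<dots> = 2 powr p * L powr p + 2 powr p * D powr p"
        unfolding L_def mean_eq[OF holH, symmetric] circ_mean_cmult[symmetric]
        by (subst circ_mean_add) (intro continuous_on_mult continuous_on_const cH | simp)+
      finally have "(real n / 2 * circ_Lp p g r) powr p \<le> 2 powr p * (L powr p + D powr p)"
        by (simp add: algebra_simps)
      moreover have "(real n * G / 4) powr p \<le> (real n / 2 * circ_Lp p g r) powr p"
      proof (rule powr_mono2)
        have "real n * (G / 2) \<le> real n * circ_Lp p g r" by (intro mult_left_mono Gr) simp
        then show "real n * G / 4 \<le> real n / 2 * circ_Lp p g r" by linarith
      qed (use p G in \<open>auto simp: G_def\<close>)
      moreover have "(real n * G / 4) powr p = 2 powr p * (2 powr p * (real n * G / 16) powr p)"
      proof -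
        have "real n * G / 4 = 2 * (2 * (real n * G / 16))" by simp
        then show ?thesis using G by (simp only: powr_mult)
      qed
      ultimately have "2 powr p * (2 powr p * (real n * G / 16) powr p) \<le> 2 powr p * (L powr p + D powr p)"
        by linarith
      then have *: "2 powr p * (real n * G / 16) powr p \<le> L powr p + D powr p"
        by (rule mult_left_le_imp_le) simp
      have "real n * G / 16 \<le> L"
      proof (rule ccontr)
        assume "\<not> ?thesis"
        then have "L powr p < (real n * G / 16) powr p"
          using p by (intro powr_less_mono2) (auto simp: L_def circ_Lp_nonneg)
        moreover have "D powr p \<le> (real n * G / 16) powr p"
          using elim D p by (intro powr_mono2) auto
        ultimately have "L powr p + D powr p < 2 * (real n * G / 16) powr p" by simp
        also have "\<dots> \<le> 2 powr p * (real n * G / 16) powr p"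
          using p powr_mono[of 1 p 2] by (intro mult_right_mono) auto
        finally show False using * by simp
      qed
      then show "real n * circ_Lp p g 1 / 16 \<le> circ_Lp p (deriv (\<lambda>z. F z + z ^ n * g z)) r"
        by (simp add: L_def H_def G_def)
    qed
  qed
qed

lemma HB_norm_modulated_lower:
  assumes g: "g holomorphic_on UNIV" and p: "1 \<le> p" and q: "0 < q" and G: "0 < circ_Lp p g 1"
  shows "\<forall>\<^sub>F n in sequentially.
    2 powr (- 1 / real_of_ereal q) * (circ_Lp p g 1 / 64) \<le> HB_norm 0 p q (\<lambda>z. z ^ n * g z)"
proof -
  have "\<forall>\<^sub>F n in sequentially. \<forall>r. 1 - 1 / (2 * real n) \<le> r \<longrightarrow> r \<le> 1 \<longrightarrow>
      real n * circ_Lp p g 1 / 16 \<le> circ_Lp p (deriv (\<lambda>z. 0 + z ^ n * g z)) r"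
    by (rule modulated_circ_Lp_lower[OF _ g p G]) simp
  then show ?thesis using eventually_gt_at_top[of 0]
  proof eventually_elim
    case (elim n)
    have hol: "(\<lambda>z. z ^ n * g z) holomorphic_on UNIV" using g by (intro holomorphic_intros)
    have n: "0 < n" using elim by simp
    define \<delta> where "\<delta> = 1 / (2 * real n)"
    have \<delta>: "0 < \<delta>" "\<delta> < 1" using n by (auto simp: \<delta>_def field_simps)
    have "2 powr (- 1 / real_of_ereal q) * ((real n * circ_Lp p g 1 / 16) * (\<delta> / 2) powr (real (besov_m 0) - 0))
        \<le> HB_norm 0 p q (\<lambda>z. z ^ n * g z)"
    proof (rule HB_norm_dyadic_lower[OF entire_in_HB[OF hol] _ q \<delta>])
      fix r assume "1 - \<delta> \<le> r" "r \<le> 1 - \<delta> / 2"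
      then show "real n * circ_Lp p g 1 / 16 \<le> circ_Lp p ((deriv ^^ besov_m 0) (\<lambda>z. z ^ n * g z)) r"
        using elim(1) \<delta> by (simp add: \<delta>_def)
    qed (use p q G in auto)
    \<comment> \<open>Here \<open>\<delta> / 2\<close> is 1/(4 n): the weight cancels the n from the
      derivative and turns 16 into 64, so the bound does not depend on n.\<close>
    also have "(real n * circ_Lp p g 1 / 16) * (\<delta> / 2) powr (real (besov_m 0) - 0) = circ_Lp p g 1 / 64"
      using n \<delta> by (simp add: \<delta>_def)
    finally show ?case .
  qed
qed

text \<open>At a fixed radius r < 1 the modulated block is invisible for large n, as n r^(n-1) tends
  to 0; the same null sequence is bounded and provides the dominating constant.\<close>

lemma circ_Lp_modulated_tendsto:
  assumes F: "F holomorphic_on UNIV" and g: "g holomorphic_on UNIV" and p: "0 < p" and r: "0 < r" "r < 1"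
  shows "(\<lambda>n. circ_Lp p (deriv (\<lambda>z. F z + z ^ n * g z)) r) \<longlonglongrightarrow> circ_Lp p (deriv F) r"
proof -
  define H where "H n = deriv (\<lambda>z. F z + z ^ n * g z)" for n
  have holH: "H n holomorphic_on UNIV" for n
    unfolding H_def using F g by (intro holomorphic_deriv holomorphic_intros) auto
  have dF: "deriv F holomorphic_on UNIV" and dg: "deriv g holomorphic_on UNIV"
    using F g by (auto intro: holomorphic_deriv)
  obtain B where B: "0 < B" "\<And>z. norm z \<le> 1 \<Longrightarrow> norm (deriv F z) \<le> B" using entire_bounded_on_disc[OF dF] by metis
  obtain B1 where B1: "0 < B1" "\<And>z. norm z \<le> 1 \<Longrightarrow> norm (g z) \<le> B1" using entire_bounded_on_disc[OF g] by metis
  obtain B2 where B2: "0 < B2" "\<And>z. norm z \<le> 1 \<Longrightarrow> norm (deriv g z) \<le> B2" using entire_bounded_on_disc[OF dg] by metis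
  have e0: "(\<lambda>n. real n * r ^ (n - 1) * B1 + r ^ n * B2) \<longlonglongrightarrow> 0"
    using r by real_asymp
  then have "Bseq (\<lambda>n. real n * r ^ (n - 1) * B1 + r ^ n * B2)"
    by (intro convergent_imp_Bseq) (auto simp: convergent_def)
  then obtain K where K: "\<And>n. \<bar>real n * r ^ (n - 1) * B1 + r ^ n * B2\<bar> \<le> K"
    unfolding Bseq_def by auto
  have diff: "norm (H n z - deriv F z) \<le> real n * r ^ (n - 1) * B1 + r ^ n * B2" if z: "norm z = r" for n z
  proof -
    have "norm (H n z - deriv F z) \<le> norm (of_nat n * z ^ (n - 1) * g z) + norm (z ^ n * deriv g z)"
      unfolding H_def deriv_add_modulation[OF F g] by (simp add: norm_triangle_ineq)
    also have "\<dots> \<le> real n * r ^ (n - 1) * B1 + r ^ n * B2"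
      unfolding norm_mult norm_power norm_of_nat z using z r
      by (intro add_mono mult_left_mono B1 B2) auto
    finally show ?thesis .
  qed
  define z where "z t = complex_of_real r * cis (2 * pi * t)" for t
  have z: "norm (z t) = r" for t using r by (simp add: z_def norm_mult)
  have "(\<lambda>n. integral {0..1} (\<lambda>t. norm (H n (z t)) powr p)) \<longlonglongrightarrow> integral {0..1} (\<lambda>t. norm (deriv F (z t)) powr p)"
  proof (rule dominated_convergence(2))
    fix n
    have "continuous_on (sphere 0 1) (\<lambda>w. norm (H n (complex_of_real r * w)) powr p)"
      using p by (intro continuous_on_powr_nonneg continuous_on_norm entire_continuous_circle holH) auto
    from integrable_circ[OF this] show "(\<lambda>t. norm (H n (z t)) powr p) integrable_on {0..1}"
      by (simp add: z_def)
    show "(\<lambda>t::real. (B + K) powr p) integrable_on {0..1}" by (rule integrable_const_ivl)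
    fix t :: real
    have "norm (H n (z t)) \<le> norm (deriv F (z t)) + norm (H n (z t) - deriv F (z t))"
      by (metis add_diff_cancel_left' diff_add_cancel norm_triangle_sub)
    also have "\<dots> \<le> B + K"
      using B(2)[of "z t"] diff[OF z, of n t] K[of n] z[of t] r by (intro add_mono) auto
    finally show "norm (norm (H n (z t)) powr p) \<le> (B + K) powr p"
      using p by (simp add: powr_mono2)
  next
    fix t :: real
    have "(\<lambda>n. norm (H n (z t) - deriv F (z t))) \<longlonglongrightarrow> 0"
      by (rule Lim_null_comparison[OF _ e0]) (use diff[OF z] in auto)
    then have "(\<lambda>n. H n (z t)) \<longlonglongrightarrow> deriv F (z t)"
      by (simp add: tendsto_norm_zero_iff LIM_zero_iff)
    then show "(\<lambda>n. norm (H n (z t)) powr p) \<longlonglongrightarrow> norm (deriv F (z t)) powr p"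
      using p by (intro tendsto_powr' tendsto_norm tendsto_const) auto
  qed
  then have "(\<lambda>n. circ_mean (\<lambda>w. norm (H n (complex_of_real r * w)) powr p))
      \<longlonglongrightarrow> circ_mean (\<lambda>w. norm (deriv F (complex_of_real r * w)) powr p)"
    by (simp add: circ_mean_def z_def)
  then have "(\<lambda>n. circ_mean (\<lambda>w. norm (H n (complex_of_real r * w)) powr p) powr (1 / p))
      \<longlonglongrightarrow> circ_mean (\<lambda>w. norm (deriv F (complex_of_real r * w)) powr p) powr (1 / p)"
    using p by (intro tendsto_powr' tendsto_const) (auto intro!: always_eventually circ_mean_nonneg)
  then show ?thesis
    by (simp add: circ_Lp_eq[OF entire_continuous_circle[OF holH] p] circ_Lp_eq[OF entire_continuous_circle[OF dF] p] flip: H_def)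
qed

lemma besov_part_0_eq:
  "0 < q \<Longrightarrow> besov_part 0 p (ereal q) f =
    (\<integral>\<^sup>+r\<in>{0<..<1}. ennreal ((circ_Lp p (deriv f) r * (1 - r) powr (1 - 1 / q)) powr q) \<partial>lborel)"
  by (simp add: besov_part_def)

text \<open>Quasi-orthogonality: for large n the derivative of z^n g lives on radii of size 1 - 1/n,
  where the derivative of F contributes nothing; Fatou's lemma handles the remaining radii.\<close>

lemma besov_part_add_modulation:
  assumes F: "F holomorphic_on UNIV" and g: "g holomorphic_on UNIV" and p: "1 \<le> p" and q: "0 < q"
    and G: "0 < G" "G \<le> circ_Lp p g 1"
  shows "\<forall>\<^sub>F n in sequentially. besov_part 0 p (ereal q) F + ennreal ((G / 64) powr q / 4)
    \<le> besov_part 0 p (ereal q) (\<lambda>z. F z + z ^ n * g z)"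
proof -
  define I where "I f r = ennreal ((circ_Lp p (deriv f) r * (1 - r) powr (1 - 1 / q)) powr q)" for f r
  define Fn where "Fn n z = F z + z ^ n * g z" for n z
  define \<delta> where "\<delta> n = 1 / (2 * real n)" for n
  \<comment> \<open>A quarter instead of the half in \<open>besov_dyadic_lower\<close>: the ring
    contributes k + k, and one k pays for the loss in Fatou's lemma.\<close>
  define k where "k = (G / 64) powr q / 4"
  have k: "0 < k" using G by (simp add: k_def)
  have holFn: "Fn n holomorphic_on UNIV" for n unfolding Fn_def using F g by (intro holomorphic_intros)
  have meas: "(\<lambda>r. I f r * indicator S r) \<in> borel_measurable borel"
    if f: "f holomorphic_on UNIV" and S: "S \<subseteq> {0..<1}" "S \<in> sets borel" for f S
  proof -
    have df: "deriv f holomorphic_on UNIV" using f by (auto intro: holomorphic_deriv)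
    have "continuous_on S (\<lambda>r. (circ_Lp p (deriv f) r * (1 - r) powr (1 - 1 / q)) powr q)"
      using p q S
      by (intro continuous_on_powr_nonneg continuous_intros continuous_on_circ_Lp[of UNIV] holomorphic_on_imp_continuous_on df
         mult_nonneg_nonneg circ_Lp_nonneg) auto
    from borel_measurable_continuous_on_indicator[OF S(2) this]
    have "(\<lambda>r. ennreal (indicator S r * (circ_Lp p (deriv f) r * (1 - r) powr (1 - 1 / q)) powr q)) \<in> borel_measurable borel"
      by simp
    also have "(\<lambda>r. ennreal (indicator S r * (circ_Lp p (deriv f) r * (1 - r) powr (1 - 1 / q)) powr q)) = (\<lambda>r. I f r * indicator S r)"
      by (auto simp: indicator_def fun_eq_iff I_def)
    finally show ?thesis .
  qed
  have \<delta>0: "0 \<le> \<delta> n" for n by (simp add: \<delta>_def)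
  \<comment> \<open>Only the radii below the ring, so that nothing is counted twice when the ring is
    added.\<close>
  define h where "h n r = I (Fn n) r * indicator {0<..<1 - \<delta> n} r" for n r
  have hmeas: "h n \<in> borel_measurable lborel" for n
  proof -
    have "{0<..<1 - \<delta> n} \<subseteq> {0..<1}" using \<delta>0[of n] by auto
    from meas[OF holFn this, of n] show ?thesis unfolding h_def[abs_def] by simp
  qed
  have lim: "liminf (\<lambda>n. h n r) = I F r * indicator {0<..<1} r" for r
  proof (rule lim_imp_Liminf)
    show "(\<lambda>n. h n r) \<longlonglongrightarrow> I F r * indicator {0<..<1} r"
    proof (cases "r \<in> {0<..<1}")
      case True
      have "(\<lambda>n. I (Fn n) r) \<longlonglongrightarrow> I F r"
        unfolding I_def Fn_def using True q p
        by (intro tendsto_ennrealI tendsto_powr' tendsto_mult tendsto_const circ_Lp_modulated_tendsto F g)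
           (auto intro!: always_eventually mult_nonneg_nonneg circ_Lp_nonneg)
      moreover have "\<forall>\<^sub>F n in sequentially. r < 1 - \<delta> n"
        unfolding \<delta>_def using True by real_asymp
      then have "\<forall>\<^sub>F n in sequentially. I (Fn n) r = h n r"
        by eventually_elim (use True in \<open>simp add: h_def\<close>)
      ultimately have "(\<lambda>n. h n r) \<longlonglongrightarrow> I F r" by (rule Lim_transform_eventually)
      then show ?thesis using True by simp
    next
      case False
      then have "h n r = 0" for n using \<delta>0[of n] by (auto simp: h_def indicator_def)
      then show ?thesis using False by simp
    qed
  qed simp
  define b where "b = besov_part 0 p (ereal q) F"
  have bI: "b = (\<integral>\<^sup>+r\<in>{0<..<1}. I F r \<partial>lborel)" unfolding b_def I_def by (rule besov_part_0_eq[OF q])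
  have bfin: "b < \<infinity>" using entire_in_HB[OF F, of 0 p "ereal q"] p q by (simp add: b_def HB_def)
  have "b \<le> liminf (\<lambda>n. \<integral>\<^sup>+r. h n r \<partial>lborel)"
    unfolding bI lim[symmetric] by (rule nn_integral_liminf[OF hmeas])
  \<comment> \<open>A liminf yields an eventual bound only from a strict inequality. Finiteness of
    \<open>b\<close> provides it, and for \<open>b = 0\<close> the bound is trivial.\<close>
  moreover have "b - ennreal k < b \<or> b = 0"
    using bfin k by (cases b) (auto simp: ennreal_minus intro!: ennreal_lessI)
  ultimately have ev1: "\<forall>\<^sub>F n in sequentially. b \<le> (\<integral>\<^sup>+r. h n r \<partial>lborel) + ennreal k"
  proof (elim disjE)
    assume "b \<le> liminf (\<lambda>n. \<integral>\<^sup>+r. h n r \<partial>lborel)" "b - ennreal k < b"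
    then have "b - ennreal k < liminf (\<lambda>n. \<integral>\<^sup>+r. h n r \<partial>lborel)" by simp
    from less_LiminfD[OF this] show ?thesis
    proof eventually_elim
      case (elim n)
      then have "b - ennreal k \<le> (\<integral>\<^sup>+r. h n r \<partial>lborel)" by simp
      then show ?case by (simp add: ennreal_minus_le_iff add.commute)
    qed
  qed simp
  have "0 < circ_Lp p g 1" using G by linarith
  from modulated_circ_Lp_lower[OF F g p this] ev1 eventually_gt_at_top[of 0]
  show ?thesis
  proof eventually_elim
    case (elim n)
    have n: "0 < n" using elim by simp
    have \<delta>: "0 < \<delta> n" "\<delta> n < 1" using n by (auto simp: \<delta>_def field_simps)
    let ?J = "{1 - \<delta> n..1 - \<delta> n / 2}"
    have "ennreal ((real n * G / 16 * (\<delta> n / 2) powr 1) powr q / 2) \<le> (\<integral>\<^sup>+r\<in>?J. I (Fn n) r \<partial>lborel)"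
      unfolding I_def
    proof (rule besov_dyadic_lower[OF q \<delta>])
      fix r assume r: "1 - \<delta> n \<le> r" "r \<le> 1 - \<delta> n / 2"
      have "real n * G / 16 \<le> real n * circ_Lp p g 1 / 16"
        using G by (intro divide_right_mono mult_left_mono) auto
      also have "\<dots> \<le> circ_Lp p (deriv (Fn n)) r"
        using elim(1) r \<delta> by (simp add: \<delta>_def Fn_def[abs_def])
      finally show "real n * G / 16 \<le> circ_Lp p (deriv (Fn n)) r" .
    qed (use G in auto)
    moreover have "(real n * G / 16 * (\<delta> n / 2) powr 1) powr q / 2 = k + k"
    proof -
      have "real n * G / 16 * (\<delta> n / 2) powr 1 = G / 64" using n \<delta> by (simp add: \<delta>_def)
      then show ?thesis unfolding k_def by (simp only:)
    qed
    ultimately have J: "ennreal k + ennreal k \<le> (\<integral>\<^sup>+r\<in>?J. I (Fn n) r \<partial>lborel)"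
      using k by (simp flip: ennreal_plus)
    have "b + ennreal k \<le> (\<integral>\<^sup>+r. h n r \<partial>lborel) + (ennreal k + ennreal k)"
      using elim(2) by (simp add: add.assoc[symmetric] add_right_mono)
    also have "\<dots> \<le> (\<integral>\<^sup>+r. h n r \<partial>lborel) + (\<integral>\<^sup>+r\<in>?J. I (Fn n) r \<partial>lborel)"
      by (intro add_left_mono J)
    also have "\<dots> = (\<integral>\<^sup>+r. h n r + I (Fn n) r * indicator ?J r \<partial>lborel)"
    proof (rule nn_integral_add[symmetric, OF hmeas])
      have "?J \<subseteq> {0..<1}" using \<delta> by auto
      from meas[OF holFn this, of n] show "(\<lambda>r. I (Fn n) r * indicator ?J r) \<in> borel_measurable lborel" by simp
    qed
    also have "\<dots> \<le> (\<integral>\<^sup>+r\<in>{0<..<1}. I (Fn n) r \<partial>lborel)"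
      using \<delta> by (intro nn_integral_mono) (auto simp: h_def indicator_def)
    also have "\<dots> = besov_part 0 p (ereal q) (Fn n)"
      unfolding I_def by (rule besov_part_0_eq[OF q, symmetric])
    finally show ?case by (simp add: b_def k_def Fn_def[abs_def])
  qed
qed

subsection \<open>Necessity of the arc condition\<close>

lemma Lp_mu_modulated_tendsto:
  assumes \<mu>: "disc_measure \<mu>" and g: "continuous_on (cball 0 1) g" and p: "0 < p"
  shows "(\<lambda>n. Lp_mu \<mu> p (\<lambda>z. z ^ n * g z))
    \<longlonglongrightarrow> enn2real (\<integral>\<^sup>+z\<in>sphere 0 1. ennreal (norm (g z) powr p) \<partial>\<mu>) powr (1 / p)"
proof -
  have fin: "(\<integral>\<^sup>+z\<in>cball 0 1. ennreal (norm (g z) powr p) \<partial>\<mu>) < \<infinity>"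
    by (rule nn_integral_powr_finite[OF \<mu> g p])
  have gS: "continuous_on (sphere 0 1) g" using g by (rule continuous_on_subset) auto
  have "(\<lambda>n. \<integral>\<^sup>+z\<in>cball 0 1. ennreal (norm (z ^ n * g z) powr p) \<partial>\<mu>)
      \<longlonglongrightarrow> (\<integral>\<^sup>+z\<in>sphere 0 1. ennreal (norm (g z) powr p) \<partial>\<mu>)"
  proof (rule nn_integral_dominated_convergence)
    show "(\<lambda>z. ennreal (norm (z ^ n * g z) powr p) * indicator (cball 0 1) z) \<in> borel_measurable \<mu>" for n
      by (intro continuous_on_indicator_powr_measurable \<mu> p continuous_intros g) auto
    show "(\<lambda>z. ennreal (norm (g z) powr p) * indicator (sphere 0 1) z) \<in> borel_measurable \<mu>"
      by (intro continuous_on_indicator_powr_measurable \<mu> p gS) auto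
    show "(\<lambda>z. ennreal (norm (g z) powr p) * indicator (cball 0 1) z) \<in> borel_measurable \<mu>"
      by (intro continuous_on_indicator_powr_measurable \<mu> p g) auto
    have "norm (z ^ n * g z) powr p \<le> norm (g z) powr p" if "norm z \<le> 1" for z n
      using that p by (intro powr_mono2) (auto simp: norm_mult norm_power intro!: mult_left_le_one_le power_le_one)
    then show "AE z in \<mu>. ennreal (norm (z ^ n * g z) powr p) * indicator (cball 0 1) z
        \<le> ennreal (norm (g z) powr p) * indicator (cball 0 1) z" for n
      by (auto simp: indicator_def intro!: ennreal_leI)
    have "(\<lambda>n. ennreal (norm (z ^ n * g z) powr p) * indicator (cball 0 1) z)
        \<longlonglongrightarrow> ennreal (norm (g z) powr p) * indicator (sphere 0 1) z" for z
    proof -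
      consider "norm z < 1" | "norm z = 1" | "norm z > 1" by linarith
      then show ?thesis
      proof cases
        case 1
        have "(\<lambda>n. norm (z ^ n * g z)) \<longlonglongrightarrow> 0"
          using LIMSEQ_power_zero[OF 1] by (intro tendsto_norm_zero tendsto_mult_left_zero)
        then have "(\<lambda>n. norm (z ^ n * g z) powr p) \<longlonglongrightarrow> 0 powr p"
          using p by (intro tendsto_powr' tendsto_const) auto
        then have "(\<lambda>n. ennreal (norm (z ^ n * g z) powr p)) \<longlonglongrightarrow> ennreal 0"
          by (intro tendsto_ennrealI) simp
        then show ?thesis using 1 by simp
      qed (simp_all add: norm_mult norm_power)
    qed
    then show "AE z in \<mu>. (\<lambda>n. ennreal (norm (z ^ n * g z) powr p) * indicator (cball 0 1) z)
        \<longlonglongrightarrow> ennreal (norm (g z) powr p) * indicator (sphere 0 1) z" by simp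
  qed (use fin in auto)
  moreover have "(\<integral>\<^sup>+z\<in>sphere 0 1. ennreal (norm (g z) powr p) \<partial>\<mu>) < \<infinity>"
    by (rule le_less_trans[OF nn_integral_mono fin]) (auto simp: indicator_def)
  ultimately have "(\<lambda>n. enn2real (\<integral>\<^sup>+z\<in>cball 0 1. ennreal (norm (z ^ n * g z) powr p) \<partial>\<mu>))
      \<longlonglongrightarrow> enn2real (\<integral>\<^sup>+z\<in>sphere 0 1. ennreal (norm (g z) powr p) \<partial>\<mu>)"
    by (intro tendsto_enn2real) auto
  then show ?thesis
    unfolding Lp_mu_def using p by (intro tendsto_powr' tendsto_const) auto
qed

text \<open>For all large n the Besov side keeps a fixed multiple of the L^p norm of g, while the
  other side converges to an integral over the circle. What remains compares arc length with
  \<open>\<mu>\<close> on moduli of entire functions, and q survives only through the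
  constant.\<close>

lemma reverse_carleson_imp_circle_bound:
  assumes \<mu>: "disc_measure \<mu>" and rc: "reverse_carleson 0 p q \<mu>" and p: "1 \<le> p" and q: "0 < q"
  obtains c where "0 < c" "\<And>g. g holomorphic_on UNIV \<Longrightarrow>
    c * circ_mean (\<lambda>w. norm (g w) powr p) \<le> enn2real (\<integral>\<^sup>+z\<in>sphere 0 1. ennreal (norm (g z) powr p) \<partial>\<mu>)"
proof -
  obtain C where C: "C > 0" "\<And>f. f \<in> HB 0 p q \<Longrightarrow> continuous_on (cball 0 1) f \<Longrightarrow> HB_norm 0 p q f \<le> C * Lp_mu \<mu> p f"
    using rc unfolding reverse_carleson_def by blast
  define k where "k = 2 powr (- 1 / real_of_ereal q) / 64"
  have k: "0 < k" by (simp add: k_def)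
  show ?thesis
  proof (rule that[of "(k / C) powr p"])
    show "0 < (k / C) powr p" using k C by simp
    fix g :: "complex \<Rightarrow> complex" assume g: "g holomorphic_on UNIV"
    define T where "T = enn2real (\<integral>\<^sup>+z\<in>sphere 0 1. ennreal (norm (g z) powr p) \<partial>\<mu>)"
    have T: "0 \<le> T" by (simp add: T_def)
    have cg: "continuous_on (cball 0 1) g"
      by (intro holomorphic_on_imp_continuous_on holomorphic_on_subset[OF g]) auto
    have mean: "circ_mean (\<lambda>w. norm (g w) powr p) = circ_Lp p g 1 powr p"
      using circ_Lp_powr[OF entire_continuous_circle[OF g, of 1], of p p] p
        circ_mean_nonneg[of "\<lambda>w. norm (g w) powr p"] by simp
    show "(k / C) powr p * circ_mean (\<lambda>w. norm (g w) powr p) \<le> enn2real (\<integral>\<^sup>+z\<in>sphere 0 1. ennreal (norm (g z) powr p) \<partial>\<mu>)"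
    proof (cases "circ_Lp p g 1 = 0")
      case True
      then show ?thesis using p by (simp add: mean)
    next
      case False
      then have G: "0 < circ_Lp p g 1" using circ_Lp_nonneg[of p g 1] by simp
      have "\<forall>\<^sub>F n in sequentially. k * circ_Lp p g 1 \<le> C * Lp_mu \<mu> p (\<lambda>z. z ^ n * g z)"
        using HB_norm_modulated_lower[OF g p q G]
      proof eventually_elim
        case (elim n)
        have hol: "(\<lambda>z. z ^ n * g z) holomorphic_on UNIV" using g by (intro holomorphic_intros)
        have "HB_norm 0 p q (\<lambda>z. z ^ n * g z) \<le> C * Lp_mu \<mu> p (\<lambda>z. z ^ n * g z)"
          using p by (intro C entire_in_HB hol q continuous_intros cg) auto
        then show ?case using elim by (simp add: k_def)
      qed
      moreover have "(\<lambda>n. C * Lp_mu \<mu> p (\<lambda>z. z ^ n * g z)) \<longlonglongrightarrow> C * T powr (1 / p)"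
        unfolding T_def using p by (intro tendsto_mult tendsto_const Lp_mu_modulated_tendsto[OF \<mu> cg]) auto
      ultimately have "k * circ_Lp p g 1 \<le> C * T powr (1 / p)"
        by (intro tendsto_lowerbound[where F = sequentially]) auto
      then have "k / C * circ_Lp p g 1 \<le> T powr (1 / p)" using C(1) by (simp add: field_simps)
      then have "(k / C * circ_Lp p g 1) powr p \<le> (T powr (1 / p)) powr p"
        using p k C(1) G by (intro powr_mono2) auto
      then have "(k / C * circ_Lp p g 1) powr p \<le> T" using p T by (simp add: powr_powr)
      then show ?thesis unfolding mean T_def[symmetric] powr_mult .
    qed
  qed
qed

text \<open>On the circle Re w = (w^2 + 1)/(2 w) and Im w = (w^2 - 1)/(2 i w), so a real polynomial
  becomes a Laurent polynomial in w; the factor w^n clears the negative powers without changing the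
  modulus.\<close>

lemma real_polynomial_function_on_circle:
  fixes P :: "complex \<Rightarrow> real"
  assumes "real_polynomial_function P"
  shows "\<exists>g n. g holomorphic_on UNIV \<and> (\<forall>w. norm w = 1 \<longrightarrow> g w = w ^ n * of_real (P w))"
  using assms
proof (induction rule: real_polynomial_function.induct)
  case (linear f)
  interpret bounded_linear f by fact
  define g where "g w = (w\<^sup>2 + 1) / 2 * of_real (f 1) + (w\<^sup>2 - 1) / (2 * \<i>) * of_real (f \<i>)" for w
  have "g w = w ^ 1 * of_real (f w)" if w: "norm w = 1" for w
  proof -
    have "w = Re w *\<^sub>R 1 + Im w *\<^sub>R \<i>" by (simp add: complex_eq_iff)
    then have "f w = f (Re w *\<^sub>R 1 + Im w *\<^sub>R \<i>)" by simp
    also have "\<dots> = Re w * f 1 + Im w * f \<i>" by (simp only: add scaleR real_scaleR_def)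
    finally have fw: "f w = Re w * f 1 + Im w * f \<i>" .
    have wc: "w * cnj w = 1" using w by (simp flip: complex_norm_square)
    have "w * complex_of_real (Re w) = (w\<^sup>2 + w * cnj w) / 2"
      by (simp add: complex_eq_iff power2_eq_square algebra_simps)
    moreover have "(2 * \<i>) * (w * complex_of_real (Im w)) = w\<^sup>2 - w * cnj w"
      by (simp add: complex_eq_iff power2_eq_square algebra_simps)
    then have "w * complex_of_real (Im w) = (w\<^sup>2 - w * cnj w) / (2 * \<i>)"
      by (simp add: eq_divide_eq mult.commute)
    ultimately have "w * complex_of_real (Re w) = (w\<^sup>2 + 1) / 2" "w * complex_of_real (Im w) = (w\<^sup>2 - 1) / (2 * \<i>)"
      by (simp_all add: wc)
    then show ?thesis
      by (simp only: g_def fw of_real_add of_real_mult power_one_right distrib_left mult.assoc[symmetric])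
  qed
  moreover have "g holomorphic_on UNIV" unfolding g_def by (intro holomorphic_intros) auto
  ultimately show ?case by blast
next
  case (const c)
  show ?case by (intro exI[of _ "\<lambda>w. of_real c"] exI[of _ 0]) auto
next
  case (add f g)
  then obtain F m G n where *: "F holomorphic_on UNIV" "\<And>w. norm w = 1 \<Longrightarrow> F w = w ^ m * of_real (f w)"
    "G holomorphic_on UNIV" "\<And>w. norm w = 1 \<Longrightarrow> G w = w ^ n * of_real (g w)" by metis
  show ?case
    by (intro exI[of _ "\<lambda>w. w ^ n * F w + w ^ m * G w"] exI[of _ "m + n"])
       (auto simp: * power_add algebra_simps intro!: holomorphic_intros)
next
  case (mult f g)
  then obtain F m G n where *: "F holomorphic_on UNIV" "\<And>w. norm w = 1 \<Longrightarrow> F w = w ^ m * of_real (f w)"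
    "G holomorphic_on UNIV" "\<And>w. norm w = 1 \<Longrightarrow> G w = w ^ n * of_real (g w)" by metis
  show ?case
    by (intro exI[of _ "\<lambda>w. F w * G w"] exI[of _ "m + n"])
       (auto simp: * power_add algebra_simps intro!: holomorphic_intros)
qed

text \<open>Stone-Weierstrass gives a real polynomial P near \<phi>, and w^n P(w) extends to an
  entire function of modulus |P| on the circle. Passing from P to |P| cannot increase the distance
  to a nonnegative function.\<close>

lemma entire_modulus_approximation:
  assumes \<phi>: "continuous_on (sphere 0 1) \<phi>" and nonneg: "\<And>w. norm w = 1 \<Longrightarrow> 0 \<le> \<phi> w" and e: "0 < e"
  obtains g where "g holomorphic_on UNIV" "\<And>w. norm w = 1 \<Longrightarrow> \<bar>norm (g w) - \<phi> w\<bar> < e"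
proof -
  obtain P where P: "real_polynomial_function P" "\<And>w. w \<in> sphere 0 1 \<Longrightarrow> \<bar>\<phi> w - P w\<bar> < e"
    using Stone_Weierstrass_real_polynomial_function[OF _ \<phi> e] by (metis compact_sphere)
  obtain g n where g: "g holomorphic_on UNIV" "\<And>w. norm w = 1 \<Longrightarrow> g w = w ^ n * of_real (P w)"
    using real_polynomial_function_on_circle[OF P(1)] by metis
  show ?thesis
  proof (rule that[OF g(1)])
    fix w :: complex assume w: "norm w = 1"
    have "norm (g w) = \<bar>P w\<bar>" using w by (simp add: g norm_mult norm_power)
    then show "\<bar>norm (g w) - \<phi> w\<bar> < e" using P(2)[of w] w nonneg[OF w] by auto
  qed
qed

lemma reverse_carleson_imp_arc_lower_bound:
  assumes \<mu>: "disc_measure \<mu>" and rc: "reverse_carleson 0 p q \<mu>" and p: "1 \<le> p" and q: "0 < q"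
  shows "arc_lower_bound \<mu>"
proof -
  interpret finite_measure \<mu> by (rule disc_measure_finite[OF \<mu>])
  note [measurable_cong] = disc_measure_sets[OF \<mu>]
  obtain c where c: "0 < c" and cb: "\<And>g. g holomorphic_on UNIV \<Longrightarrow>
    c * circ_mean (\<lambda>w. norm (g w) powr p) \<le> enn2real (\<integral>\<^sup>+z\<in>sphere 0 1. ennreal (norm (g z) powr p) \<partial>\<mu>)"
    using reverse_carleson_imp_circle_bound[OF \<mu> rc p q] by metis
  have "c * l \<le> measure \<mu> (circle_arc a l)" if l: "0 \<le> l" "l \<le> 1" for a l
  proof -
    define A where "A = circle_arc a l"
    have A: "compact A" "A \<subseteq> sphere 0 1" "A \<noteq> {}"
      using l by (auto simp: A_def compact_circle_arc circle_arc_subset) (auto simp: circle_arc_def)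
    define \<epsilon> where "\<epsilon> n = 1 / (real n + 2)" for n
    have \<epsilon>: "0 < \<epsilon> n" "\<epsilon> n < 1" for n by (auto simp: \<epsilon>_def)
    \<comment> \<open>Neighbourhoods that decrease to the closed arc; as \<open>\<mu>\<close> is
      finite, their measures converge to that of the arc.\<close>
    define I where "I n = {z. infdist z A < \<epsilon> n}" for n
    have I_sets [measurable]: "I n \<in> sets \<mu>" for n
    proof -
      have "open (I n)" unfolding I_def by (intro open_Collect_less continuous_intros)
      then show ?thesis using disc_measure_sets[OF \<mu>] by simp
    qed
    \<comment> \<open>Tests with a tent function that is 1 on the arc and 0 off \<open>I n\<close>,
      approximated by an entire modulus within \<open>\<epsilon> n\<close>. The last term is the
      price of that error away from the arc.\<close>
    have step: "c * ((1 - \<epsilon> n) powr p * l) \<le> (1 + \<epsilon> n) powr p * measure \<mu> (I n) + \<epsilon> n powr p * measure \<mu> UNIV" for n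
    proof -
      define \<phi> where "\<phi> z = max 0 (1 - infdist z A / \<epsilon> n)" for z
      have c\<phi>: "continuous_on (sphere 0 1) \<phi>" unfolding \<phi>_def using \<epsilon>[of n] by (intro continuous_intros) auto
      obtain g where g: "g holomorphic_on UNIV" "\<And>w. norm w = 1 \<Longrightarrow> \<bar>norm (g w) - \<phi> w\<bar> < \<epsilon> n"
        using entire_modulus_approximation[OF c\<phi> _ \<epsilon>(1)[of n]] by (auto simp: \<phi>_def)
      have "(1 - \<epsilon> n) powr p * l \<le> circ_mean (\<lambda>w. norm (g w) powr p)"
      proof -
        define h where "h t = norm (g (cis (2 * pi * t))) powr p" for t
        have cg: "continuous_on (sphere 0 1) (\<lambda>w. norm (g w) powr p)"
          using p by (intro continuous_on_powr_nonneg continuous_on_norm holomorphic_on_imp_continuous_on holomorphic_on_subset[OF g(1)]) auto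
        have int: "h integrable_on {x..y}" for x y unfolding h_def by (rule integrable_circ[OF cg])
        have "(1 - \<epsilon> n) powr p * l = integral {a..a + l} (\<lambda>t. (1 - \<epsilon> n) powr p)" using l by simp
        also have "\<dots> \<le> integral {a..a + l} h"
        proof (rule integral_le)
          fix t assume "t \<in> {a..a + l}"
          then have "cis (2 * pi * t) \<in> A" by (auto simp: A_def circle_arc_def)
          then have "\<phi> (cis (2 * pi * t)) = 1" by (simp add: \<phi>_def)
          then show "(1 - \<epsilon> n) powr p \<le> h t"
            unfolding h_def using g(2)[of "cis (2 * pi * t)"] p \<epsilon>[of n] by (intro powr_mono2) auto
        qed (auto intro: int integrable_const_ivl)
        also have "\<dots> \<le> integral {a..a + 1} h"
          using l by (intro integral_subset_le int) (auto simp: h_def)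
        also have "\<dots> = circ_mean (\<lambda>w. norm (g w) powr p)"
          unfolding h_def by (rule circ_mean_interval[OF cg])
        finally show ?thesis .
      qed
      then have "c * ((1 - \<epsilon> n) powr p * l) \<le> c * circ_mean (\<lambda>w. norm (g w) powr p)"
        using c by (intro mult_left_mono) auto
      also have "\<dots> \<le> enn2real (\<integral>\<^sup>+z\<in>sphere 0 1. ennreal (norm (g z) powr p) \<partial>\<mu>)" by (rule cb[OF g(1)])
      also have "\<dots> \<le> (1 + \<epsilon> n) powr p * measure \<mu> (I n) + \<epsilon> n powr p * measure \<mu> UNIV"
      proof (rule enn2real_leI)
        have "(\<integral>\<^sup>+z\<in>sphere 0 1. ennreal (norm (g z) powr p) \<partial>\<mu>)
          \<le> (\<integral>\<^sup>+z. ennreal ((1 + \<epsilon> n) powr p) * indicator (I n) z + ennreal (\<epsilon> n powr p) \<partial>\<mu>)"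
        proof (rule nn_integral_mono)
          fix z
          show "ennreal (norm (g z) powr p) * indicator (sphere 0 1) z
            \<le> ennreal ((1 + \<epsilon> n) powr p) * indicator (I n) z + ennreal (\<epsilon> n powr p)"
          proof (cases "z \<in> sphere 0 1")
            case True
            then have gz: "norm (g z) \<le> \<phi> z + \<epsilon> n" using g(2)[of z] by auto
            show ?thesis
            proof (cases "z \<in> I n")
              case True
              have "\<phi> z \<le> 1" using \<epsilon>[of n] infdist_nonneg[of z A] by (simp add: \<phi>_def)
              then have "norm (g z) powr p \<le> (1 + \<epsilon> n) powr p" using gz p by (intro powr_mono2) auto
              then show ?thesis using True by (auto intro!: add_increasing2 ennreal_leI simp: indicator_def)
            next
              case False
              then have "\<phi> z = 0" using \<epsilon>[of n] by (simp add: \<phi>_def I_def)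
              then have "norm (g z) powr p \<le> \<epsilon> n powr p" using gz p by (intro powr_mono2) auto
              then show ?thesis using False by (auto intro!: ennreal_leI simp: indicator_def)
            qed
          qed simp
        qed
        also have "\<dots> = ennreal ((1 + \<epsilon> n) powr p) * emeasure \<mu> (I n) + ennreal (\<epsilon> n powr p) * emeasure \<mu> UNIV"
          using sets_eq_imp_space_eq[OF disc_measure_sets[OF \<mu>]]
          by (subst nn_integral_add) (auto simp: nn_integral_cmult_indicator)
        also have "\<dots> = ennreal ((1 + \<epsilon> n) powr p * measure \<mu> (I n) + \<epsilon> n powr p * measure \<mu> UNIV)"
          by (simp add: emeasure_eq_measure ennreal_mult'')
        finally show "(\<integral>\<^sup>+z\<in>sphere 0 1. ennreal (norm (g z) powr p) \<partial>\<mu>)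
          \<le> ennreal ((1 + \<epsilon> n) powr p * measure \<mu> (I n) + \<epsilon> n powr p * measure \<mu> UNIV)" .
      qed simp
      finally show ?thesis .
    qed
    have \<epsilon>0: "\<epsilon> \<longlonglongrightarrow> 0" unfolding \<epsilon>_def by real_asymp
    have "(\<lambda>n. measure \<mu> (I n)) \<longlonglongrightarrow> measure \<mu> (\<Inter>n. I n)"
    proof (rule finite_Lim_measure_decseq)
      have "\<epsilon> n \<le> \<epsilon> m" if "m \<le> n" for m n using that by (simp add: \<epsilon>_def frac_le)
      then show "decseq I" unfolding I_def decseq_def by (auto intro: less_le_trans)
    qed (use I_sets in auto)
    also have "(\<Inter>n. I n) = A"
    proof
      show "A \<subseteq> (\<Inter>n. I n)" using \<epsilon> by (auto simp: I_def)
      show "(\<Inter>n. I n) \<subseteq> A"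
      proof
        fix z assume "z \<in> (\<Inter>n. I n)"
        then have "infdist z A \<le> \<epsilon> n" for n by (auto simp: I_def less_imp_le)
        then have "infdist z A \<le> 0" by (intro LIMSEQ_le_const[OF \<epsilon>0]) auto
        then have "infdist z A = 0" using infdist_nonneg[of z A] by simp
        then show "z \<in> A" using in_closed_iff_infdist_zero[of A z] A by (auto simp: compact_imp_closed)
      qed
    qed
    finally have I_lim: "(\<lambda>n. measure \<mu> (I n)) \<longlonglongrightarrow> measure \<mu> A" .
    have "(\<lambda>n. c * ((1 - \<epsilon> n) powr p * l)) \<longlonglongrightarrow> c * ((1 - 0) powr p * l)"
      by (intro tendsto_intros \<epsilon>0) auto
    moreover have "(\<lambda>n. (1 + \<epsilon> n) powr p * measure \<mu> (I n) + \<epsilon> n powr p * measure \<mu> UNIV)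
      \<longlonglongrightarrow> (1 + 0) powr p * measure \<mu> A + 0 powr p * measure \<mu> UNIV"
      using p \<epsilon> by (intro tendsto_add tendsto_mult tendsto_powr' tendsto_const \<epsilon>0 I_lim)
        (auto intro!: always_eventually less_imp_le)
    ultimately show ?thesis
      using LIMSEQ_le[of "\<lambda>n. c * ((1 - \<epsilon> n) powr p * l)" _ "\<lambda>n. (1 + \<epsilon> n) powr p * measure \<mu> (I n) + \<epsilon> n powr p * measure \<mu> UNIV"] step p
      by (fastforce simp: A_def)
  qed
  then show ?thesis unfolding arc_lower_bound_def using c by blast
qed

subsection \<open>Non-existence for small q\<close>

text \<open>Closes both counterexamples for small q: N blocks lead to an inequality between two
  powers of N, and only the exponents matter.\<close>

lemma powr_growth_exponent_le:
  fixes a b d K :: real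
  assumes "0 < b" and le: "\<And>N. 0 < N \<Longrightarrow> b * real N powr a \<le> K * real N powr d"
  shows "a \<le> d"
proof (rule ccontr)
  assume "\<not> a \<le> d"
  define e where "e = a - d"
  have e: "0 < e" using \<open>\<not> a \<le> d\<close> by (simp add: e_def)
  have "filterlim (\<lambda>N. b * real N powr e) at_top sequentially" using e \<open>0 < b\<close> by real_asymp
  then have "\<forall>\<^sub>F N in sequentially. K + 1 \<le> b * real N powr e" by (simp add: filterlim_at_top)
  then have "\<forall>\<^sub>F N in sequentially. False" using eventually_gt_at_top[of 0]
  proof eventually_elim
    case (elim N)
    then have "b * real N powr e \<le> K"
      using le[of N] by (simp add: e_def powr_diff field_simps)
    with elim(1) show False by linarith
  qed
  then show False by simp
qed

lemma HB_norm_ge_besov: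
  assumes "f \<in> HB s p (ereal q)" "ennreal X \<le> besov_part s p (ereal q) f" "0 \<le> X" "0 < q"
  shows "X powr (1 / q) \<le> HB_norm s p (ereal q) f"
proof -
  have "X \<le> enn2real (besov_part s p (ereal q) f)"
    using enn2real_mono[OF assms(2)] assms by (simp add: HB_def)
  then have "X powr (1 / q) \<le> enn2real (besov_part s p (ereal q) f) powr (1 / q)"
    using assms by (intro powr_mono2) auto
  moreover have "0 \<le> (\<Sum>j<besov_m s. norm ((deriv ^^ j) f 0))" by (intro sum_nonneg) simp
  ultimately show ?thesis by (simp add: HB_norm_def)
qed

text \<open>The signs are chosen one at a time: by the parallelogram law one of the two choices does not
  increase the squared norm in the (arbitrary) measure by more than the mass of the measure.\<close>

lemma lacunary_sum_with_signs:
  assumes \<mu>: "disc_measure \<mu>" and p: "1 \<le> p" and q: "0 < q"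
  shows "\<exists>F. F holomorphic_on UNIV \<and> ennreal (real N * ((1 / 64) powr q / 4)) \<le> besov_part 0 p (ereal q) F
    \<and> (\<integral>\<^sup>+z\<in>cball 0 1. ennreal (norm (F z) powr 2) \<partial>\<mu>) \<le> ennreal (real N * measure \<mu> UNIV)"
proof (induction N)
  case 0
  show ?case by (intro exI[of _ "\<lambda>_. 0"]) simp
next
  case (Suc N)
  define k where "k = (1 / 64) powr q / 4"
  define M where "M = measure \<mu> UNIV"
  have k: "0 \<le> k" and M: "0 \<le> M" by (auto simp: k_def M_def)
  from Suc obtain F where F: "F holomorphic_on UNIV" "ennreal (real N * k) \<le> besov_part 0 p (ereal q) F"
    "(\<integral>\<^sup>+z\<in>cball 0 1. ennreal (norm (F z) powr 2) \<partial>\<mu>) \<le> ennreal (real N * M)"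
    by (auto simp: k_def M_def)
  define E where "E s n z = F z + z ^ n * s" for s :: complex and n z
  have holE: "E s n holomorphic_on UNIV" for s n unfolding E_def using F(1) by (intro holomorphic_intros)
  \<comment> \<open>The block is z^n times a unimodular constant, so G = 1 here.\<close>
  have ev: "\<forall>\<^sub>F n in sequentially. besov_part 0 p (ereal q) F + ennreal k \<le> besov_part 0 p (ereal q) (E s n)"
    if "norm s = 1" for s
    unfolding E_def[abs_def] k_def
    by (rule besov_part_add_modulation[OF F(1) _ p q]) (use p that in \<open>auto intro!: circ_Lp_ge_const\<close>)
  \<comment> \<open>One exponent n must serve both signs, because the sign is selected only
    afterwards, according to \<open>\<mu>\<close>.\<close>
  have "\<forall>\<^sub>F n in sequentially. besov_part 0 p (ereal q) F + ennreal k \<le> besov_part 0 p (ereal q) (E 1 n)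
      \<and> besov_part 0 p (ereal q) F + ennreal k \<le> besov_part 0 p (ereal q) (E (-1) n)"
    by (intro eventually_conj ev) auto
  then obtain n where n: "besov_part 0 p (ereal q) F + ennreal k \<le> besov_part 0 p (ereal q) (E 1 n)"
      "besov_part 0 p (ereal q) F + ennreal k \<le> besov_part 0 p (ereal q) (E (-1) n)"
    using eventually_happens'[OF sequentially_bot] by blast
  define J where "J f = (\<integral>\<^sup>+z\<in>cball 0 1. ennreal (norm (f z) powr 2) \<partial>\<mu>)" for f :: "complex \<Rightarrow> complex"
  have meas: "(\<lambda>z. ennreal (norm (f z) powr 2) * indicator (cball 0 1) z) \<in> borel_measurable \<mu>"
    if "f holomorphic_on UNIV" for f
    by (intro continuous_on_indicator_powr_measurable[OF \<mu>] holomorphic_on_imp_continuous_on holomorphic_on_subset[OF that]) auto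
  have "J (E 1 n) + J (E (-1) n) = (\<integral>\<^sup>+z. ennreal (norm (E 1 n z) powr 2) * indicator (cball 0 1) z
      + ennreal (norm (E (-1) n z) powr 2) * indicator (cball 0 1) z \<partial>\<mu>)"
    unfolding J_def by (rule nn_integral_add[symmetric]; rule meas[OF holE])
  also have "\<dots> \<le> (\<integral>\<^sup>+z. 2 * (ennreal (norm (F z) powr 2) * indicator (cball 0 1) z) + 2 \<partial>\<mu>)"
  proof (rule nn_integral_mono)
    fix z
    show "ennreal (norm (E 1 n z) powr 2) * indicator (cball 0 1) z + ennreal (norm (E (-1) n z) powr 2) * indicator (cball 0 1) z
       \<le> 2 * (ennreal (norm (F z) powr 2) * indicator (cball 0 1) z) + 2"
    proof (cases "z \<in> cball 0 1")
      case True
      have "(norm (F z + z ^ n))\<^sup>2 + (norm (F z - z ^ n))\<^sup>2 = 2 * (norm (F z))\<^sup>2 + 2 * (norm (z ^ n))\<^sup>2"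
        unfolding cmod_power2 by (simp add: power2_eq_square algebra_simps)
      moreover have "(norm (z ^ n))\<^sup>2 \<le> 1" using True by (simp add: norm_power power_le_one)
      ultimately have "norm (E 1 n z) powr 2 + norm (E (-1) n z) powr 2 \<le> 2 * norm (F z) powr 2 + 2"
        by (simp add: E_def)
      then have "ennreal (norm (E 1 n z) powr 2 + norm (E (-1) n z) powr 2) \<le> ennreal (2 * norm (F z) powr 2 + 2)"
        by (rule ennreal_leI)
      then show ?thesis using True by (simp add: ennreal_mult')
    qed simp
  qed
  also have "\<dots> = 2 * J F + 2 * emeasure \<mu> UNIV"
    using sets_eq_imp_space_eq[OF disc_measure_sets[OF \<mu>]] meas[OF F(1)]
    by (simp add: nn_integral_add nn_integral_cmult J_def)
  also have "\<dots> \<le> 2 * ennreal (real N * M) + 2 * ennreal M"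
    using F(3) finite_measure.emeasure_eq_measure[OF disc_measure_finite[OF \<mu>]]
    by (intro add_mono mult_left_mono) (auto simp: J_def M_def)
  also have "\<dots> = ennreal (real (Suc N) * M) + ennreal (real (Suc N) * M)"
  proof -
    have "ennreal (real (Suc N) * M) = ennreal (real N * M) + ennreal M"
      using M by (simp add: algebra_simps flip: ennreal_plus)
    then show ?thesis unfolding mult_2 by (simp only: add_ac)
  qed
  finally have sum: "J (E 1 n) + J (E (-1) n) \<le> ennreal (real (Suc N) * M) + ennreal (real (Suc N) * M)" .
  have "J (E 1 n) \<le> ennreal (real (Suc N) * M) \<or> J (E (-1) n) \<le> ennreal (real (Suc N) * M)"
  proof (rule ccontr)
    assume "\<not> ?thesis"
    then have "ennreal (real (Suc N) * M) + ennreal (real (Suc N) * M) < J (E 1 n) + J (E (-1) n)"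
      by (intro add_strict_mono) auto
    then show False using sum by simp
  qed
  moreover have "ennreal (real (Suc N) * k) \<le> besov_part 0 p (ereal q) F + ennreal k"
  proof -
    have "ennreal (real (Suc N) * k) = ennreal (real N * k) + ennreal k"
      using k by (simp add: algebra_simps flip: ennreal_plus)
    then show ?thesis using F(2) by (simp add: add_right_mono)
  qed
  ultimately obtain s where "J (E s n) \<le> ennreal (real (Suc N) * M)"
      "ennreal (real (Suc N) * k) \<le> besov_part 0 p (ereal q) (E s n)"
    using n order_trans by metis
  then show ?case using holE[of s n] unfolding J_def k_def M_def by blast
qed

lemma not_reverse_carleson_exponents_below_2:
  assumes \<mu>: "disc_measure \<mu>" and p: "1 \<le> p" "p < 2" and q: "0 < q" "q < 2"
  shows "\<not> reverse_carleson 0 p (ereal q) \<mu>"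
proof
  assume "reverse_carleson 0 p (ereal q) \<mu>"
  then obtain C where C: "C > 0" "\<And>f. f \<in> HB 0 p (ereal q) \<Longrightarrow> continuous_on (cball 0 1) f \<Longrightarrow> HB_norm 0 p (ereal q) f \<le> C * Lp_mu \<mu> p f"
    unfolding reverse_carleson_def by blast
  define k where "k = (1 / 64) powr q / 4"
  have k: "0 < k" by (simp add: k_def)
  define M where "M = measure \<mu> UNIV"
  have "1 / q \<le> 1 / 2"
  proof (rule powr_growth_exponent_le)
    show "0 < k powr (1 / q)" using k by simp
    fix N :: nat assume N: "0 < N"
    obtain F where F: "F holomorphic_on UNIV" "ennreal (real N * k) \<le> besov_part 0 p (ereal q) F"
      "(\<integral>\<^sup>+z\<in>cball 0 1. ennreal (norm (F z) powr 2) \<partial>\<mu>) \<le> ennreal (real N * M)"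
      using lacunary_sum_with_signs[OF \<mu> p(1) q(1), of N] by (auto simp: k_def M_def)
    have FHB: "F \<in> HB 0 p (ereal q)" using F(1) p q by (intro entire_in_HB) auto
    have cF: "continuous_on (cball 0 1) F"
      by (intro holomorphic_on_imp_continuous_on holomorphic_on_subset[OF F(1)]) auto
    \<comment> \<open>The height that balances the two terms of \<open>pt\<close>: since the square
      of F has integral at most N M, each term contributes at most M x^p.\<close>
    define x where "x = sqrt (real N)"
    have x: "0 < x" using N by (simp add: x_def)
    \<comment> \<open>A pointwise substitute for Hoelder on a finite measure, splitting at the
      height x: below it the second term suffices, above it the first does because p - 2 is
      negative.\<close>
    have pt: "y powr p \<le> x powr (p - 2) * y powr 2 + x powr p" if "0 \<le> y" for y
    proof (cases "y \<le> x")
      case True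
      then have "y powr p \<le> x powr p" using that p by (intro powr_mono2) auto
      then show ?thesis by (simp add: add_increasing)
    next
      case False
      have "y powr p = y powr ((p - 2) + 2)" by simp
      also have "\<dots> = y powr (p - 2) * y powr 2" by (rule powr_add)
      finally have "y powr p = y powr (p - 2) * y powr 2" .
      also have "\<dots> \<le> x powr (p - 2) * y powr 2"
        using False x p by (intro mult_right_mono powr_mono2') auto
      finally show ?thesis by (simp add: add_increasing2)
    qed
    have "(\<integral>\<^sup>+z\<in>cball 0 1. ennreal (norm (F z) powr p) \<partial>\<mu>)
        \<le> (\<integral>\<^sup>+z. ennreal (x powr (p - 2)) * (ennreal (norm (F z) powr 2) * indicator (cball 0 1) z) + ennreal (x powr p) \<partial>\<mu>)"
      using pt by (intro nn_integral_mono) (auto simp: indicator_def intro!: ennreal_leI simp flip: ennreal_mult' ennreal_plus)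
    also have "\<dots> = ennreal (x powr (p - 2)) * (\<integral>\<^sup>+z\<in>cball 0 1. ennreal (norm (F z) powr 2) \<partial>\<mu>) + ennreal (x powr p) * ennreal M"
    proof -
      have "(\<lambda>z. ennreal (norm (F z) powr 2) * indicator (cball 0 1) z) \<in> borel_measurable \<mu>"
        by (intro continuous_on_indicator_powr_measurable[OF \<mu> cF]) auto
      then show ?thesis
        using sets_eq_imp_space_eq[OF disc_measure_sets[OF \<mu>]] finite_measure.emeasure_eq_measure[OF disc_measure_finite[OF \<mu>]]
        by (simp add: nn_integral_add nn_integral_cmult M_def)
    qed
    also have "\<dots> \<le> ennreal (x powr (p - 2)) * ennreal (real N * M) + ennreal (x powr p) * ennreal M"
      by (intro add_right_mono mult_left_mono F(3)) simp
    also have "\<dots> = ennreal (2 * M * x powr p)"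
    proof -
      have "x powr (p - 2) * (real N * M) = M * x powr p"
        using x N by (simp add: powr_diff x_def)
      moreover have "0 \<le> M" by (simp add: M_def)
      ultimately show ?thesis
        by (simp add: mult_ac flip: ennreal_mult' ennreal_plus)
    qed
    finally have "enn2real (\<integral>\<^sup>+z\<in>cball 0 1. ennreal (norm (F z) powr p) \<partial>\<mu>) \<le> 2 * M * x powr p"
      by (intro enn2real_leI) (auto simp: M_def)
    then have "Lp_mu \<mu> p F \<le> (2 * M * x powr p) powr (1 / p)"
      unfolding Lp_mu_def using p by (intro powr_mono2) auto
    also have "\<dots> = (2 * M) powr (1 / p) * x" using p x by (simp add: powr_mult powr_powr)
    also have "x = real N powr (1 / 2)" by (simp add: x_def powr_half_sqrt)
    finally have "C * Lp_mu \<mu> p F \<le> C * ((2 * M) powr (1 / p) * real N powr (1 / 2))"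
      using C(1) by (intro mult_left_mono) auto
    moreover have "(real N * k) powr (1 / q) \<le> HB_norm 0 p (ereal q) F"
      using k q by (intro HB_norm_ge_besov[OF FHB F(2)]) auto
    moreover have "HB_norm 0 p (ereal q) F \<le> C * Lp_mu \<mu> p F" by (rule C(2)[OF FHB cF])
    ultimately have "(real N * k) powr (1 / q) \<le> C * ((2 * M) powr (1 / p) * real N powr (1 / 2))" by linarith
    then show "k powr (1 / q) * real N powr (1 / q) \<le> (C * (2 * M) powr (1 / p)) * real N powr (1 / 2)"
      by (simp add: powr_mult mult_ac)
  qed
  then show False using q by (simp add: field_simps)
qed

section \<open>Superposition of bumps on nearly disjoint arcs\<close>

lemma superposition_of_blocks:
  assumes p: "1 \<le> p" and q: "0 < q" and G: "0 < G"
    and g: "\<And>i. g i holomorphic_on UNIV" "\<And>i. G \<le> circ_Lp p (g i) 1"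
  shows "\<exists>F. F holomorphic_on UNIV \<and> ennreal (real N * ((G / 64) powr q / 4)) \<le> besov_part 0 p (ereal q) F
    \<and> (\<forall>z. norm z \<le> 1 \<longrightarrow> norm (F z) \<le> (\<Sum>i<N. norm (g i z)))"
proof (induction N)
  case 0
  show ?case by (intro exI[of _ "\<lambda>_. 0"]) simp
next
  case (Suc N)
  define k where "k = (G / 64) powr q / 4"
  have k: "0 \<le> k" by (simp add: k_def)
  from Suc obtain F where F: "F holomorphic_on UNIV" "ennreal (real N * k) \<le> besov_part 0 p (ereal q) F"
    "\<And>z. norm z \<le> 1 \<Longrightarrow> norm (F z) \<le> (\<Sum>i<N. norm (g i z))"
    by (auto simp: k_def)
  \<comment> \<open>The frequency is chosen after F is fixed, so the new block adds its full share
    to the Besov part; |z^n| \<le> 1 keeps the pointwise bound whatever n is.\<close>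
  obtain n where n: "besov_part 0 p (ereal q) F + ennreal k \<le> besov_part 0 p (ereal q) (\<lambda>z. F z + z ^ n * g N z)"
    using eventually_happens'[OF sequentially_bot besov_part_add_modulation[OF F(1) g(1) p q G g(2)]]
    unfolding k_def by blast
  have "ennreal (real (Suc N) * k) = ennreal (real N * k) + ennreal k"
    using k by (simp add: algebra_simps flip: ennreal_plus)
  also have "\<dots> \<le> besov_part 0 p (ereal q) F + ennreal k" by (intro add_right_mono F)
  also note n
  finally have "ennreal (real (Suc N) * k) \<le> besov_part 0 p (ereal q) (\<lambda>z. F z + z ^ n * g N z)" .
  moreover have "(\<lambda>z. F z + z ^ n * g N z) holomorphic_on UNIV" using F(1) g(1) by (intro holomorphic_intros)
  moreover have "norm (F z + z ^ n * g N z) \<le> (\<Sum>i<Suc N. norm (g i z))" if z: "norm z \<le> 1" for z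
  proof -
    have "norm (z ^ n * g N z) \<le> norm (g N z)"
      using z by (simp add: norm_mult norm_power mult_left_le_one_le power_le_one)
    then show ?thesis using norm_triangle_ineq[of "F z" "z ^ n * g N z"] F(3)[OF z] by simp
  qed
  ultimately show ?case unfolding k_def by blast
qed

lemma sum_roots_of_unity:
  fixes m :: int
  assumes "0 < N" "\<bar>m\<bar> < int N" "m \<noteq> 0"
  shows "(\<Sum>i<N. cis (2 * pi * m / N) ^ i) = 0"
proof -
  define \<zeta> where "\<zeta> = cis (2 * pi * m / N)"
  have "\<zeta> ^ N = cis (2 * pi * m)" using assms unfolding \<zeta>_def Complex.DeMoivre by simp
  also have "\<dots> = 1" by simp
  finally have 1: "\<zeta> ^ N = 1" .
  have "\<zeta> \<noteq> 1"
  proof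
    assume "\<zeta> = 1"
    then have "cos (2 * pi * m / N) = 1" by (simp add: \<zeta>_def complex_eq_iff)
    then obtain j :: int where "2 * pi * m / N = j * 2 * pi" using cos_one_2pi_int by auto
    then have "real_of_int m = j * real N" using assms by (simp add: field_simps)
    then have "m = j * int N" by (metis of_int_eq_iff of_int_mult of_int_of_nat_eq)
    then have "int N dvd m" by simp
    then have "int N \<le> \<bar>m\<bar>" using assms(3) by (intro zdvd_imp_le) auto
    then show False using assms(2) by simp
  qed
  then have "(\<Sum>i<N. \<zeta> ^ i) = (\<zeta> ^ N - 1) / (\<zeta> - 1)" by (rule geometric_sum)
  then show ?thesis using 1 by (simp add: \<zeta>_def)
qed

text \<open>Parseval on the N-th roots of unity: after expanding the squares only the terms with j =
  l survive, which leaves N times the sum of |z|^(2j). The whole closed disc is covered because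
  \<open>\<mu>\<close> may charge the interior.\<close>

lemma sum_norm_rotated_geometric_le:
  fixes z :: complex
  assumes N: "0 < N" and z: "norm z \<le> 1"
  shows "(\<Sum>i<N. (norm (\<Sum>j<N. (cis (2 * pi * real i / real N) * z) ^ j))\<^sup>2) \<le> (real N)\<^sup>2"
proof -
  define c where "c i = cis (2 * pi * real i / N)" for i
  have cc: "c i ^ j * cnj (c i ^ l) = cis (2 * pi * (int j - int l) / N) ^ i" for i j l
  proof -
    have "c i ^ j * cnj (c i ^ l) = cis (real j * (2 * pi * real i / N) - real l * (2 * pi * real i / N))"
      by (simp only: c_def Complex.DeMoivre cis_cnj cis_mult diff_conv_add_uminus)
    also have "real j * (2 * pi * real i / N) - real l * (2 * pi * real i / N)
        = real i * (2 * pi * (int j - int l) / N)"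
      by (simp add: algebra_simps diff_divide_distrib)
    finally show ?thesis by (simp only: Complex.DeMoivre)
  qed
  have "complex_of_real (\<Sum>i<N. (norm (\<Sum>j<N. (c i * z) ^ j))\<^sup>2)
      = (\<Sum>i<N. (\<Sum>j<N. (c i * z) ^ j) * cnj (\<Sum>l<N. (c i * z) ^ l))"
    unfolding complex_norm_square[symmetric] of_real_sum ..
  also have "\<dots> = (\<Sum>i<N. \<Sum>j<N. \<Sum>l<N. z ^ j * cnj (z ^ l) * cis (2 * pi * (int j - int l) / N) ^ i)"
    unfolding cc[symmetric] cnj_sum sum_product
    by (intro sum.cong refl) (simp add: power_mult_distrib)
  also have "\<dots> = (\<Sum>j<N. \<Sum>l<N. z ^ j * cnj (z ^ l) * (\<Sum>i<N. cis (2 * pi * (int j - int l) / N) ^ i))"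
    unfolding sum_distrib_left by (subst sum.swap, rule sum.cong[OF refl], rule sum.swap)
  also have "\<dots> = (\<Sum>j<N. \<Sum>l<N. if l = j then z ^ j * cnj (z ^ j) * of_nat N else 0)"
  proof (intro sum.cong refl)
    fix j l assume jl: "j \<in> {..<N}" "l \<in> {..<N}"
    show "z ^ j * cnj (z ^ l) * (\<Sum>i<N. cis (2 * pi * (int j - int l) / N) ^ i)
        = (if l = j then z ^ j * cnj (z ^ j) * of_nat N else 0)"
    proof (cases "l = j")
      case False
      then show ?thesis using sum_roots_of_unity[OF N, of "int j - int l"] jl by simp
    qed simp
  qed
  also have "\<dots> = (\<Sum>j<N. z ^ j * cnj (z ^ j) * of_nat N)" by (simp add: sum.delta)
  also have "\<dots> = complex_of_real (\<Sum>j<N. (norm (z ^ j))\<^sup>2 * real N)"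
    unfolding complex_norm_square[symmetric] by simp
  finally have "(\<Sum>i<N. (norm (\<Sum>j<N. (c i * z) ^ j))\<^sup>2) = (\<Sum>j<N. (norm (z ^ j))\<^sup>2 * real N)"
    by (simp only: of_real_eq_iff)
  also have "\<dots> \<le> (\<Sum>j<N. 1 * real N)"
    using z by (intro sum_mono mult_right_mono) (auto simp: norm_power power_le_one)
  finally show ?thesis by (simp add: c_def power2_eq_square)
qed

text \<open>On this arc every term has argument at most 2 pi N/(6 N) = pi/3, hence real part at
  least 1/2; this is the origin of the 6.\<close>

lemma norm_geometric_near_1:
  assumes N: "0 < N" and t: "0 \<le> t" "t \<le> 1 / (6 * real N)"
  shows "real N / 2 \<le> norm (\<Sum>j<N. cis (2 * pi * t) ^ j)"
proof -
  have "1 / 2 \<le> Re (cis (2 * pi * t) ^ j)" if j: "j < N" for j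
  proof -
    have "real j * (6 * t) \<le> real N * (1 / real N)"
      using j t N by (intro mult_mono) (auto simp: field_simps)
    then have "real j * (6 * t) \<le> 1" using N by simp
    then have "pi * (real j * (6 * t)) \<le> pi * 1" by (intro mult_left_mono) auto
    then have le: "real j * (2 * pi * t) \<le> pi / 3" by (simp add: algebra_simps)
    have "cos (pi / 3) \<le> cos (real j * (2 * pi * t))"
      using le t by (intro cos_monotone_0_pi_le) auto
    then show ?thesis unfolding Complex.DeMoivre by (simp add: cos_60)
  qed
  then have "(\<Sum>j<N. 1 / 2) \<le> (\<Sum>j<N. Re (cis (2 * pi * t) ^ j))" by (intro sum_mono) auto
  also have "\<dots> \<le> norm (\<Sum>j<N. cis (2 * pi * t) ^ j)"
    unfolding Re_sum[symmetric] by (rule complex_Re_le_cmod)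
  finally show ?thesis by simp
qed

text \<open>The squares of the rotated Dirichlet-type kernels are normalised Fejer kernels: a polynomial
  partition of unity into N bumps, each concentrated on an arc of length about 1/N.\<close>

lemma polynomial_bumps:
  assumes N: "0 < N" and p: "1 \<le> p"
  obtains g :: "nat \<Rightarrow> complex \<Rightarrow> complex" where "\<And>i. g i holomorphic_on UNIV"
    "\<And>z. norm z \<le> 1 \<Longrightarrow> (\<Sum>i<N. norm (g i z)) \<le> 1"
    "\<And>i. 1 / 4 * (6 * real N) powr (- 1 / p) \<le> circ_Lp p (g i) 1"
proof -
  define h where "h w = ((\<Sum>j<N. w ^ j) / of_nat N)\<^sup>2" for w :: complex
  define c where "c i = cis (2 * pi * real i / N)" for i
  have holh: "h holomorphic_on UNIV" unfolding h_def using N by (intro holomorphic_intros) auto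
  have ch: "continuous_on (sphere 0 1) (\<lambda>w. norm (h w) powr p)"
    using p by (intro continuous_on_powr_nonneg continuous_on_norm holomorphic_on_imp_continuous_on holomorphic_on_subset[OF holh]) auto
  show ?thesis
  proof (rule that[of "\<lambda>i w. h (c i * w)"])
    show hol: "(\<lambda>w. h (c i * w)) holomorphic_on UNIV" for i
      by (rule holomorphic_on_compose_gen[OF _ holh, unfolded o_def]) (auto intro!: holomorphic_intros)
    show "(\<Sum>i<N. norm (h (c i * z))) \<le> 1" if "norm z \<le> 1" for z
    proof -
      have "(\<Sum>i<N. norm (h (c i * z))) = (\<Sum>i<N. (norm (\<Sum>j<N. (c i * z) ^ j))\<^sup>2) / (real N)\<^sup>2"
        unfolding h_def norm_power norm_divide power_divide norm_of_nat by (rule sum_divide_distrib[symmetric])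
      also have "\<dots> \<le> 1"
        using sum_norm_rotated_geometric_le[OF N that] N by (simp add: c_def)
      finally show ?thesis .
    qed
    show "1 / 4 * (6 * real N) powr (- 1 / p) \<le> circ_Lp p (\<lambda>w. h (c i * w)) 1" for i
    proof -
      define H where "H t = norm (h (cis (2 * pi * t))) powr p" for t
      have int: "H integrable_on {x..y}" for x y unfolding H_def by (rule integrable_circ[OF ch])
      \<comment> \<open>The bump is at least (1/2)^2 = 1/4 on an arc of length 1/(6 N), and this arc
        alone yields the required norm.\<close>
      have "(1 / 4) powr p * (1 / (6 * real N)) = integral {0..1 / (6 * real N)} (\<lambda>t. (1 / 4) powr p)"
        by simp
      also have "\<dots> \<le> integral {0..1 / (6 * real N)} H"
      proof (rule integral_le)
        fix t assume t: "t \<in> {0..1 / (6 * real N)}"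
        have "(real N / 2)\<^sup>2 \<le> (norm (\<Sum>j<N. cis (2 * pi * t) ^ j))\<^sup>2"
          using norm_geometric_near_1[OF N, of t] t by (intro power_mono) auto
        then have "1 / 4 \<le> norm (h (cis (2 * pi * t)))"
          using N by (simp add: h_def norm_power norm_divide power_divide field_simps)
        then show "(1 / 4) powr p \<le> H t" unfolding H_def using p by (intro powr_mono2) auto
      qed (auto intro: int integrable_const_ivl)
      also have "\<dots> \<le> integral {0..1} H"
        using N by (intro integral_subset_le int) (auto simp: H_def field_simps)
      also have "\<dots> = circ_mean (\<lambda>w. norm (h (c i * w)) powr p)"
        using circ_mean_rotate[OF ch, of "c i"] by (simp add: circ_mean_def H_def[abs_def] c_def)
      finally have "((1 / 4) powr p * (1 / (6 * real N))) powr (1 / p) \<le> circ_mean (\<lambda>w. norm (h (c i * w)) powr p) powr (1 / p)"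
        using p by (intro powr_mono2) auto
      also have "\<dots> = circ_Lp p (\<lambda>w. h (c i * w)) 1"
        using circ_Lp_eq[OF entire_continuous_circle[OF hol[of i], of 1], of p] p by simp
      also have "((1 / 4) powr p * (1 / (6 * real N))) powr (1 / p) = 1 / 4 * (6 * real N) powr (- 1 / p)"
        using p N by (simp add: powr_mult powr_powr powr_minus_divide powr_divide)
      finally show ?thesis .
    qed
  qed
qed

text \<open>N bumps of L^p norm about N^(-1/p) combine to a Besov norm of at least a constant times
  N^(1/q - 1/p), while their superposition stays bounded by 1 on the closed disc, hence bounded in
  L^p of any finite \<open>\<mu>\<close>.\<close>

lemma not_reverse_carleson_q_less_p:
  assumes \<mu>: "disc_measure \<mu>" and p: "1 \<le> p" and q: "0 < q" "q < p"
  shows "\<not> reverse_carleson 0 p (ereal q) \<mu>"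
proof
  assume "reverse_carleson 0 p (ereal q) \<mu>"
  then obtain C where C: "C > 0" "\<And>f. f \<in> HB 0 p (ereal q) \<Longrightarrow> continuous_on (cball 0 1) f \<Longrightarrow> HB_norm 0 p (ereal q) f \<le> C * Lp_mu \<mu> p f"
    unfolding reverse_carleson_def by blast
  \<comment> \<open>256 = 4 * 64 joins the height 1/4 of the bumps to the 64 of the modulation
    bound; (1/4)^(1/q) comes from the quarter in the gain per block.\<close>
  define b where "b = (1 / 4) powr (1 / q) * (6 powr (- 1 / p) / 256)"
  have "1 / q - 1 / p \<le> 0"
  proof (rule powr_growth_exponent_le)
    show "0 < b" by (simp add: b_def)
    fix N :: nat assume N: "0 < N"
    define G where "G = 1 / 4 * (6 * real N) powr (- 1 / p)"
    have G: "0 < G" using N by (simp add: G_def)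
    obtain g :: "nat \<Rightarrow> complex \<Rightarrow> complex" where g: "\<And>i. g i holomorphic_on UNIV"
        "\<And>z. norm z \<le> 1 \<Longrightarrow> (\<Sum>i<N. norm (g i z)) \<le> 1" "\<And>i. G \<le> circ_Lp p (g i) 1"
      using polynomial_bumps[OF N p] unfolding G_def by metis
    obtain F where F: "F holomorphic_on UNIV" "ennreal (real N * ((G / 64) powr q / 4)) \<le> besov_part 0 p (ereal q) F"
        "\<And>z. norm z \<le> 1 \<Longrightarrow> norm (F z) \<le> (\<Sum>i<N. norm (g i z))"
      using superposition_of_blocks[where g = g and N = N, OF p q(1) G g(1) g(3)] by blast
    have FHB: "F \<in> HB 0 p (ereal q)" using F(1) p q by (intro entire_in_HB) auto
    have cF: "continuous_on (cball 0 1) F"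
      by (intro holomorphic_on_imp_continuous_on holomorphic_on_subset[OF F(1)]) auto
    have "(real N * ((G / 64) powr q / 4)) powr (1 / q) \<le> HB_norm 0 p (ereal q) F"
      using q by (intro HB_norm_ge_besov[OF FHB F(2)]) auto
    also have "\<dots> \<le> C * Lp_mu \<mu> p F" by (rule C(2)[OF FHB cF])
    also have "\<dots> \<le> C * (1 * measure \<mu> UNIV powr (1 / p))"
    proof (intro mult_left_mono Lp_mu_le[OF \<mu>])
      show "norm (F z) \<le> 1" if "z \<in> cball 0 1" for z
        using order_trans[OF F(3)[of z] g(2)[of z]] that by simp
    qed (use C(1) p in auto)
    finally have le: "(real N * ((G / 64) powr q / 4)) powr (1 / q) \<le> C * measure \<mu> UNIV powr (1 / p)" by simp
    have "(real N * ((G / 64) powr q / 4)) powr (1 / q) = (real N * (1 / 4) * (G / 64) powr q) powr (1 / q)" by simp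
    also have "\<dots> = real N powr (1 / q) * (1 / 4) powr (1 / q) * (G / 64)"
      unfolding powr_mult powr_powr using q G by simp
    also have "\<dots> = b * (real N powr (1 / q) * real N powr (- 1 / p))"
      using N by (simp add: G_def b_def powr_mult)
    also have "\<dots> = b * real N powr (1 / q - 1 / p)" by (simp flip: powr_add)
    finally show "b * real N powr (1 / q - 1 / p) \<le> (C * measure \<mu> UNIV powr (1 / p)) * real N powr 0"
      using le N by simp
  qed
  then show False using q by (simp add: field_simps)
qed

theorem theorem6p1:
  fixes s p :: real and q :: ereal
  assumes "0 \<le> s" and "1 \<le> p" and "0 < q"
  shows "(0 < s \<longrightarrow> (\<forall>\<mu>. disc_measure \<mu> \<longrightarrow> \<not> reverse_carleson s p q \<mu>))
       \<and> (2 \<le> p \<and> ereal p \<le> q \<longrightarrow>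
            (\<forall>\<mu>. disc_measure \<mu> \<longrightarrow> (reverse_carleson 0 p q \<mu> \<longleftrightarrow> arc_lower_bound \<mu>)))
       \<and> (2 \<le> p \<and> q < ereal p \<longrightarrow> (\<forall>\<mu>. disc_measure \<mu> \<longrightarrow> \<not> reverse_carleson 0 p q \<mu>))
       \<and> (p < 2 \<and> 2 \<le> q \<longrightarrow>
            (\<forall>\<mu>. disc_measure \<mu> \<longrightarrow> (reverse_carleson 0 p q \<mu> \<longleftrightarrow> arc_lower_bound \<mu>)))
       \<and> (p < 2 \<and> q < 2 \<longrightarrow> (\<forall>\<mu>. disc_measure \<mu> \<longrightarrow> \<not> reverse_carleson 0 p q \<mu>))"
proof (intro conjI impI allI)
  \<comment> \<open>The two equivalences of the theorem, for p \<ge> 2 and for p < 2, are together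
    the single condition q \<ge> max(p, 2).\<close>
  have equiv: "reverse_carleson 0 p q \<mu> \<longleftrightarrow> arc_lower_bound \<mu>"
    if "disc_measure \<mu>" "2 \<le> q" "ereal p \<le> q" for \<mu>
    using arc_lower_bound_imp_reverse_carleson[OF that(1) _ assms(2) that(2,3)]
      reverse_carleson_imp_arc_lower_bound[OF that(1) _ assms(2,3)] by blast
  show "\<not> reverse_carleson s p q \<mu>" if "0 < s" "disc_measure \<mu>" for \<mu>
    using not_reverse_carleson_positive_smoothness[OF that(2,1)] assms by simp
  show "reverse_carleson 0 p q \<mu> \<longleftrightarrow> arc_lower_bound \<mu>" if "2 \<le> p \<and> ereal p \<le> q" "disc_measure \<mu>" for \<mu>
  proof (rule equiv[OF that(2)])
    have "2 \<le> ereal p" using that(1) by (simp add: numeral_eq_ereal)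
    then show "2 \<le> q" using that(1) order_trans by blast
  qed (use that in simp)
  show "reverse_carleson 0 p q \<mu> \<longleftrightarrow> arc_lower_bound \<mu>" if "p < 2 \<and> 2 \<le> q" "disc_measure \<mu>" for \<mu>
  proof (rule equiv[OF that(2)])
    have "ereal p \<le> 2" using that(1) by (simp add: numeral_eq_ereal)
    then show "ereal p \<le> q" using that(1) order_trans by blast
  qed (use that in simp)
  show "\<not> reverse_carleson 0 p q \<mu>" if "2 \<le> p \<and> q < ereal p" "disc_measure \<mu>" for \<mu>
    using not_reverse_carleson_q_less_p[OF that(2) assms(2)] that(1) assms(3) by (cases q) auto
  show "\<not> reverse_carleson 0 p q \<mu>" if "p < 2 \<and> q < 2" "disc_measure \<mu>" for \<mu>
    using not_reverse_carleson_exponents_below_2[OF that(2) assms(2)] that(1) assms(3)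
    by (cases q) (auto simp: numeral_eq_ereal)
qed

end
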